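(* Let $m\in\mathbb{N}$, let $E_1,\ldots,E_m$ be Archimedean Riesz spaces, let $F$ be a Riesz space and let $A\colon E_1\times\cdots\times E_m\longrightarrow F$ be a Riesz multimorphism. Then, for every $\rho\in S_m$, the restriction of the Arens extension $AR_m^\rho(A)$ to $(E_1^\sim)_n^\sim\times\cdots\times(E_m^\sim)_n^\sim$ is a Riesz multimorphism.
   Context: All Riesz spaces are real. $E^\sim$ is the order dual of a Riesz space $E$ (the order bounded, equivalently regular, linear functionals), $E^{\sim\sim}=(E^\sim)^\sim$, and $(E^\sim)_n^\sim\subseteq E^{\sim\sim}$ is the subspace of order continuous functionals on $E^\sim$. $S_m$ is the set of permutations of $\{1,\ldots,m\}$. An $m$-linear operator $A\colon E_1\times\cdots\times E_m\to F$ between Riesz spaces is positive if $A(x_1,\ldots,x_m)\ge 0$ whenever all $x_i\ge 0$, and regular if it is a difference of two positive $m$-linear operators; $\mathcal{L}_r(E_1,\ldots,E_m;F)$ is the space of regular $m$-linear operators. A Riesz multimorphism is an $A\in\mathcal{L}_r(E_1,\ldots,E_m;F)$ with $|A(x_1,\ldots,x_m)|=A(|x_1|,\ldots,|x_m|)$ for all $x_i\in E_i$. Arens extensions: fix $\rho\in S_m$. For $0\le k\le m$ let $I_k=\{1,\ldots,m\}\setminus\{\rho(1),\ldots,\rho(k)\}$ and let $\mathcal{L}^{\rho,k}$ be the space of regular $(m-k)$-linear forms on the product of the spaces $E_i$, $i\in I_k$ (in increasing order of indices), with $\mathcal{L}^{\rho,m}=\mathbb{R}$. For $1\le k\le m$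 and $x''\in E_{\rho(k)}^{\sim\sim}$ define $\overline{x''}^{\rho}\colon\mathcal{L}^{\rho,k-1}\to\mathcal{L}^{\rho,k}$ by letting $\overline{x''}^{\rho}(B)\big((x_i)_{i\in I_k}\big)$ be the value of $x''$ at the functional $x_{\rho(k)}\mapsto B\big((x_i)_{i\in I_{k-1}}\big)$ in $E_{\rho(k)}^\sim$. For $A\in\mathcal{L}_r(E_1,\ldots,E_m;F)$ the Arens extension $AR_m^\rho(A)\colon E_1^{\sim\sim}\times\cdots\times E_m^{\sim\sim}\to F^{\sim\sim}$ is $$AR_m^\rho(A)(x_1'',\ldots,x_m'')(y')=\big(\overline{x_{\rho(m)}''}^{\rho}\circ\cdots\circ\overline{x_{\rho(1)}''}^{\rho}\big)(y'\circ A),\quad y'\in F^\sim.$$ *)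

theory Defs
  imports Complex_Main "HOL-Algebra.Module" "HOL-Algebra.Lattice"
    "HOL-Combinatorics.Permutations"
begin

section \<open>Riesz spaces\<close>

text \<open>Riesz spaces are carrier-based, so that a family \<open>E 1, \<dots>, E m\<close> of unrelated spaces
  can be indexed by natural numbers and so that duals, biduals and subspaces of biduals are again
  objects of the same kind. The multiplicative fields \<open>mult\<close> and \<open>one\<close>, inherited
  from \<open>ring\<close> as in every HOL-Algebra module, play no role.\<close>

record 'a ordered_module = "(real, 'a) module" +
  vle :: "'a \<Rightarrow> 'a \<Rightarrow> bool"  (infixl \<open>\<preceq>\<index>\<close> 50)

definition real_ring :: "real ring" where
  "real_ring = \<lparr>carrier = UNIV, monoid.mult = (*), one = 1, zero = 0, add = (+)\<rparr>"

definition order_of :: "('a, 'b) ordered_module_scheme \<Rightarrow> 'a gorder" where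
  "order_of E = \<lparr>carrier = carrier E, eq = (=), le = (\<preceq>\<^bsub>E\<^esub>)\<rparr>"

locale riesz_space = module real_ring E + order?: lattice "order_of E" for E (structure) +
  assumes add_mono:
      "\<lbrakk>x \<in> carrier E; y \<in> carrier E; z \<in> carrier E; x \<preceq> y\<rbrakk> \<Longrightarrow> x \<oplus> z \<preceq> y \<oplus> z"
    and smult_mono:
      "\<lbrakk>x \<in> carrier E; y \<in> carrier E; 0 \<le> c; x \<preceq> y\<rbrakk> \<Longrightarrow> c \<odot> x \<preceq> c \<odot> y"

locale archimedean_riesz_space = riesz_space +
  assumes archimedean:
    "\<lbrakk>x \<in> carrier E; y \<in> carrier E; \<And>n::nat. real n \<odot> x \<preceq> y\<rbrakk> \<Longrightarrow> x \<preceq> \<zero>"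

definition vabs :: "('a, 'b) ordered_module_scheme \<Rightarrow> 'a \<Rightarrow> 'a" where
  "vabs E x = x \<squnion>\<^bsub>order_of E\<^esub> (\<ominus>\<^bsub>E\<^esub> x)"

section \<open>Order duals\<close>

definition linear_functional :: "('a, 'b) ordered_module_scheme \<Rightarrow> ('a \<Rightarrow> real) \<Rightarrow> bool" where
  "linear_functional E f \<longleftrightarrow>
     (\<forall>x\<in>carrier E. \<forall>y\<in>carrier E. f (x \<oplus>\<^bsub>E\<^esub> y) = f x + f y) \<and>
     (\<forall>c. \<forall>x\<in>carrier E. f (c \<odot>\<^bsub>E\<^esub> x) = c * f x)"

definition order_bounded :: "('a, 'b) ordered_module_scheme \<Rightarrow> ('a \<Rightarrow> real) \<Rightarrow> bool" where
  "order_bounded E f \<longleftrightarrow>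
     (\<forall>a\<in>carrier E. \<forall>b\<in>carrier E. \<exists>K. \<forall>x\<in>carrier E. a \<preceq>\<^bsub>E\<^esub> x \<and> x \<preceq>\<^bsub>E\<^esub> b \<longrightarrow> \<bar>f x\<bar> \<le> K)"

text \<open>Functionals are taken to be \<^const>\<open>extensional\<close> on the carrier, so that equality
  of functionals is equality of HOL functions.\<close>

definition order_dual :: "('a, 'b) ordered_module_scheme \<Rightarrow> ('a \<Rightarrow> real) ordered_module" where
  "order_dual E =
     \<lparr>carrier = {f \<in> extensional (carrier E). linear_functional E f \<and> order_bounded E f},
      monoid.mult = undefined, one = undefined,
      zero = (\<lambda>x\<in>carrier E. 0),
      add = (\<lambda>f g. \<lambda>x\<in>carrier E. f x + g x),
      smult = (\<lambda>c f. \<lambda>x\<in>carrier E. c * f x),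
      vle = (\<lambda>f g. \<forall>x\<in>carrier E. \<zero>\<^bsub>E\<^esub> \<preceq>\<^bsub>E\<^esub> x \<longrightarrow> f x \<le> g x)\<rparr>"

text \<open>Order convergence to zero of a net, expressed through the filter on the space which is
  generated by the tails of the net: the net is eventually dominated in absolute value by every
  element of a set that is directed downwards to zero. Quantifying over filters instead of nets
  avoids a quantification over index types.\<close>

definition order_null :: "('a, 'b) ordered_module_scheme \<Rightarrow> 'a filter \<Rightarrow> bool" where
  "order_null E \<F> \<longleftrightarrow>
     (\<exists>D. D \<noteq> {} \<and> D \<subseteq> carrier E \<and>
        (\<forall>a\<in>D. \<forall>b\<in>D. \<exists>d\<in>D. d \<preceq>\<^bsub>E\<^esub> a \<and> d \<preceq>\<^bsub>E\<^esub> b) \<and>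
        is_glb (order_of E) \<zero>\<^bsub>E\<^esub> D \<and>
        (\<forall>d\<in>D. \<forall>\<^sub>F x in \<F>. x \<in> carrier E \<and> vabs E x \<preceq>\<^bsub>E\<^esub> d))"

definition order_continuous :: "('a, 'b) ordered_module_scheme \<Rightarrow> ('a \<Rightarrow> real) \<Rightarrow> bool" where
  "order_continuous E f \<longleftrightarrow> (\<forall>\<F>. order_null E \<F> \<longrightarrow> (f \<longlongrightarrow> 0) \<F>)"

definition oc_order_dual :: "('a, 'b) ordered_module_scheme \<Rightarrow> ('a \<Rightarrow> real) ordered_module" where
  "oc_order_dual E =
     (order_dual E)\<lparr>carrier := {f \<in> carrier (order_dual E). order_continuous E f}\<rparr>"

section \<open>Multilinear operators\<close>

text \<open>Arguments of an \<open>m\<close>-linear operator are extensional families on \<open>{1..m}\<close>.\<close>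

definition tuples :: "nat set \<Rightarrow> (nat \<Rightarrow> ('a, 'b) ordered_module_scheme) \<Rightarrow> (nat \<Rightarrow> 'a) set" where
  "tuples I E = (\<Pi>\<^sub>E i\<in>I. carrier (E i))"

definition multilinear :: "nat \<Rightarrow> (nat \<Rightarrow> ('a, 'b) ordered_module_scheme)
    \<Rightarrow> ('c, 'd) ordered_module_scheme \<Rightarrow> ((nat \<Rightarrow> 'a) \<Rightarrow> 'c) \<Rightarrow> bool" where
  "multilinear m E F A \<longleftrightarrow>
     A \<in> tuples {1..m} E \<rightarrow> carrier F \<and>
     (\<forall>x\<in>tuples {1..m} E. \<forall>i\<in>{1..m}.
        (\<forall>u\<in>carrier (E i). \<forall>v\<in>carrier (E i).
           A (x(i := u \<oplus>\<^bsub>E i\<^esub> v)) = A (x(i := u)) \<oplus>\<^bsub>F\<^esub> A (x(i := v))) \<and>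
        (\<forall>c. \<forall>u\<in>carrier (E i). A (x(i := c \<odot>\<^bsub>E i\<^esub> u)) = c \<odot>\<^bsub>F\<^esub> A (x(i := u))))"

definition positive_multilinear :: "nat \<Rightarrow> (nat \<Rightarrow> ('a, 'b) ordered_module_scheme)
    \<Rightarrow> ('c, 'd) ordered_module_scheme \<Rightarrow> ((nat \<Rightarrow> 'a) \<Rightarrow> 'c) \<Rightarrow> bool" where
  "positive_multilinear m E F A \<longleftrightarrow>
     multilinear m E F A \<and>
     (\<forall>x\<in>tuples {1..m} E. (\<forall>i\<in>{1..m}. \<zero>\<^bsub>E i\<^esub> \<preceq>\<^bsub>E i\<^esub> x i) \<longrightarrow> \<zero>\<^bsub>F\<^esub> \<preceq>\<^bsub>F\<^esub> A x)"

definition regular_multilinear :: "nat \<Rightarrow> (nat \<Rightarrow> ('a, 'b) ordered_module_scheme)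
    \<Rightarrow> ('c, 'd) ordered_module_scheme \<Rightarrow> ((nat \<Rightarrow> 'a) \<Rightarrow> 'c) \<Rightarrow> bool" where
  "regular_multilinear m E F A \<longleftrightarrow>
     (\<exists>P Q. positive_multilinear m E F P \<and> positive_multilinear m E F Q \<and>
        (\<forall>x\<in>tuples {1..m} E. A x = P x \<ominus>\<^bsub>F\<^esub> Q x))"

text \<open>That the domains and the codomain are Riesz spaces is part of the notion; it guarantees
  that the absolute values below exist.\<close>

definition riesz_multimorphism :: "nat \<Rightarrow> (nat \<Rightarrow> ('a, 'b) ordered_module_scheme)
    \<Rightarrow> ('c, 'd) ordered_module_scheme \<Rightarrow> ((nat \<Rightarrow> 'a) \<Rightarrow> 'c) \<Rightarrow> bool" where
  "riesz_multimorphism m E F A \<longleftrightarrow>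
     (\<forall>i\<in>{1..m}. riesz_space (E i)) \<and> riesz_space F \<and>
     regular_multilinear m E F A \<and>
     (\<forall>x\<in>tuples {1..m} E. vabs F (A x) = A (\<lambda>i\<in>{1..m}. vabs (E i) (x i)))"

section \<open>Arens extensions\<close>

definition arens_index :: "nat \<Rightarrow> (nat \<Rightarrow> nat) \<Rightarrow> nat \<Rightarrow> nat set" where
  "arens_index m \<rho> k = {1..m} - \<rho> ` {1..k}"

text \<open>The operator induced by \<open>\<xi>\<close> in the bidual of \<open>E (\<rho> k)\<close>, from forms on the
  product over \<open>arens_index m \<rho> (k - 1)\<close> to forms on the product over
  \<open>arens_index m \<rho> k\<close>.\<close>

definition arens_bar :: "nat \<Rightarrow> (nat \<Rightarrow> ('a, 'b) ordered_module_scheme) \<Rightarrow> (nat \<Rightarrow> nat) \<Rightarrow> nat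
    \<Rightarrow> (('a \<Rightarrow> real) \<Rightarrow> real) \<Rightarrow> ((nat \<Rightarrow> 'a) \<Rightarrow> real) \<Rightarrow> ((nat \<Rightarrow> 'a) \<Rightarrow> real)" where
  "arens_bar m E \<rho> k \<xi> B =
     (\<lambda>x\<in>tuples (arens_index m \<rho> k) E. \<xi> (\<lambda>t\<in>carrier (E (\<rho> k)). B (x(\<rho> k := t))))"

text \<open>\<open>arens_comp m E \<rho> xs k\<close> composes the first \<open>k\<close> of these operators, the one for
  \<open>\<rho> 1\<close> being applied first.\<close>

primrec arens_comp :: "nat \<Rightarrow> (nat \<Rightarrow> ('a, 'b) ordered_module_scheme) \<Rightarrow> (nat \<Rightarrow> nat)
    \<Rightarrow> (nat \<Rightarrow> ('a \<Rightarrow> real) \<Rightarrow> real) \<Rightarrow> nat \<Rightarrow> ((nat \<Rightarrow> 'a) \<Rightarrow> real) \<Rightarrow> ((nat \<Rightarrow> 'a) \<Rightarrow> real)"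
where
  "arens_comp m E \<rho> xs 0 = (\<lambda>B. B)"
| "arens_comp m E \<rho> xs (Suc k) =
     arens_bar m E \<rho> (Suc k) (xs (\<rho> (Suc k))) \<circ> arens_comp m E \<rho> xs k"

text \<open>For \<open>k = m\<close> the product is over the empty index set, whose only element is
  \<open>\<lambda>_. undefined\<close>; forms on it are identified with their single value.\<close>

definition arens_extension :: "nat \<Rightarrow> (nat \<Rightarrow> ('a, 'b) ordered_module_scheme)
    \<Rightarrow> ('c, 'd) ordered_module_scheme \<Rightarrow> (nat \<Rightarrow> nat) \<Rightarrow> ((nat \<Rightarrow> 'a) \<Rightarrow> 'c)
    \<Rightarrow> (nat \<Rightarrow> ('a \<Rightarrow> real) \<Rightarrow> real) \<Rightarrow> (('c \<Rightarrow> real) \<Rightarrow> real)" where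
  "arens_extension m E F \<rho> A =
     (\<lambda>xs\<in>tuples {1..m} (\<lambda>i. order_dual (order_dual (E i))).
        \<lambda>y\<in>carrier (order_dual F).
          arens_comp m E \<rho> xs m (\<lambda>x\<in>tuples {1..m} E. y (A x)) (\<lambda>_. undefined))"

end

(*
  A positive multilinear map into a Riesz space is a Riesz multimorphism as soon as it preserves
  disjointness in each variable. For the Arens extension this means: if xi and eta are disjoint in
  the j-th factor and all other arguments are positive, then every positive functional f on F has
  to split as f = g + (f - g) with the extension vanishing on g when xi is inserted, and on f - g
  when eta is inserted.

  Splittings are produced by a simultaneous version of Nakano's theorem on carriers: a family of
  monotone, subadditive, order continuous gauges on the order dual of F, directed by its index,
  has a common exact splitting if each member has approximate ones. A splitting that works for all
  arguments of one stage of the Arens extension works at the next stage too, because the next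
  functional is evaluated at 0. So it suffices to split once: for two disjoint elements of E_j
  before stage 0 (with the component of f on the disjoint complement of a value of A), and for
  xi and eta at the stage where the j-th variable is extended. There the functional
  h = (t |-> f(.., t, ..)) on E_j is decomposed into disjoint parts u, w and a null part, u and w
  are approximately supported by disjoint elements of E_j, and the splittings already known for
  those elements give approximate splittings for xi and eta.
*)

theory Submission
  imports Defs
begin

text \<open>Splitting f at a single argument of a stage is not enough: the next functional of the
  Arens extension is applied to the whole slice, so one splitting has to serve all positive tuples.
  Approximate splittings do not pass either, since an error that is small at each t says nothing
  about the value of the next functional at the slice. Errors are therefore removed, and the
  splitting is made uniform, before a stage is left; order continuity is what both operations
  consume. A second obstacle is that \<xi> and \<eta> are not tested at points of the space.
  Disjointness of the slice of g from w, and of the slice of f - g from u, takes their place: it can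
  be tested at points y, where splittings are known, and it forces \<xi> and \<eta> to vanish. The
  truncation of a slice by w is not linear in g, and for this reason the separation theorem is set
  up for gauges instead of functionals.\<close>

abbreviation dual :: "('a, 'b) ordered_module_scheme \<Rightarrow> ('a \<Rightarrow> real) ordered_module" where
  "dual \<equiv> order_dual"

abbreviation dual_less_eq :: "('a, 'b) ordered_module_scheme \<Rightarrow> ('a \<Rightarrow> real) \<Rightarrow> ('a \<Rightarrow> real) \<Rightarrow> bool"
  (infixl "\<unlhd>\<index>" 50) where
  "f \<unlhd>\<^bsub>E\<^esub> g \<equiv> f \<preceq>\<^bsub>order_dual E\<^esub> g"

section \<open>Riesz spaces\<close>

definition pcone :: "('a, 'b) ordered_module_scheme \<Rightarrow> 'a set" where
  "pcone E = {x \<in> carrier E. \<zero>\<^bsub>E\<^esub> \<preceq>\<^bsub>E\<^esub> x}"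

lemma order_of_simps [simp]:
  "carrier (order_of E) = carrier E"
  "le (order_of E) = vle E"
  "eq (order_of E) = (=)"
  by (auto simp: order_of_def)

lemma real_ring_simps [simp]:
  "carrier real_ring = UNIV" "\<zero>\<^bsub>real_ring\<^esub> = 0" "\<one>\<^bsub>real_ring\<^esub> = 1"
  "a \<otimes>\<^bsub>real_ring\<^esub> b = a * b" "a \<oplus>\<^bsub>real_ring\<^esub> b = a + b"
  by (auto simp: real_ring_def)

lemma cring_real_ring: "cring real_ring"
proof (rule cringI)
  show "abelian_group real_ring"
  proof (rule abelian_groupI)
    fix x :: real
    show "\<exists>y\<in>carrier real_ring. y \<oplus>\<^bsub>real_ring\<^esub> x = \<zero>\<^bsub>real_ring\<^esub>"
      by (rule bexI[of _ "- x"]) auto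
  qed auto
  show "comm_monoid real_ring"
    by (rule comm_monoidI) auto
qed (simp add: algebra_simps)

abbreviation vsup :: "('a, 'b) ordered_module_scheme \<Rightarrow> 'a \<Rightarrow> 'a \<Rightarrow> 'a" where
  "vsup E x y \<equiv> x \<squnion>\<^bsub>order_of E\<^esub> y"

abbreviation vinf :: "('a, 'b) ordered_module_scheme \<Rightarrow> 'a \<Rightarrow> 'a \<Rightarrow> 'a" where
  "vinf E x y \<equiv> x \<sqinter>\<^bsub>order_of E\<^esub> y"

text \<open>Stated through lower bounds instead of the meet, because \<sqinter> depends on the
  carrier. Disjointness in \<open>dual\<close> and in \<open>oc_order_dual\<close> can then be
  compared by means of the order, which both share. Positivity of the two elements is part of the
  notion.\<close>

definition vdisjoint :: "('a, 'b) ordered_module_scheme \<Rightarrow> 'a \<Rightarrow> 'a \<Rightarrow> bool" where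
  "vdisjoint E x y \<longleftrightarrow> x \<in> pcone E \<and> y \<in> pcone E \<and>
     (\<forall>t\<in>carrier E. t \<preceq>\<^bsub>E\<^esub> x \<longrightarrow> t \<preceq>\<^bsub>E\<^esub> y \<longrightarrow> t \<preceq>\<^bsub>E\<^esub> \<zero>\<^bsub>E\<^esub>)"

text \<open>Suprema suffice: negation reverses the order, so minus the supremum of -x and -y is the
  infimum of x and y. The order dual and its order continuous part are both shown to be Riesz spaces
  through this rule.\<close>

lemma riesz_spaceI:
  assumes "module real_ring E"
    and refl: "\<And>x. x \<in> carrier E \<Longrightarrow> x \<preceq>\<^bsub>E\<^esub> x"
    and antisym: "\<And>x y. \<lbrakk>x \<preceq>\<^bsub>E\<^esub> y; y \<preceq>\<^bsub>E\<^esub> x; x \<in> carrier E; y \<in> carrier E\<rbrakk> \<Longrightarrow> x = y"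
    and trans: "\<And>x y z. \<lbrakk>x \<preceq>\<^bsub>E\<^esub> y; y \<preceq>\<^bsub>E\<^esub> z; x \<in> carrier E; y \<in> carrier E; z \<in> carrier E\<rbrakk>
      \<Longrightarrow> x \<preceq>\<^bsub>E\<^esub> z"
    and add: "\<And>x y z. \<lbrakk>x \<in> carrier E; y \<in> carrier E; z \<in> carrier E; x \<preceq>\<^bsub>E\<^esub> y\<rbrakk>
      \<Longrightarrow> x \<oplus>\<^bsub>E\<^esub> z \<preceq>\<^bsub>E\<^esub> y \<oplus>\<^bsub>E\<^esub> z"
    and smult: "\<And>x y c. \<lbrakk>x \<in> carrier E; y \<in> carrier E; 0 \<le> c; x \<preceq>\<^bsub>E\<^esub> y\<rbrakk>
      \<Longrightarrow> c \<odot>\<^bsub>E\<^esub> x \<preceq>\<^bsub>E\<^esub> c \<odot>\<^bsub>E\<^esub> y"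
    and sup: "\<And>x y. \<lbrakk>x \<in> carrier E; y \<in> carrier E\<rbrakk> \<Longrightarrow>
      \<exists>s\<in>carrier E. x \<preceq>\<^bsub>E\<^esub> s \<and> y \<preceq>\<^bsub>E\<^esub> s \<and>
        (\<forall>t\<in>carrier E. x \<preceq>\<^bsub>E\<^esub> t \<longrightarrow> y \<preceq>\<^bsub>E\<^esub> t \<longrightarrow> s \<preceq>\<^bsub>E\<^esub> t)"
  shows "riesz_space E"
proof -
  interpret M: module real_ring E by fact
  interpret partial_order "order_of E"
    by unfold_locales (auto intro: refl antisym trans)
  have neg: "\<ominus>\<^bsub>E\<^esub> y \<preceq>\<^bsub>E\<^esub> \<ominus>\<^bsub>E\<^esub> x" if "x \<in> carrier E" "y \<in> carrier E" "x \<preceq>\<^bsub>E\<^esub> y" for x y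
  proof -
    have "x \<oplus>\<^bsub>E\<^esub> (\<ominus>\<^bsub>E\<^esub> x \<oplus>\<^bsub>E\<^esub> \<ominus>\<^bsub>E\<^esub> y) \<preceq>\<^bsub>E\<^esub> y \<oplus>\<^bsub>E\<^esub> (\<ominus>\<^bsub>E\<^esub> x \<oplus>\<^bsub>E\<^esub> \<ominus>\<^bsub>E\<^esub> y)"
      using that by (intro add) auto
    moreover have "x \<oplus>\<^bsub>E\<^esub> (\<ominus>\<^bsub>E\<^esub> x \<oplus>\<^bsub>E\<^esub> \<ominus>\<^bsub>E\<^esub> y) = \<ominus>\<^bsub>E\<^esub> y"
      using that by (simp add: M.r_neg2)
    moreover have "y \<oplus>\<^bsub>E\<^esub> (\<ominus>\<^bsub>E\<^esub> x \<oplus>\<^bsub>E\<^esub> \<ominus>\<^bsub>E\<^esub> y) = \<ominus>\<^bsub>E\<^esub> x"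
      using that by (metis M.a_inv_closed M.add.m_lcomm M.r_neg M.r_zero)
    ultimately show ?thesis by simp
  qed
  show ?thesis
  proof (intro riesz_space.intro lattice.intro upper_semilattice.intro lower_semilattice.intro
      riesz_space_axioms.intro assms(1) partial_order_axioms)
    show "upper_semilattice_axioms (order_of E)"
    proof
      fix x y assume "x \<in> carrier (order_of E)" "y \<in> carrier (order_of E)"
      with sup[of x y] obtain s where s: "s \<in> carrier E" "x \<preceq>\<^bsub>E\<^esub> s" "y \<preceq>\<^bsub>E\<^esub> s"
        "\<forall>t\<in>carrier E. x \<preceq>\<^bsub>E\<^esub> t \<longrightarrow> y \<preceq>\<^bsub>E\<^esub> t \<longrightarrow> s \<preceq>\<^bsub>E\<^esub> t" and xy: "x \<in> carrier E" "y \<in> carrier E"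
        by auto
      then have "least (order_of E) s (Upper (order_of E) {x, y})"
        by (auto simp: least_def Upper_def)
      then show "\<exists>s. least (order_of E) s (Upper (order_of E) {x, y})" by blast
    qed
    show "lower_semilattice_axioms (order_of E)"
    proof
      fix x y assume "x \<in> carrier (order_of E)" "y \<in> carrier (order_of E)"
      then have xy: "x \<in> carrier E" "y \<in> carrier E" by auto
      then obtain s where s: "s \<in> carrier E" "\<ominus>\<^bsub>E\<^esub> x \<preceq>\<^bsub>E\<^esub> s" "\<ominus>\<^bsub>E\<^esub> y \<preceq>\<^bsub>E\<^esub> s"
        "\<forall>t\<in>carrier E. \<ominus>\<^bsub>E\<^esub> x \<preceq>\<^bsub>E\<^esub> t \<longrightarrow> \<ominus>\<^bsub>E\<^esub> y \<preceq>\<^bsub>E\<^esub> t \<longrightarrow> s \<preceq>\<^bsub>E\<^esub> t"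
        using sup[of "\<ominus>\<^bsub>E\<^esub> x" "\<ominus>\<^bsub>E\<^esub> y"] by auto
      have "\<ominus>\<^bsub>E\<^esub> s \<preceq>\<^bsub>E\<^esub> x" "\<ominus>\<^bsub>E\<^esub> s \<preceq>\<^bsub>E\<^esub> y"
        using neg[of "\<ominus>\<^bsub>E\<^esub> x" s] neg[of "\<ominus>\<^bsub>E\<^esub> y" s] s xy by auto
      moreover have "t \<preceq>\<^bsub>E\<^esub> \<ominus>\<^bsub>E\<^esub> s" if "t \<in> carrier E" "t \<preceq>\<^bsub>E\<^esub> x" "t \<preceq>\<^bsub>E\<^esub> y" for t
      proof -
        have "s \<preceq>\<^bsub>E\<^esub> \<ominus>\<^bsub>E\<^esub> t" using neg[of t x] neg[of t y] that s(4) xy by auto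
        from neg[OF _ _ this] show ?thesis using that s by simp
      qed
      ultimately have "greatest (order_of E) (\<ominus>\<^bsub>E\<^esub> s) (Lower (order_of E) {x, y})"
        using s xy by (auto simp: greatest_def Lower_def)
      then show "\<exists>s. greatest (order_of E) s (Lower (order_of E) {x, y})" by blast
    qed
  qed (use add smult in auto)
qed

section \<open>Order, positive cone and Riesz decomposition\<close>

context riesz_space
begin

lemma vle_refl: "x \<in> carrier E \<Longrightarrow> x \<preceq> x"
  using le_refl[of x] by simp

lemma vle_trans: "\<lbrakk>x \<preceq> y; y \<preceq> z; x \<in> carrier E; y \<in> carrier E; z \<in> carrier E\<rbrakk> \<Longrightarrow> x \<preceq> z"
  using le_trans[of x y z] by simp

lemma vle_antisym: "\<lbrakk>x \<preceq> y; y \<preceq> x; x \<in> carrier E; y \<in> carrier E\<rbrakk> \<Longrightarrow> x = y"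
  using le_antisym[of x y] by simp

lemma vsup_closed: "\<lbrakk>x \<in> carrier E; y \<in> carrier E\<rbrakk> \<Longrightarrow> vsup E x y \<in> carrier E"
  using join_closed[of x y] by simp

lemma vsup_upper: "\<lbrakk>x \<in> carrier E; y \<in> carrier E\<rbrakk> \<Longrightarrow> x \<preceq> vsup E x y"
  "\<lbrakk>x \<in> carrier E; y \<in> carrier E\<rbrakk> \<Longrightarrow> y \<preceq> vsup E x y"
  using join_left[of x y] join_right[of x y] by simp_all

lemma vsup_least: "\<lbrakk>x \<preceq> z; y \<preceq> z; x \<in> carrier E; y \<in> carrier E; z \<in> carrier E\<rbrakk> \<Longrightarrow> vsup E x y \<preceq> z"
  using join_le[of x z y] by simp

lemma vsup_eqI:
  assumes "x \<in> carrier E" "y \<in> carrier E" "s \<in> carrier E" "x \<preceq> s" "y \<preceq> s"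
    "\<And>t. \<lbrakk>t \<in> carrier E; x \<preceq> t; y \<preceq> t\<rbrakk> \<Longrightarrow> s \<preceq> t"
  shows "vsup E x y = s"
  using assms by (intro vle_antisym vsup_least vsup_closed) (auto intro: vsup_upper vsup_closed)

lemma vinf_closed: "\<lbrakk>x \<in> carrier E; y \<in> carrier E\<rbrakk> \<Longrightarrow> vinf E x y \<in> carrier E"
  using meet_closed[of x y] by simp

lemma vinf_lower: "\<lbrakk>x \<in> carrier E; y \<in> carrier E\<rbrakk> \<Longrightarrow> vinf E x y \<preceq> x"
  "\<lbrakk>x \<in> carrier E; y \<in> carrier E\<rbrakk> \<Longrightarrow> vinf E x y \<preceq> y"
  using meet_left[of x y] meet_right[of x y] by simp_all

lemma vinf_greatest: "\<lbrakk>z \<preceq> x; z \<preceq> y; x \<in> carrier E; y \<in> carrier E; z \<in> carrier E\<rbrakk> \<Longrightarrow> z \<preceq> vinf E x y"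
  using meet_le[of z x y] by simp

lemma pcone_closed: "x \<in> pcone E \<Longrightarrow> x \<in> carrier E"
  by (simp add: pcone_def)

lemma pcone_zero: "\<zero> \<in> pcone E"
  by (simp add: pcone_def vle_refl)

lemma pcone_add:
  assumes "x \<in> pcone E" "y \<in> pcone E" shows "x \<oplus> y \<in> pcone E"
proof -
  have "\<zero> \<oplus> y \<preceq> x \<oplus> y" using assms by (intro add_mono) (auto simp: pcone_def)
  then show ?thesis using assms vle_trans[of \<zero> y "x \<oplus> y"] by (auto simp: pcone_def)
qed

lemma pcone_smult: "\<lbrakk>x \<in> pcone E; 0 \<le> c\<rbrakk> \<Longrightarrow> c \<odot> x \<in> pcone E"
  using smult_mono[of \<zero> x c] by (auto simp: pcone_def)

text \<open>Together with the commutativity rules this reduces inequalities to equations without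
  subtraction.\<close>

lemma vle_iff:
  assumes "x \<in> carrier E" "y \<in> carrier E"
  shows "x \<preceq> y \<longleftrightarrow> (\<exists>p\<in>pcone E. y = x \<oplus> p)"
proof
  assume "x \<preceq> y"
  then have "x \<oplus> \<ominus> x \<preceq> y \<oplus> \<ominus> x" using assms by (intro add_mono) auto
  then have "y \<oplus> \<ominus> x \<in> pcone E" using assms by (simp add: pcone_def M.r_neg)
  moreover have "y = x \<oplus> (y \<oplus> \<ominus> x)"
    using assms by (metis M.a_inv_closed M.a_lcomm M.r_neg M.r_zero)
  ultimately show "\<exists>p\<in>pcone E. y = x \<oplus> p" by blast
next
  assume "\<exists>p\<in>pcone E. y = x \<oplus> p"
  then obtain p where p: "p \<in> pcone E" "y = x \<oplus> p" by blast
  then have "\<zero> \<oplus> x \<preceq> p \<oplus> x" using assms by (intro add_mono) (auto simp: pcone_def)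
  then show "x \<preceq> y" using p assms by (simp add: M.a_comm pcone_def)
qed

lemma vle_add: "\<lbrakk>x \<in> carrier E; p \<in> pcone E\<rbrakk> \<Longrightarrow> x \<preceq> x \<oplus> p"
  by (auto simp: vle_iff pcone_closed)

lemma vle_cancel:
  assumes "x \<oplus> z \<preceq> y \<oplus> z" "x \<in> carrier E" "y \<in> carrier E" "z \<in> carrier E"
  shows "x \<preceq> y"
proof -
  obtain p where p: "p \<in> pcone E" "y \<oplus> z = x \<oplus> z \<oplus> p"
    using assms vle_iff[of "x \<oplus> z" "y \<oplus> z"] by auto
  then have "y \<oplus> z = (x \<oplus> p) \<oplus> z" using assms pcone_closed[of p] by (simp add: M.a_ac)
  then have "y = x \<oplus> p" using assms pcone_closed[of p] p(1) by simp
  then show ?thesis using p vle_add assms by auto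
qed

lemma add_mono2:
  assumes "x \<preceq> y" "u \<preceq> v" "x \<in> carrier E" "y \<in> carrier E" "u \<in> carrier E" "v \<in> carrier E"
  shows "x \<oplus> u \<preceq> y \<oplus> v"
proof -
  have "x \<oplus> u \<preceq> y \<oplus> u" using assms by (intro add_mono) auto
  moreover have "u \<oplus> y \<preceq> v \<oplus> y" using assms by (intro add_mono) auto
  ultimately show ?thesis using assms vle_trans[of "x \<oplus> u" "y \<oplus> u" "y \<oplus> v"] by (simp add: M.a_comm)
qed

lemma pcone_add_zero:
  assumes "x \<in> pcone E" "x \<preceq> \<zero>" shows "x = \<zero>"
  using assms vle_antisym[of x \<zero>] by (auto simp: pcone_def)

text \<open>The summands are a = x \<sqinter> y and b = x - a. Since x - z lies below both x and y,
  it lies below a, and this is b \<le> z.\<close>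

lemma riesz_decomposition:
  assumes "x \<in> pcone E" "y \<in> pcone E" "z \<in> pcone E" "x \<preceq> y \<oplus> z"
  obtains a b where "a \<in> pcone E" "b \<in> pcone E" "x = a \<oplus> b" "a \<preceq> y" "b \<preceq> z" "a \<preceq> x" "b \<preceq> x"
proof -
  have C: "x \<in> carrier E" "y \<in> carrier E" "z \<in> carrier E" using assms pcone_closed by auto
  define a where "a = vinf E x y"
  have a: "a \<in> carrier E" "a \<preceq> x" "a \<preceq> y" unfolding a_def using C by (auto intro: vinf_closed vinf_lower)
  have ap: "a \<in> pcone E" using a assms by (auto simp: pcone_def a_def intro: vinf_greatest)
  obtain b where b: "b \<in> pcone E" "x = a \<oplus> b" using a C vle_iff[of a x] by auto
  have bC: "b \<in> carrier E" using b pcone_closed by auto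
  have "x \<oplus> \<ominus> z \<preceq> a" unfolding a_def
  proof (rule vinf_greatest)
    show "x \<oplus> \<ominus> z \<preceq> x"
      by (rule vle_cancel[of _ z]) (use C vle_add[of x z] assms in \<open>auto simp: M.a_assoc M.l_neg\<close>)
    show "x \<oplus> \<ominus> z \<preceq> y"
      by (rule vle_cancel[of _ z]) (use C assms in \<open>auto simp: M.a_assoc M.l_neg\<close>)
  qed (use C in auto)
  then have "x \<oplus> \<ominus> z \<oplus> z \<preceq> a \<oplus> z" using C a by (intro add_mono) auto
  then have "b \<oplus> a \<preceq> z \<oplus> a" using C a b bC by (simp add: M.a_assoc M.l_neg) (simp add: M.a_comm)
  then have "b \<preceq> z" using vle_cancel[of b a z] a bC C by simp
  moreover have "b \<preceq> x" using b a vle_add[of b a] ap bC by (simp add: M.a_comm)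
  ultimately show ?thesis using that[of a b] ap b a by simp
qed

lemma cone_decomposition:
  assumes "x \<in> carrier E"
  obtains p n where "p \<in> pcone E" "n \<in> pcone E" "p = x \<oplus> n"
proof -
  have p: "vsup E x \<zero> \<in> pcone E" "x \<preceq> vsup E x \<zero>"
    using assms by (auto simp: pcone_def intro: vsup_closed vsup_upper)
  then show ?thesis using that[of "vsup E x \<zero>"] assms vle_iff[of x "vsup E x \<zero>"] pcone_closed by auto
qed

lemma half_double: "x \<in> carrier E \<Longrightarrow> (1/2) \<odot> (x \<oplus> x) = x"
proof -
  assume x: "x \<in> carrier E"
  have "(1/2) \<odot> (x \<oplus> x) = (1/2) \<odot> x \<oplus> (1/2) \<odot> x" using x by (simp add: smult_r_distr)
  also have "\<dots> = (1/2 + 1/2) \<odot> x" using x smult_l_distr[of "1/2" "1/2" x] by simp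
  also have "\<dots> = x" using x smult_one by simp
  finally show ?thesis .
qed

lemma half_le:
  assumes "x \<oplus> x \<preceq> y \<oplus> y" "x \<in> carrier E" "y \<in> carrier E" shows "x \<preceq> y"
  using smult_mono[OF _ _ _ assms(1), of "1/2"] assms by (simp add: half_double)

lemma jordan_decomposition:
  assumes x: "x \<in> carrier E"
  obtains p n where "p \<in> pcone E" "n \<in> pcone E" "p = x \<oplus> n" "vabs E x = p \<oplus> n" "vdisjoint E p n"
proof -
  define p where "p = vsup E x \<zero>"
  have p: "p \<in> pcone E" "x \<preceq> p"
    unfolding p_def using assms by (auto simp: pcone_def intro: vsup_closed vsup_upper)
  then obtain n where n: "n \<in> pcone E" "p = x \<oplus> n" using x pcone_closed vle_iff[of x p] by auto
  have C: "p \<in> carrier E" "n \<in> carrier E" using p n pcone_closed by auto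
  have n': "n = \<ominus> x \<oplus> p" using n x C by (simp add: M.r_neg1)
  have "vabs E x = p \<oplus> n"
    unfolding vabs_def
  proof (rule vsup_eqI)
    show "x \<preceq> p \<oplus> n" using p n C x vle_add[of p n] vle_trans[of x p "p \<oplus> n"] by auto
    have "p \<oplus> n = \<ominus> x \<oplus> (p \<oplus> p)" using x C n' by (simp add: M.a_ac)
    then show "\<ominus> x \<preceq> p \<oplus> n" using x C p vle_add[of "\<ominus> x" "p \<oplus> p"] by (simp add: pcone_add)
  next
    fix t assume t: "t \<in> carrier E" "x \<preceq> t" "\<ominus> x \<preceq> t"
    \<comment> \<open>For an upper bound t of x and -x, the midpoint of x and t dominates both x and
      0, hence also p. Doubling this gives p + n \<le> t.\<close>
    let ?h = "(1/2) \<odot> (x \<oplus> t)"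
    have h2: "?h \<oplus> ?h = x \<oplus> t"
      using x t half_double[of "x \<oplus> t"] by (simp add: smult_r_distr)
    have "x \<preceq> ?h" by (rule half_le) (use t x h2 in \<open>auto intro!: add_mono2 vle_refl\<close>)
    moreover have "\<zero> \<preceq> ?h"
    proof (rule half_le)
      have "x \<oplus> \<ominus> x \<preceq> x \<oplus> t" using t x by (auto intro!: add_mono2 vle_refl)
      then show "\<zero> \<oplus> \<zero> \<preceq> ?h \<oplus> ?h" using h2 x by (simp add: M.r_neg)
    qed (use t x in auto)
    ultimately have "p \<preceq> ?h" unfolding p_def using x t by (intro vsup_least) auto
    then have "p \<oplus> p \<preceq> x \<oplus> t" using add_mono2[of p ?h p ?h] h2 C x t by auto
    then have "(p \<oplus> n) \<oplus> x \<preceq> t \<oplus> x" using C x t n(2) by (simp add: M.a_ac)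
    then show "p \<oplus> n \<preceq> t" using vle_cancel[of "p \<oplus> n" x t] C x t by auto
  qed (use x C in auto)
  moreover have "vdisjoint E p n"
    unfolding vdisjoint_def
  proof (intro conjI ballI impI p n)
    fix t assume t: "t \<in> carrier E" "t \<preceq> p" "t \<preceq> n"
    \<comment> \<open>u = p - t is still an upper bound of x and 0, because t \<le> n and n = p - x
      give x \<le> u. Minimality of p leaves p \<le> u, so t \<le> 0.\<close>
    obtain u where u: "u \<in> pcone E" "p = t \<oplus> u" using t C vle_iff[of t p] by auto
    have uC: "u \<in> carrier E" using u pcone_closed by auto
    have "t \<oplus> x \<preceq> n \<oplus> x" using t C x by (intro add_mono) auto
    then have "x \<oplus> t \<preceq> u \<oplus> t" using n u uC x C t by (simp add: M.a_comm)
    then have "x \<preceq> u" using vle_cancel[of x t u] x uC t by auto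
    then have "p \<preceq> u" unfolding p_def using u uC x by (intro vsup_least) (auto simp: pcone_def)
    then have "t \<oplus> u \<preceq> \<zero> \<oplus> u" using u uC by auto
    then show "t \<preceq> \<zero>" using vle_cancel[of t u \<zero>] t uC by auto
  qed
  ultimately show ?thesis using that p n by blast
qed

section \<open>Absolute values and disjointness\<close>

lemma vabs_closed: "x \<in> carrier E \<Longrightarrow> vabs E x \<in> carrier E"
  by (simp add: vabs_def vsup_closed)

lemma vabs_pcone: "x \<in> carrier E \<Longrightarrow> vabs E x \<in> pcone E"
  by (erule jordan_decomposition) (simp add: pcone_add)

lemma vabs_pos: "x \<in> pcone E \<Longrightarrow> vabs E x = x"
proof -
  assume x: "x \<in> pcone E"
  have xC: "x \<in> carrier E" using x pcone_closed by auto
  have "\<ominus> x \<oplus> x \<preceq> x \<oplus> x" using pcone_add[OF x x] xC by (simp add: M.l_neg pcone_def)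
  then have "\<ominus> x \<preceq> x" using vle_cancel[of "\<ominus> x" x x] xC by auto
  then show ?thesis unfolding vabs_def using xC by (intro vsup_eqI vle_refl) auto
qed

lemma vabs_ge:
  "x \<in> carrier E \<Longrightarrow> x \<preceq> vabs E x" "x \<in> carrier E \<Longrightarrow> \<ominus> x \<preceq> vabs E x"
  unfolding vabs_def by (auto intro: vsup_upper)

lemma vdisjoint_sym: "vdisjoint E x y \<Longrightarrow> vdisjoint E y x"
  by (auto simp: vdisjoint_def)

lemma vdisjoint_zeroD: "\<lbrakk>vdisjoint E x y; t \<in> pcone E; t \<preceq> x; t \<preceq> y\<rbrakk> \<Longrightarrow> t = \<zero>"
  using pcone_add_zero[of t] pcone_closed[of t] by (auto simp: vdisjoint_def)

text \<open>Positive lower bounds suffice, because the meet of x and y is one of them and every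
  lower bound lies below it.\<close>

lemma vdisjointI:
  assumes "x \<in> pcone E" "y \<in> pcone E" "\<And>t. \<lbrakk>t \<in> pcone E; t \<preceq> x; t \<preceq> y\<rbrakk> \<Longrightarrow> t = \<zero>"
  shows "vdisjoint E x y"
proof -
  have C: "x \<in> carrier E" "y \<in> carrier E" using assms pcone_closed by auto
  let ?m = "vinf E x y"
  have m: "?m \<in> pcone E" "?m \<preceq> x" "?m \<preceq> y"
    using assms(1,2) C by (auto simp: pcone_def intro: vinf_closed vinf_lower vinf_greatest)
  then have "?m = \<zero>" using assms(3) by blast
  then have "t \<preceq> \<zero>" if "t \<in> carrier E" "t \<preceq> x" "t \<preceq> y" for t
    using vinf_greatest[OF that(2,3) C that(1)] by simp
  then show ?thesis using assms(1,2) by (simp add: vdisjoint_def)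
qed

lemma vdisjoint_mono:
  assumes "vdisjoint E x y" "x' \<in> pcone E" "y' \<in> pcone E" "x' \<preceq> x" "y' \<preceq> y"
  shows "vdisjoint E x' y'"
proof (rule vdisjointI[OF assms(2,3)])
  fix t assume "t \<in> pcone E" "t \<preceq> x'" "t \<preceq> y'"
  moreover from this have "t \<preceq> x" "t \<preceq> y"
    using assms vle_trans[of t x' x] vle_trans[of t y' y] by (auto simp: vdisjoint_def pcone_def)
  ultimately show "t = \<zero>" using vdisjoint_zeroD[OF assms(1)] by blast
qed

text \<open>A lower bound of x + y and z decomposes into parts below x and below y; each part is
  still below z and therefore vanishes.\<close>

lemma vdisjoint_add:
  assumes "vdisjoint E x z" "vdisjoint E y z" shows "vdisjoint E (x \<oplus> y) z"
proof (rule vdisjointI)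
  have P: "x \<in> pcone E" "y \<in> pcone E" "z \<in> pcone E" using assms by (auto simp: vdisjoint_def)
  then show "x \<oplus> y \<in> pcone E" "z \<in> pcone E" by (auto simp: pcone_add)
  fix t assume t: "t \<in> pcone E" "t \<preceq> x \<oplus> y" "t \<preceq> z"
  then obtain a b where ab: "a \<in> pcone E" "b \<in> pcone E" "t = a \<oplus> b" "a \<preceq> x" "b \<preceq> y" "a \<preceq> t" "b \<preceq> t"
    using riesz_decomposition[OF t(1) P(1,2) t(2)] by metis
  then have "a \<preceq> z" "b \<preceq> z"
    using t P pcone_closed vle_trans[of a t z] vle_trans[of b t z] by auto
  then have "a = \<zero>" "b = \<zero>"
    using ab vdisjoint_zeroD[OF assms(1)] vdisjoint_zeroD[OF assms(2)] by auto
  then show "t = \<zero>" using ab by simp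
qed

text \<open>Converse to |a - b| = a + b for disjoint a and b; a map that preserves absolute values
  is seen in this way to preserve disjointness. Subtracting a common lower bound t from a and b does
  not change x = a - b, so |x| \<le> a + b - 2t, and the assumed equality leaves 2t \<le> 0.\<close>

lemma vdisjoint_abs_diff:
  assumes "a \<in> pcone E" "b \<in> pcone E" "x \<in> carrier E" "a = x \<oplus> b" "vabs E x = a \<oplus> b"
  shows "vdisjoint E a b"
proof (rule vdisjointI[OF assms(1,2)])
  fix t assume t: "t \<in> pcone E" "t \<preceq> a" "t \<preceq> b"
  have C: "a \<in> carrier E" "b \<in> carrier E" "t \<in> carrier E" using assms t pcone_closed by auto
  obtain u v where u: "u \<in> pcone E" "a = t \<oplus> u" and v: "v \<in> pcone E" "b = t \<oplus> v"
    using t C vle_iff[of t a] vle_iff[of t b] by auto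
  have uv: "u \<in> carrier E" "v \<in> carrier E" using u v pcone_closed by auto
  have "t \<oplus> u = t \<oplus> (x \<oplus> v)" using assms(3,4) u v uv C by (simp add: M.a_ac)
  then have e: "u = x \<oplus> v" using C uv assms(3) by simp
  have "x \<preceq> u \<oplus> v"
    using vle_add[of x "v \<oplus> v"] pcone_add[OF v(1) v(1)] e assms(3) uv by (simp add: M.a_assoc)
  moreover have "\<ominus> x \<preceq> u \<oplus> v"
  proof -
    have "v = \<ominus> x \<oplus> u" using e assms(3) uv by (simp add: M.r_neg1)
    then have "u \<oplus> v = \<ominus> x \<oplus> (u \<oplus> u)" using uv assms(3) by (simp add: M.a_ac)
    then show ?thesis using vle_add[of "\<ominus> x" "u \<oplus> u"] pcone_add[OF u(1) u(1)] assms(3) by simp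
  qed
  ultimately have "a \<oplus> b \<preceq> u \<oplus> v" unfolding assms(5)[symmetric] vabs_def
    using assms(3) uv by (intro vsup_least) auto
  then have "(t \<oplus> t) \<oplus> (u \<oplus> v) \<preceq> \<zero> \<oplus> (u \<oplus> v)" using u v uv C by (simp add: M.a_ac)
  then have "t \<oplus> t \<preceq> \<zero> \<oplus> \<zero>" using vle_cancel[of "t \<oplus> t" "u \<oplus> v" \<zero>] C uv by simp
  then have "t \<preceq> \<zero>" using half_le[of t \<zero>] C by simp
  then show "t = \<zero>" using t pcone_add_zero by auto
qed

text \<open>Here m = x \<sqinter> y. A common lower bound t of the remainders would put m + t below
  x and y, hence below m.\<close>

lemma vdisjoint_remainder:
  assumes "x \<in> pcone E" "y \<in> pcone E"
  obtains m a b where "m \<in> pcone E" "a \<in> pcone E" "b \<in> pcone E" "x = a \<oplus> m" "y = b \<oplus> m"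
    "vdisjoint E a b"
proof -
  have C: "x \<in> carrier E" "y \<in> carrier E" using assms pcone_closed by auto
  define m where "m = vinf E x y"
  have m: "m \<in> pcone E" "m \<preceq> x" "m \<preceq> y"
    using assms C by (auto simp: m_def pcone_def intro: vinf_closed vinf_lower vinf_greatest)
  have mC: "m \<in> carrier E" using m pcone_closed by auto
  obtain a b where ab: "a \<in> pcone E" "x = m \<oplus> a" "b \<in> pcone E" "y = m \<oplus> b"
    using m C mC vle_iff[of m x] vle_iff[of m y] by auto
  have abC: "a \<in> carrier E" "b \<in> carrier E" using ab pcone_closed by auto
  have "vdisjoint E a b"
  proof (rule vdisjointI)
    fix t assume t: "t \<in> pcone E" "t \<preceq> a" "t \<preceq> b"
    have tC: "t \<in> carrier E" using t pcone_closed by auto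
    have "m \<oplus> t \<preceq> x" "m \<oplus> t \<preceq> y" using ab t abC tC mC by (auto intro!: add_mono2 vle_refl)
    then have "m \<oplus> t \<preceq> m" unfolding m_def using C tC vinf_closed by (intro vinf_greatest) auto
    then have "t \<oplus> m \<preceq> \<zero> \<oplus> m" using tC mC by (simp add: M.a_comm)
    then show "t = \<zero>" using vle_cancel[of t m \<zero>] t tC mC pcone_add_zero by auto
  qed (use ab in auto)
  then show ?thesis using that[of m a b] m ab abC mC by (auto simp: M.a_comm)
qed

end

section \<open>The order dual as a Riesz space\<close>

lemma real_le_if_le_add_eps: "(\<And>e::real. 0 < e \<Longrightarrow> a < b + e) \<Longrightarrow> a \<le> b"
  by (meson field_le_epsilon less_imp_le)

section \<open>Functionals and the cone of the order dual\<close>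

lemma dual_simps [simp]:
  "\<zero>\<^bsub>dual E\<^esub> = (\<lambda>x\<in>carrier E. 0)"
  "f \<oplus>\<^bsub>dual E\<^esub> g = (\<lambda>x\<in>carrier E. f x + g x)"
  "c \<odot>\<^bsub>dual E\<^esub> f = (\<lambda>x\<in>carrier E. c * f x)"
  by (simp_all add: order_dual_def)

lemma dual_carrier:
  "f \<in> carrier (dual E) \<longleftrightarrow> f \<in> extensional (carrier E) \<and> linear_functional E f \<and> order_bounded E f"
  by (simp add: order_dual_def)

lemma dual_vle: "f \<unlhd>\<^bsub>E\<^esub> g \<longleftrightarrow> (\<forall>x\<in>pcone E. f x \<le> g x)"
  by (auto simp add: order_dual_def pcone_def)

lemma pcone_dual:
  "f \<in> pcone (dual E) \<longleftrightarrow> f \<in> carrier (dual E) \<and> (\<forall>x\<in>pcone E. 0 \<le> f x)"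
  by (auto simp: pcone_def order_dual_def)

lemma pcone_dual_closed: "f \<in> pcone (dual E) \<Longrightarrow> f \<in> carrier (dual E)"
  by (simp add: pcone_def)

lemma pcone_dual_nonneg: "\<lbrakk>f \<in> pcone (dual E); x \<in> pcone E\<rbrakk> \<Longrightarrow> 0 \<le> f x"
  by (simp add: pcone_dual)

lemma functional_add:
  "\<lbrakk>f \<in> carrier (dual E); x \<in> carrier E; y \<in> carrier E\<rbrakk> \<Longrightarrow> f (x \<oplus>\<^bsub>E\<^esub> y) = f x + f y"
  by (simp add: dual_carrier linear_functional_def)

lemma functional_smult:
  "\<lbrakk>f \<in> carrier (dual E); x \<in> carrier E\<rbrakk> \<Longrightarrow> f (c \<odot>\<^bsub>E\<^esub> x) = c * f x"
  by (simp add: dual_carrier linear_functional_def)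

text \<open>The cone generates the space, so the values on it determine an extensional
  functional.\<close>

lemma functional_pos_eqI:
  assumes "riesz_space E" "f \<in> carrier (dual E)" "g \<in> carrier (dual E)"
    and "\<And>x. x \<in> pcone E \<Longrightarrow> f x = g x"
  shows "f = g"
proof (rule extensionalityI[of _ "carrier E"])
  interpret riesz_space E by fact
  fix x assume "x \<in> carrier E"
  then obtain p n where p: "p \<in> pcone E" "n \<in> pcone E" "p = x \<oplus>\<^bsub>E\<^esub> n" by (rule cone_decomposition)
  then have "f p = f x + f n" "g p = g x + g n"
    using assms(2,3) \<open>x \<in> carrier E\<close> pcone_closed[of n] by (auto simp: functional_add)
  then show "f x = g x" using assms(4)[of p] assms(4)[of n] p by simp
qed (use assms in \<open>auto simp: dual_carrier\<close>)

section \<open>Functionals from additive functions on the cone\<close>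

context riesz_space
begin

lemma functional_zero: "f \<in> carrier (dual E) \<Longrightarrow> f \<zero> = 0"
  using functional_add[of f E \<zero> \<zero>] by simp

lemma functional_mono:
  assumes "f \<in> pcone (dual E)" "x \<preceq> y" "x \<in> carrier E" "y \<in> carrier E"
  shows "f x \<le> f y"
proof -
  obtain p where p: "p \<in> pcone E" "y = x \<oplus> p" using assms(2-) vle_iff by auto
  then show ?thesis
    using assms functional_add[of f E x p] by (auto simp: pcone_dual pcone_closed)
qed

lemma cone_additive_homogeneous:
  fixes q :: "'a \<Rightarrow> real"
  assumes nonneg: "\<And>x. x \<in> pcone E \<Longrightarrow> 0 \<le> q x"
    and add: "\<And>x y. \<lbrakk>x \<in> pcone E; y \<in> pcone E\<rbrakk> \<Longrightarrow> q (x \<oplus> y) = q x + q y"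
    and x: "x \<in> pcone E" and c: "0 \<le> c"
  shows "q (c \<odot> x) = c * q x"
proof -
  have xC: "x \<in> carrier E" using x pcone_closed by auto
  have z: "q \<zero> = 0" using add[of \<zero> \<zero>] pcone_zero by simp
  have nat: "q (real n \<odot> y) = real n * q y" if y: "y \<in> pcone E" for n y
  proof (induction n)
    case 0
    then show ?case using z y smult_l_null[of y] pcone_closed by simp
  next
    case (Suc n)
    have "real (Suc n) \<odot> y = real n \<odot> y \<oplus> y"
      using smult_l_distr[of "real n" 1 y] y pcone_closed smult_one[of y] by (simp add: add.commute)
    then show ?case using Suc y add[of "real n \<odot> y" y] by (simp add: pcone_smult algebra_simps)
  qed
  have mono: "q (a \<odot> x) \<le> q (b \<odot> x)" if "0 \<le> a" "a \<le> b" for a b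
  proof -
    have "b \<odot> x = a \<odot> x \<oplus> (b - a) \<odot> x" using smult_l_distr[of a "b - a" x] xC by simp
    then show ?thesis using that x add[of "a \<odot> x" "(b - a) \<odot> x"] nonneg[of "(b - a) \<odot> x"]
      by (simp add: pcone_smult)
  qed
  have bound: "real n * \<bar>q (c \<odot> x) - c * q x\<bar> \<le> q x" for n
  proof -
    \<comment> \<open>With k the integer part of n c, monotonicity places both n q(c x) and n c q(x)
      between k q(x) and (k + 1) q(x). They differ by at most q(x), for every n.\<close>
    define k where "k = nat \<lfloor>real n * c\<rfloor>"
    have k: "real k \<le> real n * c" "real n * c \<le> real (k + 1)"
      unfolding k_def using c by (simp_all add: of_nat_nat) linarith+
    have e: "q ((real n * c) \<odot> x) = real n * q (c \<odot> x)"
      using nat[of "c \<odot> x" n] smult_assoc1[of "real n" c x] x xC c by (simp add: pcone_smult)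
    have "real k * q x \<le> real n * q (c \<odot> x)" "real n * q (c \<odot> x) \<le> real (k + 1) * q x"
      using mono[OF _ k(1)] mono[OF _ k(2)] nat[OF x, of k] nat[OF x, of "k + 1"] c e by auto
    moreover have "real k * q x \<le> real n * c * q x" "real n * c * q x \<le> real (k + 1) * q x"
      using k nonneg[OF x] by (auto intro!: mult_right_mono)
    ultimately have "\<bar>real n * q (c \<odot> x) - real n * c * q x\<bar> \<le> q x"
      by (simp add: algebra_simps abs_le_iff)
    moreover have "real n * q (c \<odot> x) - real n * c * q x = real n * (q (c \<odot> x) - c * q x)"
      by (simp add: right_diff_distrib)
    ultimately show ?thesis by (simp add: abs_mult)
  qed
  have "\<not> 0 < \<bar>q (c \<odot> x) - c * q x\<bar>"
  proof
    assume "0 < \<bar>q (c \<odot> x) - c * q x\<bar>"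
    then obtain n where "q x < real n * \<bar>q (c \<odot> x) - c * q x\<bar>" using reals_Archimedean3 by blast
    with bound[of n] show False by simp
  qed
  then show ?thesis by simp
qed

text \<open>Positivity makes f monotone, and a monotone functional is bounded on an order interval
  by its values at the endpoints.\<close>

lemma positive_linear_in_dual:
  assumes "f \<in> extensional (carrier E)" "linear_functional E f" "\<And>x. x \<in> pcone E \<Longrightarrow> 0 \<le> f x"
  shows "f \<in> pcone (dual E)"
proof -
  have mono: "f x \<le> f y" if xy: "x \<preceq> y" "x \<in> carrier E" "y \<in> carrier E" for x y
  proof -
    obtain p where p: "p \<in> pcone E" "y = x \<oplus> p" using xy vle_iff by auto
    then show ?thesis using assms xy by (auto simp: pcone_closed linear_functional_def)
  qed
  have "order_bounded E f"
    unfolding order_bounded_def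
  proof (intro ballI)
    fix a b assume "a \<in> carrier E" "b \<in> carrier E"
    then have "\<forall>x\<in>carrier E. a \<preceq> x \<and> x \<preceq> b \<longrightarrow> \<bar>f x\<bar> \<le> max (f b) (- f a)"
      using mono by (fastforce simp: abs_if)
    then show "\<exists>K. \<forall>x\<in>carrier E. a \<preceq> x \<and> x \<preceq> b \<longrightarrow> \<bar>f x\<bar> \<le> K" by blast
  qed
  then show ?thesis using assms by (auto simp: pcone_dual dual_carrier)
qed

text \<open>Homogeneity need not be assumed: it follows from additivity and positivity because the reals
  are Archimedean.\<close>

lemma cone_additive_extension:
  fixes q :: "'a \<Rightarrow> real"
  assumes nonneg: "\<And>x. x \<in> pcone E \<Longrightarrow> 0 \<le> q x"
    and add: "\<And>x y. \<lbrakk>x \<in> pcone E; y \<in> pcone E\<rbrakk> \<Longrightarrow> q (x \<oplus> y) = q x + q y"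
  obtains f where "f \<in> pcone (dual E)" "\<And>x. x \<in> pcone E \<Longrightarrow> f x = q x"
proof -
  \<comment> \<open>The value at x is q a - q b for a representation x = a - b with positive a and
    b. The fact \<open>f\<close> shows that any representation gives the same value.\<close>
  define f where "f = (\<lambda>x\<in>carrier E. SOME r. \<exists>a\<in>pcone E. \<exists>b\<in>pcone E. a = x \<oplus> b \<and> r = q a - q b)"
  have f: "f x = q a - q b" if x: "x \<in> carrier E" and ab: "a \<in> pcone E" "b \<in> pcone E" "a = x \<oplus> b" for x a b
  proof -
    have "\<exists>a\<in>pcone E. \<exists>b\<in>pcone E. a = x \<oplus> b \<and> f x = q a - q b"
      unfolding f_def using x ab
      by (simp, intro someI[of "\<lambda>r. \<exists>a\<in>pcone E. \<exists>b\<in>pcone E. a = x \<oplus> b \<and> r = q a - q b" "q a - q b"]) blast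
    then obtain a' b' where ab': "a' \<in> pcone E" "b' \<in> pcone E" "a' = x \<oplus> b'" "f x = q a' - q b'" by blast
    have "a \<oplus> b' = a' \<oplus> b" using ab ab' x pcone_closed[of b] pcone_closed[of b'] by (simp add: M.a_ac)
    then have "q a + q b' = q a' + q b" using add ab ab' by metis
    then show ?thesis using ab' by simp
  qed
  have eq: "f x = q x" if "x \<in> pcone E" for x
    using f[of x x \<zero>] add[of \<zero> \<zero>] that pcone_closed pcone_zero by simp
  have "linear_functional E f"
    unfolding linear_functional_def
  proof (intro conjI ballI allI)
    fix x y assume x: "x \<in> carrier E" and y: "y \<in> carrier E"
    obtain a b where ab: "a \<in> pcone E" "b \<in> pcone E" "a = x \<oplus> b" using cone_decomposition[OF x] by blast
    obtain c d where cd: "c \<in> pcone E" "d \<in> pcone E" "c = y \<oplus> d" using cone_decomposition[OF y] by blast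
    have "a \<oplus> c = (x \<oplus> y) \<oplus> (b \<oplus> d)"
      using ab cd x y pcone_closed[of b] pcone_closed[of d] by (simp add: M.a_ac)
    then have "f (x \<oplus> y) = q (a \<oplus> c) - q (b \<oplus> d)"
      by (rule f[OF M.a_closed[OF x y] pcone_add[OF ab(1) cd(1)] pcone_add[OF ab(2) cd(2)]])
    then show "f (x \<oplus> y) = f x + f y"
      using f[OF x ab] f[OF y cd] add[OF ab(1) cd(1)] add[OF ab(2) cd(2)] by simp
  next
    fix c x assume x: "x \<in> carrier E"
    obtain a b where ab: "a \<in> pcone E" "b \<in> pcone E" "a = x \<oplus> b" using cone_decomposition[OF x] by blast
    have abC: "a \<in> carrier E" "b \<in> carrier E" using ab pcone_closed by auto
    have hom: "q (c \<odot> y) = c * q y" if "y \<in> pcone E" "0 \<le> c" for c y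
      using cone_additive_homogeneous[of q y c] nonneg add that by blast
    show "f (c \<odot> x) = c * f x"
    proof (cases "0 \<le> c")
      case True
      have "c \<odot> a = c \<odot> x \<oplus> c \<odot> b" using ab abC x by (simp add: smult_r_distr)
      then have "f (c \<odot> x) = q (c \<odot> a) - q (c \<odot> b)"
        by (rule f[OF _ pcone_smult[OF ab(1) True] pcone_smult[OF ab(2) True], rotated]) (simp add: x)
      then show ?thesis using hom[OF ab(1) True] hom[OF ab(2) True] f[OF x ab] by (simp add: right_diff_distrib)
    next
      \<comment> \<open>For negative c, a representation of c x arises by scaling with -c and
        exchanging the two parts.\<close>
      case False
      then have c: "0 \<le> - c" by simp
      have "c \<odot> x \<oplus> (- c) \<odot> a = (c \<odot> x \<oplus> (- c) \<odot> x) \<oplus> (- c) \<odot> b"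
        using ab abC x by (simp add: smult_r_distr M.a_assoc)
      also have "\<dots> = (- c) \<odot> b" using x abC smult_l_distr[of c "- c" x] smult_l_null[of x] by simp
      finally have "f (c \<odot> x) = q ((- c) \<odot> b) - q ((- c) \<odot> a)"
        using f[OF _ pcone_smult[OF ab(2) c] pcone_smult[OF ab(1) c], of "c \<odot> x"] x by simp
      then show ?thesis using hom[OF ab(1) c] hom[OF ab(2) c] f[OF x ab] by (simp add: right_diff_distrib)
    qed
  qed
  then have "f \<in> pcone (dual E)"
    using eq nonneg by (intro positive_linear_in_dual) (auto simp: f_def)
  then show ?thesis using eq that by blast
qed

text \<open>The Riesz-Kantorovich formula: s x is the supremum of h t over 0 \<le> t \<le> x, finite
  by order boundedness and additive in x by Riesz decomposition. The supremum property is exported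
  with an epsilon, the form in which it is applied.\<close>

lemma functional_pos_part:
  assumes h: "h \<in> carrier (dual E)"
  obtains s where "s \<in> pcone (dual E)"
    "\<And>x t. \<lbrakk>x \<in> pcone E; t \<in> pcone E; t \<preceq> x\<rbrakk> \<Longrightarrow> h t \<le> s x"
    "\<And>x e. \<lbrakk>x \<in> pcone E; 0 < e\<rbrakk> \<Longrightarrow> \<exists>t\<in>pcone E. t \<preceq> x \<and> s x < h t + e"
proof -
  define S where "S x = h ` {t \<in> pcone E. t \<preceq> x}" for x
  define q where "q x = Sup (S x)" for x
  have bdd: "bdd_above (S x)" if x: "x \<in> pcone E" for x
  proof -
    obtain K where K: "\<forall>t\<in>carrier E. \<zero> \<preceq> t \<and> t \<preceq> x \<longrightarrow> \<bar>h t\<bar> \<le> K"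
      using h x pcone_closed[of x] unfolding dual_carrier order_bounded_def by (meson M.zero_closed)
    then show ?thesis by (intro bdd_aboveI[of _ K]) (force simp: S_def pcone_def abs_le_iff)
  qed
  have z: "0 \<in> S x" if "x \<in> pcone E" for x
    using that functional_zero[OF h] pcone_zero by (auto simp: S_def pcone_def intro!: image_eqI[of _ _ \<zero>])
  have up: "h t \<le> q x" if "x \<in> pcone E" "t \<in> pcone E" "t \<preceq> x" for x t
    unfolding q_def using that by (intro cSup_upper bdd) (auto simp: S_def)
  have ap: "\<exists>t\<in>pcone E. t \<preceq> x \<and> q x < h t + e" if x: "x \<in> pcone E" and e: "0 < e" for x e
  proof -
    have "q x - e < Sup (S x)" using e by (simp add: q_def)
    then obtain y where "y \<in> S x" "q x - e < y" using less_cSupD[of "S x"] z[OF x] by blast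
    then show ?thesis by (fastforce simp: S_def)
  qed
  have nonneg: "0 \<le> q x" if "x \<in> pcone E" for x
    unfolding q_def using that by (intro cSup_upper z bdd)
  have add: "q (x \<oplus> y) = q x + q y" if x: "x \<in> pcone E" and y: "y \<in> pcone E" for x y
  proof (rule antisym)
    have xy: "x \<oplus> y \<in> pcone E" using x y by (rule pcone_add)
    show "q (x \<oplus> y) \<le> q x + q y"
    proof (rule real_le_if_le_add_eps)
      fix e :: real assume "0 < e"
      with ap[OF xy] obtain t where t: "t \<in> pcone E" "t \<preceq> x \<oplus> y" "q (x \<oplus> y) < h t + e" by blast
      then obtain a b where ab: "a \<in> pcone E" "b \<in> pcone E" "t = a \<oplus> b" "a \<preceq> x" "b \<preceq> y"
        using riesz_decomposition[OF t(1) x y t(2)] by metis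
      then have "h t = h a + h b" using functional_add[OF h] pcone_closed by simp
      then show "q (x \<oplus> y) < q x + q y + e" using t up[OF x ab(1,4)] up[OF y ab(2,5)] by simp
    qed
    show "q x + q y \<le> q (x \<oplus> y)"
    proof (rule real_le_if_le_add_eps)
      fix e :: real assume "0 < e"
      then have "0 < e/2" by simp
      obtain a where a: "a \<in> pcone E" "a \<preceq> x" "q x < h a + e/2" using ap[OF x \<open>0 < e/2\<close>] by blast
      obtain b where b: "b \<in> pcone E" "b \<preceq> y" "q y < h b + e/2" using ap[OF y \<open>0 < e/2\<close>] by blast
      have "h (a \<oplus> b) \<le> q (x \<oplus> y)"
        using a b x y by (intro up xy pcone_add add_mono2) (auto simp: pcone_closed)
      then show "q x + q y < q (x \<oplus> y) + e"
        using a b functional_add[OF h] pcone_closed by simp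
    qed
  qed
  obtain s where s: "s \<in> pcone (dual E)" "\<And>x. x \<in> pcone E \<Longrightarrow> s x = q x"
    using cone_additive_extension[of q] nonneg add by blast
  show ?thesis by (rule that[OF s(1)]) (use s(2) up ap in auto)
qed

section \<open>Vector space and lattice structure of the order dual\<close>

lemma dual_zero_closed: "(\<lambda>x\<in>carrier E. 0) \<in> carrier (dual E)"
  by (auto simp: dual_carrier linear_functional_def order_bounded_def)

lemma dual_add_closed:
  assumes f: "f \<in> carrier (dual E)" and g: "g \<in> carrier (dual E)"
  shows "(\<lambda>x\<in>carrier E. f x + g x) \<in> carrier (dual E)"
proof -
  have "order_bounded E (\<lambda>x\<in>carrier E. f x + g x)"
    unfolding order_bounded_def
  proof (intro ballI)
    fix a b assume "a \<in> carrier E" "b \<in> carrier E"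
    then obtain K L where "\<forall>x\<in>carrier E. a \<preceq> x \<and> x \<preceq> b \<longrightarrow> \<bar>f x\<bar> \<le> K"
      "\<forall>x\<in>carrier E. a \<preceq> x \<and> x \<preceq> b \<longrightarrow> \<bar>g x\<bar> \<le> L"
      using f g unfolding dual_carrier order_bounded_def by metis
    then show "\<exists>K. \<forall>x\<in>carrier E. a \<preceq> x \<and> x \<preceq> b \<longrightarrow> \<bar>(\<lambda>x\<in>carrier E. f x + g x) x\<bar> \<le> K"
      by (intro exI[of _ "K + L"]) (fastforce intro: order_trans[OF abs_triangle_ineq])
  qed
  then show ?thesis
    using f g by (auto simp: dual_carrier linear_functional_def algebra_simps)
qed

lemma dual_smult_closed:
  assumes f: "f \<in> carrier (dual E)"
  shows "(\<lambda>x\<in>carrier E. c * f x) \<in> carrier (dual E)"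
proof -
  have "order_bounded E (\<lambda>x\<in>carrier E. c * f x)"
    unfolding order_bounded_def
  proof (intro ballI)
    fix a b assume "a \<in> carrier E" "b \<in> carrier E"
    then obtain K where "\<forall>x\<in>carrier E. a \<preceq> x \<and> x \<preceq> b \<longrightarrow> \<bar>f x\<bar> \<le> K"
      using f unfolding dual_carrier order_bounded_def by metis
    then show "\<exists>K. \<forall>x\<in>carrier E. a \<preceq> x \<and> x \<preceq> b \<longrightarrow> \<bar>(\<lambda>x\<in>carrier E. c * f x) x\<bar> \<le> K"
      by (intro exI[of _ "\<bar>c\<bar> * K"]) (auto simp: abs_mult intro!: mult_left_mono)
  qed
  then show ?thesis
    using f by (auto simp: dual_carrier linear_functional_def algebra_simps)
qed

lemma dual_minus_closed:
  assumes f: "f \<in> carrier (dual E)" and g: "g \<in> carrier (dual E)"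
  shows "(\<lambda>x\<in>carrier E. f x - g x) \<in> carrier (dual E)"
proof -
  have "(\<lambda>x\<in>carrier E. f x + (\<lambda>x\<in>carrier E. (-1) * g x) x) \<in> carrier (dual E)"
    using f g by (intro dual_add_closed dual_smult_closed)
  moreover have "(\<lambda>x\<in>carrier E. f x + (\<lambda>x\<in>carrier E. (-1) * g x) x) = (\<lambda>x\<in>carrier E. f x - g x)"
    by auto
  ultimately show ?thesis by simp
qed

lemma dual_ext: "f \<in> carrier (dual E) \<Longrightarrow> (\<lambda>x\<in>carrier E. f x) = f"
  by (simp add: dual_carrier extensional_restrict)

lemma module_dual: "module real_ring (dual E)"
proof (rule moduleI)
  show "abelian_group (dual E)"
  proof (rule abelian_groupI)
    fix f assume f: "f \<in> carrier (dual E)"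
    show "\<zero>\<^bsub>dual E\<^esub> \<oplus>\<^bsub>dual E\<^esub> f = f"
      using dual_ext[OF f] by (simp cong: restrict_cong)
    show "\<exists>g\<in>carrier (dual E). g \<oplus>\<^bsub>dual E\<^esub> f = \<zero>\<^bsub>dual E\<^esub>"
      using dual_smult_closed[OF f, of "-1"] by (intro bexI) (auto simp: restrict_def)
  qed (use dual_zero_closed dual_add_closed in \<open>simp_all add: algebra_simps cong: restrict_cong\<close>)
  fix f assume f: "f \<in> carrier (dual E)"
  show "\<one>\<^bsub>real_ring\<^esub> \<odot>\<^bsub>dual E\<^esub> f = f"
    using dual_ext[OF f] by simp
qed (use cring_real_ring dual_smult_closed in \<open>simp_all add: algebra_simps cong: restrict_cong\<close>)

text \<open>The supremum is g plus the positive part of f - g. The last clause is the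
  Riesz-Kantorovich formula for two functionals; it turns lattice statements about functionals into
  estimates at points.\<close>

lemma dual_sup_exists:
  assumes f: "f \<in> carrier (dual E)" and g: "g \<in> carrier (dual E)"
  obtains s where "s \<in> carrier (dual E)" "f \<unlhd> s" "g \<unlhd> s"
    "\<And>t. \<lbrakk>t \<in> carrier (dual E); f \<unlhd> t; g \<unlhd> t\<rbrakk> \<Longrightarrow> s \<unlhd> t"
    "\<And>x e. \<lbrakk>x \<in> pcone E; 0 < e\<rbrakk> \<Longrightarrow> \<exists>a\<in>pcone E. \<exists>b\<in>pcone E. x = a \<oplus> b \<and> s x < f a + g b + e"
proof -
  define h where "h = (\<lambda>x\<in>carrier E. f x - g x)"
  have h: "h \<in> carrier (dual E)" unfolding h_def using f g by (rule dual_minus_closed)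
  obtain r where r: "r \<in> pcone (dual E)"
    "\<And>x t. \<lbrakk>x \<in> pcone E; t \<in> pcone E; t \<preceq> x\<rbrakk> \<Longrightarrow> h t \<le> r x"
    "\<And>x e. \<lbrakk>x \<in> pcone E; 0 < e\<rbrakk> \<Longrightarrow> \<exists>t\<in>pcone E. t \<preceq> x \<and> r x < h t + e"
    using functional_pos_part[OF h] by blast
  define s where "s = (\<lambda>x\<in>carrier E. g x + r x)"
  have s: "s \<in> carrier (dual E)"
    unfolding s_def using g r(1) by (intro dual_add_closed) (auto simp: pcone_dual)
  have ap: "\<exists>a\<in>pcone E. \<exists>b\<in>pcone E. x = a \<oplus> b \<and> s x < f a + g b + e" if x: "x \<in> pcone E" and e: "0 < e" for x e
  proof -
    obtain a where a: "a \<in> pcone E" "a \<preceq> x" "r x < h a + e" using r(3)[OF x e] by blast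
    then obtain b where b: "b \<in> pcone E" "x = a \<oplus> b" using vle_iff[of a x] x pcone_closed by blast
    have "g x = g a + g b" using functional_add[OF g] a b pcone_closed by simp
    then have "s x < f a + g b + e" using a x pcone_closed by (simp add: s_def h_def)
    then show ?thesis using a b by blast
  qed
  show ?thesis
  proof (rule that[OF s _ _ _ ap])
    show "f \<unlhd> s"
      using r(2)[of x x for x] by (force simp: dual_vle s_def h_def pcone_closed vle_refl)
    show "g \<unlhd> s"
      using r(1) by (auto simp: dual_vle s_def pcone_closed pcone_dual)
    fix t assume t: "t \<in> carrier (dual E)" "f \<unlhd> t" "g \<unlhd> t"
    show "s \<unlhd> t"
      unfolding dual_vle
    proof (intro ballI real_le_if_le_add_eps)
      fix x and e :: real assume "x \<in> pcone E" "0 < e"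
      with ap obtain a b where ab: "a \<in> pcone E" "b \<in> pcone E" "x = a \<oplus> b" "s x < f a + g b + e" by blast
      moreover have "t x = t a + t b" using functional_add[OF t(1)] ab pcone_closed by simp
      moreover have "f a \<le> t a" "g b \<le> t b" using t ab by (auto simp: dual_vle)
      ultimately show "s x < t x + e" by simp
    qed
  qed
qed

lemma riesz_space_dual: "riesz_space (dual E)"
proof (rule riesz_spaceI[OF module_dual])
  fix f g assume fg: "f \<unlhd> g" "g \<unlhd> f"
    "f \<in> carrier (dual E)" "g \<in> carrier (dual E)"
  have "f x = g x" if "x \<in> pcone E" for x
    using fg that by (meson dual_vle order_antisym)
  then show "f = g" using functional_pos_eqI[OF riesz_space_axioms] fg by blast
next
  fix f g assume "f \<in> carrier (dual E)" "g \<in> carrier (dual E)"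
  then show "\<exists>s\<in>carrier (dual E). f \<unlhd> s \<and> g \<unlhd> s \<and>
      (\<forall>t\<in>carrier (dual E). f \<unlhd> t \<longrightarrow> g \<unlhd> t \<longrightarrow> s \<unlhd> t)"
    by (rule dual_sup_exists) blast
qed (auto simp: dual_vle pcone_closed intro: order_trans mult_left_mono)

lemma dual_uminus:
  assumes f: "f \<in> carrier (dual E)"
  shows "\<ominus>\<^bsub>dual E\<^esub> f = (\<lambda>x\<in>carrier E. - f x)"
proof -
  interpret D: module real_ring "dual E" by (rule module_dual)
  have "(\<lambda>x\<in>carrier E. - f x) \<in> carrier (dual E)"
    using dual_smult_closed[OF f, of "-1"] by simp
  moreover have "(\<lambda>x\<in>carrier E. - f x) \<oplus>\<^bsub>dual E\<^esub> f = \<zero>\<^bsub>dual E\<^esub>"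
    by auto
  ultimately show ?thesis using D.minus_equality f by blast
qed

lemma dual_vsup_approx:
  assumes f: "f \<in> carrier (dual E)" and g: "g \<in> carrier (dual E)"
    and "x \<in> pcone E" "0 < e"
  shows "\<exists>a\<in>pcone E. \<exists>b\<in>pcone E. x = a \<oplus> b \<and> vsup (dual E) f g x < f a + g b + e"
proof -
  interpret D: riesz_space "dual E" by (rule riesz_space_dual)
  obtain s where s: "s \<in> carrier (dual E)" "f \<unlhd> s" "g \<unlhd> s"
    "\<And>t. \<lbrakk>t \<in> carrier (dual E); f \<unlhd> t; g \<unlhd> t\<rbrakk> \<Longrightarrow> s \<unlhd> t"
    "\<And>x e. \<lbrakk>x \<in> pcone E; 0 < e\<rbrakk> \<Longrightarrow> \<exists>a\<in>pcone E. \<exists>b\<in>pcone E. x = a \<oplus> b \<and> s x < f a + g b + e"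
    using dual_sup_exists[OF f g] by blast
  have "vsup (dual E) f g = s" by (rule D.vsup_eqI) (use f g s in auto)
  then show ?thesis using s(5) assms(3,4) by simp
qed

text \<open>Splitting x into its positive and negative part reduces the estimate to the cone, where
  |f| dominates f and -f.\<close>

lemma functional_abs_le:
  assumes f: "f \<in> carrier (dual E)" and x: "x \<in> carrier E"
  shows "\<bar>f x\<bar> \<le> vabs (dual E) f (vabs E x)"
proof -
  interpret D: riesz_space "dual E" by (rule riesz_space_dual)
  obtain p n where pn: "p \<in> pcone E" "n \<in> pcone E" "p = x \<oplus> n" "vabs E x = p \<oplus> n"
    using jordan_decomposition[OF x] by metis
  have C: "p \<in> carrier E" "n \<in> carrier E" using pn pcone_closed by auto
  let ?g = "vabs (dual E) f"
  have g: "?g \<in> carrier (dual E)" using f by (rule D.vabs_closed)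
  have *: "\<bar>f y\<bar> \<le> ?g y" if "y \<in> pcone E" for y
    using D.vabs_ge[OF f] that pcone_closed[OF that] dual_uminus[OF f]
    by (auto simp: dual_vle abs_le_iff)
  have "f p = f x + f n" using functional_add[OF f x C(2)] pn by simp
  then have "\<bar>f x\<bar> \<le> \<bar>f p\<bar> + \<bar>f n\<bar>" by linarith
  also have "\<dots> \<le> ?g p + ?g n" using *[OF pn(1)] *[OF pn(2)] by linarith
  also have "\<dots> = ?g (vabs E x)" using functional_add[OF g C] pn by simp
  finally show ?thesis .
qed

text \<open>Disjoint functionals satisfy u + w \<le> u \<squnion> w. A splitting x = b + a that is
  nearly optimal for the supremum, with value u b + w a, therefore falls short of u x + w x by
  little, and the shortfall is exactly u a + w b. Read in the dual, the lemma distributes a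
  functional h between \<xi> and \<eta>.\<close>

lemma dual_disjoint_approx:
  assumes d: "vdisjoint (dual E) u w" and x: "x \<in> pcone E" and e: "0 < e"
  obtains a b where "a \<in> pcone E" "b \<in> pcone E" "x = a \<oplus> b" "u a + w b < e"
proof -
  interpret D: riesz_space "dual E" by (rule riesz_space_dual)
  have u: "u \<in> carrier (dual E)" and w: "w \<in> carrier (dual E)"
    using d by (auto simp: vdisjoint_def pcone_def)
  define s where "s = vsup (dual E) u w"
  have s: "s \<in> carrier (dual E)" unfolding s_def using u w by (rule D.vsup_closed)
  \<comment> \<open>\<open>u + w - sup u w\<close> is a lower bound, hence negative.\<close>
  define t where "t = (\<lambda>y\<in>carrier E. (\<lambda>y\<in>carrier E. u y + w y) y - s y)"
  have t: "t \<in> carrier (dual E)"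
    unfolding t_def by (intro dual_minus_closed dual_add_closed u w s)
  have "t \<unlhd> u" "t \<unlhd> w"
    using D.vsup_upper[OF u w] by (auto simp: t_def s_def dual_vle pcone_closed)
  then have "t \<unlhd> \<zero>\<^bsub>dual E\<^esub>" using d t by (auto simp: vdisjoint_def)
  then have "t x \<le> 0" using x by (auto simp: dual_vle pcone_closed)
  then have le: "u x + w x \<le> s x" using x by (simp add: t_def pcone_closed)
  obtain b a where ab: "b \<in> pcone E" "a \<in> pcone E" "x = b \<oplus> a" "s x < u b + w a + e"
    using dual_vsup_approx[OF u w x e] unfolding s_def by blast
  have "u x = u b + u a" "w x = w b + w a"
    using functional_add[OF u, of b a] functional_add[OF w, of b a] ab pcone_closed by auto
  then have "u a + w b < e" using le ab by simp
  then show ?thesis using that[of a b] ab pcone_closed by (simp add: M.a_comm)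
qed

section \<open>Dominated functionals, truncation and components\<close>

lemma vabs_le_iff:
  assumes "x \<in> carrier E" "y \<in> carrier E" "x \<preceq> y" "\<ominus> x \<preceq> y"
  shows "vabs E x \<preceq> y"
  unfolding vabs_def using assms by (intro vsup_least) auto

lemma uminus_vle:
  assumes "x \<preceq> y" "x \<in> carrier E" "y \<in> carrier E" shows "\<ominus> y \<preceq> \<ominus> x"
proof -
  obtain p where p: "p \<in> pcone E" "y = x \<oplus> p" using assms vle_iff by auto
  then have "\<ominus> x = \<ominus> y \<oplus> p"
    using assms(2) pcone_closed[OF p(1)] by (simp add: M.minus_add M.a_assoc M.l_neg)
  then show ?thesis using vle_add[of "\<ominus> y" p] p assms by simp
qed

lemma vabs_between:
  assumes "a \<preceq> t" "t \<preceq> b" "a \<in> carrier E" "t \<in> carrier E" "b \<in> carrier E"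
  shows "vabs E t \<preceq> vabs E a \<oplus> vabs E b"
proof (rule vabs_le_iff)
  have C: "vabs E a \<in> carrier E" "vabs E b \<in> carrier E" and P: "vabs E a \<in> pcone E" "vabs E b \<in> pcone E"
    using assms vabs_closed vabs_pcone by auto
  have "t \<preceq> vabs E b" using assms C vabs_ge(1)[of b] vle_trans[of t b "vabs E b"] by simp
  moreover have "vabs E b \<preceq> vabs E a \<oplus> vabs E b" using vle_add[OF C(2) P(1)] C by (simp add: M.a_comm)
  ultimately show "t \<preceq> vabs E a \<oplus> vabs E b" using vle_trans assms C by (meson M.a_closed)
  have "\<ominus> t \<preceq> vabs E a"
    using assms C vabs_ge(2)[of a] uminus_vle[of a t] vle_trans[of "\<ominus> t" "\<ominus> a" "vabs E a"] by simp
  moreover have "vabs E a \<preceq> vabs E a \<oplus> vabs E b" using vle_add[OF C(1) P(2)] .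
  ultimately show "\<ominus> t \<preceq> vabs E a \<oplus> vabs E b" using vle_trans assms C by (meson M.a_closed M.a_inv_closed)
qed (use assms vabs_closed in auto)

text \<open>Membership in the order dual for functionals that need not be positive: a dominating
  positive g bounds f on the interval from a to b by its value at |a| + |b|. The absolute value of f
  is controlled at the same time.\<close>

lemma dominated_functional:
  assumes f: "f \<in> extensional (carrier E)" "linear_functional E f" and g: "g \<in> pcone (dual E)"
    and dom: "\<And>t. t \<in> carrier E \<Longrightarrow> \<bar>f t\<bar> \<le> g (vabs E t)"
  shows "f \<in> carrier (dual E)" "vabs (dual E) f \<unlhd> g"
proof -
  interpret D: riesz_space "dual E" by (rule riesz_space_dual)
  have "order_bounded E f"
    unfolding order_bounded_def
  proof (intro ballI exI impI)
    fix a b t assume C: "a \<in> carrier E" "b \<in> carrier E" "t \<in> carrier E" and "a \<preceq> t \<and> t \<preceq> b"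
    then have "g (vabs E t) \<le> g (vabs E a \<oplus> vabs E b)"
      by (intro functional_mono[OF g] vabs_between) (auto simp: vabs_closed)
    then show "\<bar>f t\<bar> \<le> g (vabs E a \<oplus> vabs E b)" using dom[OF C(3)] by simp
  qed
  then show fC: "f \<in> carrier (dual E)" using f by (simp add: dual_carrier)
  have "\<bar>f t\<bar> \<le> g t" if "t \<in> pcone E" for t
    using dom[of t] that vabs_pos[OF that] pcone_closed by simp
  then show "vabs (dual E) f \<unlhd> g"
    using fC g by (intro D.vabs_le_iff)
      (auto simp: dual_vle dual_uminus pcone_closed pcone_dual abs_le_iff)
qed

lemma vabs_uminus: "x \<in> carrier E \<Longrightarrow> vabs E (\<ominus> x) = vabs E x"
  by (simp add: vabs_def join_comm)

lemma vabs_triangle: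
  assumes "x \<in> carrier E" "y \<in> carrier E" shows "vabs E (x \<oplus> y) \<preceq> vabs E x \<oplus> vabs E y"
proof (rule vabs_le_iff)
  show "x \<oplus> y \<preceq> vabs E x \<oplus> vabs E y"
    using assms by (intro add_mono2 vabs_ge) (auto simp: vabs_closed)
  have "\<ominus> x \<oplus> \<ominus> y \<preceq> vabs E x \<oplus> vabs E y"
    using assms by (intro add_mono2 vabs_ge) (auto simp: vabs_closed)
  then show "\<ominus> (x \<oplus> y) \<preceq> vabs E x \<oplus> vabs E y" using assms by (simp add: M.minus_add)
qed (use assms vabs_closed in auto)

lemma vabs_diff_disjoint:
  assumes C: "a \<in> carrier E" "b \<in> carrier E" "z \<in> carrier E" and z: "a = z \<oplus> b"
    and d: "vdisjoint E (vabs E a) (vabs E b)"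
  shows "vabs E z = vabs E a \<oplus> vabs E b"
proof (rule vle_antisym)
  have vC: "vabs E a \<in> carrier E" "vabs E b \<in> carrier E" "vabs E z \<in> carrier E" using C vabs_closed by auto
  have vP: "vabs E a \<in> pcone E" "vabs E b \<in> pcone E" "vabs E z \<in> pcone E" using C vabs_pcone by auto
  have z': "z = a \<oplus> \<ominus> b" using z C by (simp add: M.a_assoc M.r_neg)
  then have b: "b = \<ominus> z \<oplus> a" using C by (simp add: z M.r_neg1)
  show "vabs E z \<preceq> vabs E a \<oplus> vabs E b"
    using vabs_triangle[of a "\<ominus> b"] vabs_uminus[of b] z' C by simp
  \<comment> \<open>If p is disjoint from q, then the part of p lying under q in p \<le> s + q
    vanishes, so p \<le> s. This is used once for |a| and twice for |b|, the second time to fit |b|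
    into the remainder of |z| after |a|.\<close>
  have le: "p \<preceq> s" if d: "vdisjoint E p q" and le: "p \<preceq> s \<oplus> q" and s: "s \<in> pcone E" for p q s
  proof -
    have pq: "p \<in> pcone E" "q \<in> pcone E" using d by (auto simp: vdisjoint_def)
    obtain c d where cd: "c \<in> pcone E" "d \<in> pcone E" "p = c \<oplus> d" "c \<preceq> s" "d \<preceq> q" "d \<preceq> p"
      using riesz_decomposition[OF pq(1) s pq(2) le] by metis
    then have "d = \<zero>" using vdisjoint_zeroD[OF \<open>vdisjoint E p q\<close>] by blast
    then show ?thesis using cd pcone_closed by simp
  qed
  have "vabs E a \<preceq> vabs E z \<oplus> vabs E b" using vabs_triangle[of z b] z C by simp
  from le[OF d this vP(3)] obtain q where q: "q \<in> pcone E" "vabs E z = vabs E a \<oplus> q"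
    using vle_iff vC by auto
  have qC: "q \<in> carrier E" using q pcone_closed by auto
  have "vabs E b \<preceq> vabs E z \<oplus> vabs E a" using vabs_triangle[of "\<ominus> z" a] vabs_uminus[of z] b C by simp
  then have "vabs E b \<preceq> vabs E z" using le[OF vdisjoint_sym[OF d]] vP by blast
  then have "vabs E b \<preceq> q \<oplus> vabs E a" using q qC vC by (simp add: M.a_comm)
  then have "vabs E b \<preceq> q" using le[OF vdisjoint_sym[OF d]] q by blast
  then show "vabs E a \<oplus> vabs E b \<preceq> vabs E z" unfolding q(2) using vC qC by (intro add_mono2 vle_refl) auto
qed (use C vabs_closed in auto)

lemma vinf_pcone: "\<lbrakk>x \<in> pcone E; y \<in> pcone E\<rbrakk> \<Longrightarrow> vinf E x y \<in> pcone E"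
  by (simp add: pcone_def vinf_closed vinf_greatest)

lemma vinf_mono:
  assumes "x \<preceq> x'" "x \<in> carrier E" "x' \<in> carrier E" "y \<in> carrier E" shows "vinf E x y \<preceq> vinf E x' y"
  using assms vle_trans[OF vinf_lower(1)[of x y] assms(1)]
  by (intro vinf_greatest) (auto simp: vinf_closed intro: vinf_lower)

text \<open>Decomposing the left side along x + y gives parts that are also below w. This
  subadditivity is what makes truncated slices gauges.\<close>

lemma vinf_add_le:
  assumes "x \<in> pcone E" "y \<in> pcone E" "w \<in> pcone E"
  shows "vinf E (x \<oplus> y) w \<preceq> vinf E x w \<oplus> vinf E y w"
proof -
  have C: "x \<in> carrier E" "y \<in> carrier E" "w \<in> carrier E" using assms pcone_closed by auto
  let ?t = "vinf E (x \<oplus> y) w"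
  have t: "?t \<in> pcone E" "?t \<in> carrier E" "?t \<preceq> x \<oplus> y" "?t \<preceq> w"
    using assms C by (auto intro: vinf_pcone pcone_add vinf_closed vinf_lower)
  obtain a b where ab: "a \<in> pcone E" "b \<in> pcone E" "?t = a \<oplus> b" "a \<preceq> x" "b \<preceq> y" "a \<preceq> ?t" "b \<preceq> ?t"
    using riesz_decomposition[OF t(1) assms(1,2) t(3)] by metis
  have abC: "a \<in> carrier E" "b \<in> carrier E" using ab pcone_closed by auto
  have "a \<preceq> w" "b \<preceq> w"
    using vle_trans[OF ab(6) t(4) abC(1) t(2) C(3)] vle_trans[OF ab(7) t(4) abC(2) t(2) C(3)] by auto
  then have "a \<preceq> vinf E x w" "b \<preceq> vinf E y w" using ab abC C by (auto intro: vinf_greatest)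
  then show ?thesis unfolding ab(3) using abC C by (intro add_mono2 vinf_closed)
qed

text \<open>The component of f on the disjoint complement of a: g v is the supremum of f z over
  positive z \<le> v that are disjoint from a. It is additive because sums of such z, and the parts
  of their Riesz decompositions, are again disjoint from a. Below a only z = 0 is admissible,
  whereas below b the element b itself is.\<close>

lemma functional_disjoint_component:
  assumes d: "vdisjoint E a b" and f: "f \<in> pcone (dual E)"
  obtains g where "g \<in> pcone (dual E)" "g \<unlhd> f" "g a = 0" "g b = f b"
proof -
  have P: "a \<in> pcone E" "b \<in> pcone E" using d by (auto simp: vdisjoint_def)
  have fC: "f \<in> carrier (dual E)" using f by (rule pcone_dual_closed)
  define S where "S v = {z \<in> pcone E. z \<preceq> v \<and> vdisjoint E z a}" for v
  define q where "q v = Sup (f ` S v)" for v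
  have zS: "\<zero> \<in> S v" if "v \<in> pcone E" for v
    using that pcone_zero P(1) by (auto simp: S_def pcone_def vdisjoint_def)
  have le: "f z \<le> f v" if "v \<in> pcone E" "z \<in> S v" for v z
    using that functional_mono[OF f, of z v] pcone_closed by (auto simp: S_def)
  have up: "f z \<le> q v" if "v \<in> pcone E" "z \<in> S v" for v z
    unfolding q_def using that le[OF that(1)] by (intro cSup_upper bdd_aboveI[of _ "f v"]) auto
  have qle: "q v \<le> c" if "v \<in> pcone E" "\<And>z. z \<in> S v \<Longrightarrow> f z \<le> c" for v c
    unfolding q_def using zS[OF that(1)] that(2) by (intro cSup_least) auto
  have nonneg: "0 \<le> q v" if "v \<in> pcone E" for v using up[OF that zS[OF that]] functional_zero[OF fC] by simp
  have add: "q (v \<oplus> w) = q v + q w" if v: "v \<in> pcone E" and w: "w \<in> pcone E" for v w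
  proof (rule antisym)
    have vw: "v \<oplus> w \<in> pcone E" using v w by (rule pcone_add)
    show "q (v \<oplus> w) \<le> q v + q w"
    proof (rule qle[OF vw])
      fix z assume z: "z \<in> S (v \<oplus> w)"
      then obtain c e where ce: "c \<in> pcone E" "e \<in> pcone E" "z = c \<oplus> e" "c \<preceq> v" "e \<preceq> w" "c \<preceq> z" "e \<preceq> z"
        using riesz_decomposition[OF _ v w, of z] unfolding S_def by blast
      have za: "vdisjoint E z a" using z by (simp add: S_def)
      have "vdisjoint E c a" "vdisjoint E e a"
        using vdisjoint_mono[OF za _ P(1)] ce P vle_refl pcone_closed by auto
      then have "c \<in> S v" "e \<in> S w" using ce by (auto simp: S_def)
      then show "f z \<le> q v + q w" using up[OF v] up[OF w] ce functional_add[OF fC] pcone_closed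
        by (metis Groups.add_mono)
    qed
    have "f c + f e \<le> q (v \<oplus> w)" if c: "c \<in> S v" and e: "e \<in> S w" for c e
    proof -
      have C: "c \<in> carrier E" "e \<in> carrier E" using c e pcone_closed by (auto simp: S_def)
      have "c \<oplus> e \<in> S (v \<oplus> w)"
        using c e C v w pcone_closed by (auto simp: S_def intro: pcone_add vdisjoint_add add_mono2)
      then show ?thesis using up[OF vw, of "c \<oplus> e"] functional_add[OF fC C] by simp
    qed
    then have "q v \<le> q (v \<oplus> w) - f e" if "e \<in> S w" for e
      using that by (intro qle[OF v]) (auto simp: algebra_simps)
    then have "q w \<le> q (v \<oplus> w) - q v" by (intro qle[OF w]) (auto simp: algebra_simps)
    then show "q v + q w \<le> q (v \<oplus> w)" by simp
  qed
  obtain g where g: "g \<in> pcone (dual E)" "\<And>x. x \<in> pcone E \<Longrightarrow> g x = q x"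
    using cone_additive_extension[of q] nonneg add by blast
  have "g \<unlhd> f" using g(2) qle le by (auto simp: dual_vle)
  moreover have "q a \<le> 0"
  proof (rule qle[OF P(1)])
    fix z assume z: "z \<in> S a"
    then have "z \<preceq> z" by (simp add: S_def vle_refl pcone_closed)
    then have "z = \<zero>" using z vdisjoint_zeroD[of z a z] by (auto simp: S_def)
    then show "f z \<le> 0" using functional_zero[OF fC] by simp
  qed
  moreover have "b \<in> S b" using P vdisjoint_sym[OF d] by (auto simp: S_def vle_refl pcone_closed)
  then have "f b \<le> q b" using up P by blast
  moreover have "q b \<le> f b" using qle[OF P(2)] le[OF P(2)] by blast
  ultimately show ?thesis using that[OF g(1)] g(2) P nonneg[OF P(1)] by force
qed

text \<open>Additivity and homogeneity in one rule. The combination is described by its values, so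
  that slices need not be rewritten as module expressions.\<close>

lemma bidual_lincomb:
  assumes \<phi>: "\<phi> \<in> carrier (dual (dual E))"
    and C: "f \<in> carrier (dual E)" "g \<in> carrier (dual E)" "h \<in> carrier (dual E)"
    and eq: "\<And>t. t \<in> carrier E \<Longrightarrow> h t = c * f t + d * g t"
  shows "\<phi> h = c * \<phi> f + d * \<phi> g"
proof -
  interpret D: riesz_space "dual E" by (rule riesz_space_dual)
  have "h = c \<odot>\<^bsub>dual E\<^esub> f \<oplus>\<^bsub>dual E\<^esub> d \<odot>\<^bsub>dual E\<^esub> g"
    using C(3) eq by (intro extensionalityI[of _ "carrier E"]) (auto simp: dual_carrier)
  moreover have "c \<odot>\<^bsub>dual E\<^esub> f \<in> carrier (dual E)" "d \<odot>\<^bsub>dual E\<^esub> g \<in> carrier (dual E)"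
    by (rule D.smult_closed[OF _ C(1)] D.smult_closed[OF _ C(2)], simp)+
  ultimately show ?thesis
    by (simp only: functional_add[OF \<phi>] functional_smult[OF \<phi> C(1)] functional_smult[OF \<phi> C(2)])
qed

end

section \<open>Separation in order duals\<close>

definition dual_diff :: "('a, 'b) ordered_module_scheme \<Rightarrow> ('a \<Rightarrow> real) \<Rightarrow> ('a \<Rightarrow> real) \<Rightarrow> 'a \<Rightarrow> real" where
  "dual_diff E f g = (\<lambda>x\<in>carrier E. f x - g x)"

text \<open>The supremum is required to be pointwise on the cone. In an order dual every bounded
  directed set has such a supremum, and pointwise approximation is the property that can be handed
  on from the forms of one stage to their slices.\<close>

definition directed_sup :: "('a, 'b) ordered_module_scheme \<Rightarrow> ('a \<Rightarrow> real) set \<Rightarrow> ('a \<Rightarrow> real) \<Rightarrow> bool" where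
  "directed_sup E D s \<longleftrightarrow> D \<noteq> {} \<and> D \<subseteq> pcone (dual E) \<and> s \<in> pcone (dual E) \<and>
     (\<forall>d\<in>D. \<forall>d'\<in>D. \<exists>d''\<in>D. d \<unlhd>\<^bsub>E\<^esub> d'' \<and> d' \<unlhd>\<^bsub>E\<^esub> d'') \<and>
     (\<forall>d\<in>D. d \<unlhd>\<^bsub>E\<^esub> s) \<and>
     (\<forall>x\<in>pcone E. \<forall>e>0. \<exists>d\<in>D. s x < d x + e)"

text \<open>Positive order continuous functionals on the order dual are gauges; so are the truncations
  \<open>g \<mapsto> (T g \<and> w) y\<close> of positive order continuous operators \<open>T\<close>, which are not linear.\<close>

definition gauge :: "('a, 'b) ordered_module_scheme \<Rightarrow> (('a \<Rightarrow> real) \<Rightarrow> real) \<Rightarrow> bool" where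
  "gauge E \<alpha> \<longleftrightarrow>
     (\<forall>g\<in>pcone (dual E). 0 \<le> \<alpha> g) \<and>
     (\<forall>g\<in>pcone (dual E). \<forall>h\<in>pcone (dual E). g \<unlhd>\<^bsub>E\<^esub> h \<longrightarrow> \<alpha> g \<le> \<alpha> h) \<and>
     (\<forall>g\<in>pcone (dual E). \<forall>h\<in>pcone (dual E). \<alpha> (g \<oplus>\<^bsub>dual E\<^esub> h) \<le> \<alpha> g + \<alpha> h) \<and>
     (\<forall>D s. directed_sup E D s \<longrightarrow> (\<forall>e>0. \<exists>d\<in>D. \<alpha> s < \<alpha> d + e))"

lemma gaugeD:
  assumes "gauge E \<alpha>"
  shows "g \<in> pcone (dual E) \<Longrightarrow> 0 \<le> \<alpha> g"
    and "\<lbrakk>g \<in> pcone (dual E); h \<in> pcone (dual E); g \<unlhd>\<^bsub>E\<^esub> h\<rbrakk> \<Longrightarrow> \<alpha> g \<le> \<alpha> h"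
    and "\<lbrakk>g \<in> pcone (dual E); h \<in> pcone (dual E)\<rbrakk> \<Longrightarrow> \<alpha> (g \<oplus>\<^bsub>dual E\<^esub> h) \<le> \<alpha> g + \<alpha> h"
    and "\<lbrakk>directed_sup E D s; 0 < e\<rbrakk> \<Longrightarrow> \<exists>d\<in>D. \<alpha> s < \<alpha> d + e"
  using assms unfolding gauge_def by blast+

lemma gauge_directed_sup_le:
  assumes "gauge E \<alpha>" "directed_sup E D s" "\<And>d. d \<in> D \<Longrightarrow> \<alpha> d \<le> c"
  shows "\<alpha> s \<le> c"
proof (rule real_le_if_le_add_eps)
  fix e :: real assume "0 < e"
  then obtain d where "d \<in> D" "\<alpha> s < \<alpha> d + e" using gaugeD(4)[OF assms(1,2)] by blast
  then show "\<alpha> s < c + e" using assms(3)[of d] by simp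
qed

section \<open>Directed suprema and exact separators\<close>

context riesz_space
begin

lemma dual_vle_refl: "f \<unlhd> f"
  by (simp add: dual_vle)

lemma dual_vle_trans: "\<lbrakk>f \<unlhd> g; g \<unlhd> h\<rbrakk> \<Longrightarrow> f \<unlhd> h"
  by (force simp: dual_vle)

lemma dual_pcone_vle:
  "\<lbrakk>f \<in> pcone (dual E); g \<in> carrier (dual E); f \<unlhd> g\<rbrakk> \<Longrightarrow> g \<in> pcone (dual E)"
  by (force simp: dual_vle pcone_dual)

lemma dual_diff_pcone:
  assumes "f \<in> carrier (dual E)" "g \<in> carrier (dual E)" "g \<unlhd> f"
  shows "dual_diff E f g \<in> pcone (dual E)"
  using dual_minus_closed[OF assms(1,2)] assms(3)
  by (auto simp: pcone_dual dual_diff_def dual_vle pcone_closed)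

lemma dual_diff_le: "g \<in> pcone (dual E) \<Longrightarrow> dual_diff E f g \<unlhd> f"
  by (auto simp: dual_vle dual_diff_def pcone_closed pcone_dual)

lemma dual_diff_antimono:
  "g \<unlhd> h \<Longrightarrow> dual_diff E f h \<unlhd> dual_diff E f g"
  by (auto simp: dual_vle dual_diff_def pcone_closed)

lemma dual_diff_diff:
  assumes "g \<in> carrier (dual E)" shows "dual_diff E f (dual_diff E f g) = g"
  using dual_ext[OF assms] by (simp add: dual_diff_def cong: restrict_cong)

lemma dual_vsup:
  assumes "f \<in> carrier (dual E)" "g \<in> carrier (dual E)"
  shows "vsup (dual E) f g \<in> carrier (dual E)"
    "f \<unlhd> vsup (dual E) f g" "g \<unlhd> vsup (dual E) f g"
    "\<And>t. \<lbrakk>t \<in> carrier (dual E); f \<unlhd> t; g \<unlhd> t\<rbrakk>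
      \<Longrightarrow> vsup (dual E) f g \<unlhd> t"
proof -
  interpret D: riesz_space "dual E" by (rule riesz_space_dual)
  show "vsup (dual E) f g \<in> carrier (dual E)"
    "f \<unlhd> vsup (dual E) f g" "g \<unlhd> vsup (dual E) f g"
    "\<And>t. \<lbrakk>t \<in> carrier (dual E); f \<unlhd> t; g \<unlhd> t\<rbrakk>
      \<Longrightarrow> vsup (dual E) f g \<unlhd> t"
    using assms by (auto intro: D.vsup_closed D.vsup_upper D.vsup_least)
qed

text \<open>For positive functionals the supremum lies below the sum, so subadditivity and
  monotonicity give the same bound for suprema.\<close>

lemma gauge_vsup:
  assumes "gauge E \<alpha>" and f: "f \<in> pcone (dual E)" and g: "g \<in> pcone (dual E)"
  shows "\<alpha> (vsup (dual E) f g) \<le> \<alpha> f + \<alpha> g"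
proof -
  interpret D: riesz_space "dual E" by (rule riesz_space_dual)
  have C: "f \<in> carrier (dual E)" "g \<in> carrier (dual E)" using f g pcone_dual_closed by auto
  have fg: "f \<oplus>\<^bsub>dual E\<^esub> g \<in> pcone (dual E)" using f g by (rule D.pcone_add)
  have "vsup (dual E) f g \<unlhd> f \<oplus>\<^bsub>dual E\<^esub> g"
    using fg C f g by (intro dual_vsup) (auto simp: dual_vle pcone_dual pcone_closed)
  moreover have "vsup (dual E) f g \<in> pcone (dual E)"
    using dual_pcone_vle[OF f] dual_vsup[OF C] by blast
  ultimately have "\<alpha> (vsup (dual E) f g) \<le> \<alpha> (f \<oplus>\<^bsub>dual E\<^esub> g)"
    using gaugeD(2)[OF assms(1)] fg by blast
  also have "\<dots> \<le> \<alpha> f + \<alpha> g" using gaugeD(3)[OF assms(1)] f g by blast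
  finally show ?thesis .
qed

lemma directed_sup_least:
  assumes "directed_sup E D s" "\<And>d. d \<in> D \<Longrightarrow> d \<unlhd> t"
  shows "s \<unlhd> t"
  unfolding dual_vle
proof (intro ballI real_le_if_le_add_eps)
  fix x and e :: real assume x: "x \<in> pcone E" and "0 < e"
  then obtain d where "d \<in> D" "s x < d x + e" using assms(1) unfolding directed_sup_def by blast
  then show "s x < t x + e" using assms(2)[of d] x by (force simp: dual_vle)
qed

text \<open>Dedekind completeness of the order dual. Directedness enters through additivity of the
  pointwise supremum: nearly optimal members for x and for y have a common majorant in D.\<close>

lemma directed_sup_exists:
  assumes ne: "D \<noteq> {}" and D: "D \<subseteq> pcone (dual E)"
    and dir: "\<And>d d'. \<lbrakk>d \<in> D; d' \<in> D\<rbrakk> \<Longrightarrow> \<exists>d''\<in>D. d \<unlhd> d'' \<and> d' \<unlhd> d''"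
    and bd: "\<And>d. d \<in> D \<Longrightarrow> d \<unlhd> f"
  obtains s where "directed_sup E D s" "s \<unlhd> f"
proof -
  define q where "q x = (SUP d\<in>D. d x)" for x
  have bdd: "bdd_above ((\<lambda>d. d x) ` D)" if "x \<in> pcone E" for x
    using bd that by (intro bdd_aboveI[of _ "f x"]) (auto simp: dual_vle)
  have up: "d x \<le> q x" if "x \<in> pcone E" "d \<in> D" for x d
    unfolding q_def using that by (intro cSup_upper bdd) auto
  have ap: "\<exists>d\<in>D. q x < d x + e" if "x \<in> pcone E" "0 < e" for x e
  proof -
    have "q x - e < (SUP d\<in>D. d x)" using that by (simp add: q_def)
    then obtain y where "y \<in> (\<lambda>d. d x) ` D" "q x - e < y"
      using less_cSupD[of "(\<lambda>d. d x) ` D"] ne by blast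
    then show ?thesis by (force simp: algebra_simps)
  qed
  have "0 \<le> q x" if "x \<in> pcone E" for x
  proof -
    obtain d where "d \<in> D" using ne by blast
    then show ?thesis using up[OF that, of d] D that pcone_dual_nonneg[of d E x] by force
  qed
  moreover have "q (x \<oplus> y) = q x + q y" if x: "x \<in> pcone E" and y: "y \<in> pcone E" for x y
  proof (rule antisym)
    have lin: "d (x \<oplus> y) = d x + d y" if "d \<in> D" for d
      using that D x y functional_add[of d E x y] pcone_closed pcone_dual_closed by blast
    have xy: "x \<oplus> y \<in> pcone E" using x y by (rule pcone_add)
    show "q (x \<oplus> y) \<le> q x + q y"
    proof (rule real_le_if_le_add_eps)
      fix e :: real assume "0 < e"
      with ap[OF xy] obtain d where "d \<in> D" "q (x \<oplus> y) < d (x \<oplus> y) + e" by blast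
      then show "q (x \<oplus> y) < q x + q y + e" using lin up[OF x, of d] up[OF y, of d] by force
    qed
    show "q x + q y \<le> q (x \<oplus> y)"
    proof (rule real_le_if_le_add_eps)
      fix e :: real assume "0 < e"
      then have e: "0 < e/2" by simp
      obtain d d' where d: "d \<in> D" "q x < d x + e/2" "d' \<in> D" "q y < d' y + e/2"
        using ap[OF x e] ap[OF y e] by blast
      obtain d'' where d'': "d'' \<in> D" "d \<unlhd> d''" "d' \<unlhd> d''"
        using dir d by blast
      have "d x \<le> d'' x" "d' y \<le> d'' y" using d'' x y by (auto simp: dual_vle)
      moreover have "d'' x + d'' y \<le> q (x \<oplus> y)" using up[OF xy d''(1)] lin[OF d''(1)] by simp
      ultimately show "q x + q y < q (x \<oplus> y) + e" using d by simp
    qed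
  qed
  ultimately obtain s where s: "s \<in> pcone (dual E)" "\<And>x. x \<in> pcone E \<Longrightarrow> s x = q x"
    using cone_additive_extension[of q] by blast
  have "directed_sup E D s"
    unfolding directed_sup_def using ne D dir s up ap by (auto simp: dual_vle)
  moreover from this have "s \<unlhd> f" using bd by (rule directed_sup_least)
  ultimately show ?thesis using that by blast
qed

text \<open>The limes superior of approximate separators is an exact one.\<close>

lemma exact_separation:
  assumes \<alpha>: "gauge E \<alpha>" and \<beta>: "gauge E \<beta>" and f: "f \<in> pcone (dual E)"
    and ap: "\<And>e. 0 < e \<Longrightarrow> \<exists>g\<in>pcone (dual E). g \<unlhd> f \<and> \<alpha> g < e \<and> \<beta> (dual_diff E f g) < e"
  obtains g where "g \<in> pcone (dual E)" "g \<unlhd> f" "\<alpha> g = 0" "\<beta> (dual_diff E f g) = 0"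
proof -
  let ?P = "pcone (dual E)"
  note PC = pcone_dual_closed
  have fC: "f \<in> carrier (dual E)" using f by (rule PC)
  have diffP: "dual_diff E f g \<in> ?P" if "g \<in> ?P" "g \<unlhd> f" for g
    using dual_diff_pcone[OF fC PC] that by blast
  \<comment> \<open>Errors (1/2)^n are summable, which keeps the suprema over tails of the sequence
    small.\<close>
  have "\<forall>n. \<exists>g. g \<in> ?P \<and> g \<unlhd> f \<and> \<alpha> g < (1/2)^n \<and> \<beta> (dual_diff E f g) < (1/2)^n"
    using ap by (meson half_gt_zero zero_less_one zero_less_power)
  then obtain G where G: "\<And>n. G n \<in> ?P" "\<And>n. G n \<unlhd> f"
    "\<And>n. \<alpha> (G n) < (1/2)^n" "\<And>n. \<beta> (dual_diff E f (G n)) < (1/2)^n"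
    by metis
  \<comment> \<open>J n N is the supremum of G n, ..., G (n + N).\<close>
  define J where "J n = rec_nat (G n) (\<lambda>N j. vsup (dual E) j (G (n + Suc N)))" for n
  have J0: "J n 0 = G n" and JS: "J n (Suc N) = vsup (dual E) (J n N) (G (n + Suc N))" for n N
    by (auto simp: J_def)
  \<comment> \<open>The bound is the sum of (1/2)^i for i from n to n + N.\<close>
  have J: "J n N \<in> ?P \<and> J n N \<unlhd> f \<and> \<alpha> (J n N) \<le> 2 * (1/2)^n - (1/2)^(n+N)" for n N
  proof (induction N)
    case 0
    then show ?case using G(1,2)[of n] G(3)[of n] by (simp add: J0)
  next
    case (Suc N)
    have C: "J n N \<in> carrier (dual E)" "G (n + Suc N) \<in> carrier (dual E)"
      using Suc G(1)[of "n + Suc N"] PC by auto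
    have "\<alpha> (J n (Suc N)) \<le> \<alpha> (J n N) + \<alpha> (G (n + Suc N))"
      unfolding JS using \<alpha> Suc G by (intro gauge_vsup) auto
    also have "\<dots> \<le> 2 * (1/2)^n - (1/2)^(n+N) + (1/2)^(n + Suc N)"
      using Suc G(3)[of "n + Suc N"] by (intro Groups.add_mono) auto
    also have "\<dots> = 2 * (1/2)^n - (1/2)^(n + Suc N)" by simp
    finally show ?case
      using Suc dual_vsup[OF C] dual_pcone_vle[of "J n N"] fC G(2)[of "n + Suc N"] by (auto simp: JS)
  qed
  have Jstep: "J n N \<unlhd> J n (Suc N)" "G (n + Suc N) \<unlhd> J n (Suc N)" for n N
    unfolding JS using dual_vsup[of "J n N" "G (n + Suc N)"] J[of n N] G(1) PC by auto
  have Jmono: "N \<le> M \<Longrightarrow> J n N \<unlhd> J n M" for n N M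
    by (induction M rule: dec_induct) (auto intro: dual_vle_refl dual_vle_trans Jstep)
  have "\<exists>s. directed_sup E (range (J n)) s \<and> s \<unlhd> f" for n
  proof (rule directed_sup_exists[of "range (J n)" f])
    fix d d' assume "d \<in> range (J n)" "d' \<in> range (J n)"
    then obtain N M where "d = J n N" "d' = J n M" by blast
    then show "\<exists>d''\<in>range (J n). d \<unlhd> d'' \<and> d' \<unlhd> d''"
      using Jmono[of N "max N M" n] Jmono[of M "max N M" n] by auto
  qed (use J in auto)
  \<comment> \<open>s n is the supremum of all G k with k \<ge> n. Order continuity of \<alpha>
    carries the bound 2 (1/2)^n over from the finite suprema.\<close>
  then obtain s where s: "\<And>n. directed_sup E (range (J n)) (s n)" "\<And>n. s n \<unlhd> f" by metis
  have sP: "s n \<in> ?P" for n using s(1)[of n] by (simp add: directed_sup_def)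
  have "\<alpha> d \<le> 2 * (1/2)^n" if d: "d \<in> range (J n)" for n d
  proof -
    obtain N where "d = J n N" using d by blast
    moreover have "0 \<le> (1/2 :: real)^(n+N)" by simp
    moreover have "\<alpha> (J n N) \<le> 2 * (1/2)^n - (1/2)^(n+N)" using J[of n N] by blast
    ultimately show ?thesis by (simp only:)
  qed
  then have \<alpha>s: "\<alpha> (s n) \<le> 2 * (1/2)^n" for n
    using gauge_directed_sup_le[OF \<alpha> s(1)[of n]] by blast
  have Js: "J n N \<unlhd> s n" for n N using s(1)[of n] by (auto simp: directed_sup_def)
  have Gs: "G k \<unlhd> s n" if nk: "n \<le> k" for n k
  proof (cases "k = n")
    case True
    then show ?thesis using Js[of n 0] by (simp add: J0)
  next
    case False
    then obtain N where "k = n + Suc N"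
      using nk by (metis le_neq_implies_less less_natE add_Suc_right)
    then show ?thesis using dual_vle_trans[OF Jstep(2)[of n N] Js[of n "Suc N"]] by simp
  qed
  have sdec: "s m \<unlhd> s n" if "n \<le> m" for n m
  proof (rule directed_sup_least[OF s(1)])
    fix d assume "d \<in> range (J m)"
    then obtain N where "d = J m N" by blast
    moreover have "J m N \<unlhd> s n"
    proof (induction N)
      case 0
      then show ?case using Gs that by (simp add: J0)
    next
      case (Suc N)
      have "J m N \<in> carrier (dual E)" using J[of m N] PC by blast
      with Suc show ?case unfolding JS
        by (intro dual_vsup(4) PC[OF G(1)] PC[OF sP] Gs) (use that in auto)
    qed
    ultimately show "d \<unlhd> s n" by simp
  qed
  \<comment> \<open>s n dominates G k for every k \<ge> n, so f - s n lies below each f - G k, and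
    \<beta> of the latter is less than (1/2)^k.\<close>
  have \<beta>s: "\<beta> (dual_diff E f (s n)) = 0" for n
  proof -
    have "\<beta> (dual_diff E f (s n)) \<le> (1/2)^k" if "n \<le> k" for k
      using gaugeD(2)[OF \<beta> diffP[OF sP s(2)] diffP[OF G(1) G(2)] dual_diff_antimono[OF Gs[OF that]]] G(4)[of k]
      by (meson less_imp_le order_trans)
    moreover have "(\<lambda>k. (1/2)^k) \<longlonglongrightarrow> (0::real)" by (simp add: LIMSEQ_realpow_zero)
    ultimately have "\<beta> (dual_diff E f (s n)) \<le> 0"
      by (intro LIMSEQ_le_const[of "\<lambda>k. (1/2)^k" 0]) auto
    then show ?thesis using gaugeD(1)[OF \<beta> diffP[OF sP s(2)], of n] by simp
  qed
  \<comment> \<open>The limes superior is the infimum of the decreasing s n. It is reached through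
    the supremum t of the increasing complements f - s n, because gauges are continuous along
    increasing sets; f - t is the separator.\<close>
  define D where "D = range (\<lambda>n. dual_diff E f (s n))"
  obtain t where t: "directed_sup E D t" "t \<unlhd> f"
  proof (rule directed_sup_exists[of D f])
    fix d d' assume "d \<in> D" "d' \<in> D"
    then obtain n m where "d = dual_diff E f (s n)" "d' = dual_diff E f (s m)" unfolding D_def by blast
    moreover have "dual_diff E f (s n) \<unlhd> dual_diff E f (s (max n m))"
      "dual_diff E f (s m) \<unlhd> dual_diff E f (s (max n m))"
      by (auto intro!: dual_diff_antimono sdec)
    ultimately show "\<exists>d''\<in>D. d \<unlhd> d'' \<and> d' \<unlhd> d''"
      unfolding D_def by blast
  qed (use diffP[OF sP s(2)] dual_diff_le[OF sP] in \<open>auto simp: D_def\<close>)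
  have tP: "t \<in> ?P" using t by (simp add: directed_sup_def)
  have g: "dual_diff E f t \<in> ?P" "dual_diff E f t \<unlhd> f"
    using diffP[OF tP t(2)] dual_diff_le[OF tP] by auto
  have "\<alpha> (dual_diff E f t) \<le> 2 * (1/2)^n" for n
  proof -
    have "dual_diff E f (s n) \<unlhd> t" using t(1) by (auto simp: directed_sup_def D_def)
    then have "dual_diff E f t \<unlhd> s n"
      using dual_diff_antimono[of "dual_diff E f (s n)" t f] dual_diff_diff[OF PC[OF sP], of f n] by simp
    then show ?thesis using gaugeD(2)[OF \<alpha> g(1) sP] \<alpha>s[of n] by force
  qed
  moreover have "(\<lambda>k. 2 * (1/2)^k) \<longlonglongrightarrow> (2 * 0::real)"
    by (intro tendsto_mult tendsto_const LIMSEQ_realpow_zero) auto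
  ultimately have "\<alpha> (dual_diff E f t) \<le> 2 * 0" by (intro LIMSEQ_le_const[of "\<lambda>k. 2 * (1/2)^k"]) auto
  then have "\<alpha> (dual_diff E f t) = 0" using gaugeD(1)[OF \<alpha> g(1)] by simp
  moreover have "\<beta> t \<le> 0" using \<beta>s by (intro gauge_directed_sup_le[OF \<beta> t(1)]) (auto simp: D_def)
  then have "\<beta> (dual_diff E f (dual_diff E f t)) = 0"
    using gaugeD(1)[OF \<beta> tP] dual_diff_diff[OF PC[OF tP]] by simp
  ultimately show ?thesis using that g by blast
qed

text \<open>The infimum of the exact separators for \<open>i\<close> annihilates every \<open>\<alpha> j\<close>, since \<open>i\<close> and \<open>j\<close>
  have a common majorant in \<open>I\<close>; the supremum of these infima separates for all indices.\<close>

lemma simultaneous_separation: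
  assumes \<alpha>: "\<And>i. i \<in> I \<Longrightarrow> gauge E (\<alpha> i)" and \<beta>: "\<And>i. i \<in> I \<Longrightarrow> gauge E (\<beta> i)"
    and f: "f \<in> pcone (dual E)"
    and dir: "\<And>i j. \<lbrakk>i \<in> I; j \<in> I\<rbrakk> \<Longrightarrow> \<exists>k\<in>I. \<forall>g\<in>pcone (dual E).
      \<alpha> i g \<le> \<alpha> k g \<and> \<alpha> j g \<le> \<alpha> k g \<and> \<beta> i g \<le> \<beta> k g \<and> \<beta> j g \<le> \<beta> k g"
    and ap: "\<And>i e. \<lbrakk>i \<in> I; 0 < e\<rbrakk> \<Longrightarrow> \<exists>g\<in>pcone (dual E). g \<unlhd> f \<and>
      \<alpha> i g < e \<and> \<beta> i (dual_diff E f g) < e"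
  shows "\<exists>g\<in>pcone (dual E). g \<unlhd> f \<and>
    (\<forall>i\<in>I. \<alpha> i g = 0 \<and> \<beta> i (dual_diff E f g) = 0)"
proof -
  let ?P = "pcone (dual E)"
  interpret D: riesz_space "dual E" by (rule riesz_space_dual)
  note PC = pcone_dual_closed
  have fC: "f \<in> carrier (dual E)" using f by (rule PC)
  have diffP: "dual_diff E f g \<in> ?P" if "g \<in> ?P" "g \<unlhd> f" for g
    using dual_diff_pcone[OF fC PC] that by blast
  have zP: "\<zero>\<^bsub>dual E\<^esub> \<in> ?P" by (rule D.pcone_zero)
  have supP: "vsup (dual E) c d \<in> ?P \<and> vsup (dual E) c d \<unlhd> f \<and>
      c \<unlhd> vsup (dual E) c d \<and> d \<unlhd> vsup (dual E) c d"
    if "c \<in> ?P" "d \<in> ?P" "c \<unlhd> f" "d \<unlhd> f" for c d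
    using dual_vsup[OF PC[OF that(1)] PC[OF that(2)]] that fC dual_pcone_vle[OF that(1)] by auto
  \<comment> \<open>The complements \<open>f - g\<close> of the exact separators \<open>g\<close> for the index \<open>i\<close>.\<close>
  define C where "C i = {c \<in> ?P. c \<unlhd> f \<and> \<alpha> i (dual_diff E f c) = 0 \<and> \<beta> i c = 0}" for i
  have ne: "\<exists>g. dual_diff E f g \<in> C i \<and> g \<in> ?P \<and> g \<unlhd> f \<and> \<alpha> i g = 0" if i: "i \<in> I" for i
  proof -
    obtain g where g: "g \<in> ?P" "g \<unlhd> f" "\<alpha> i g = 0" "\<beta> i (dual_diff E f g) = 0"
      using exact_separation[OF \<alpha>[OF i] \<beta>[OF i] f] ap[OF i] by blast
    then show ?thesis using diffP dual_diff_le dual_diff_diff[OF PC]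
      by (intro exI[of _ g]) (auto simp: C_def)
  qed
  have Csup: "\<exists>c. directed_sup E (C i) c \<and> c \<unlhd> f" if i: "i \<in> I" for i
  proof (rule directed_sup_exists[of "C i" f])
    show "C i \<noteq> {}" using ne[OF i] by blast
    fix c d assume cd: "c \<in> C i" "d \<in> C i"
    let ?v = "vsup (dual E) c d"
    have v: "?v \<in> ?P" "?v \<unlhd> f" "c \<unlhd> ?v" "d \<unlhd> ?v"
      using supP[of c d] cd by (auto simp: C_def)
    have "\<beta> i ?v = 0"
      using gauge_vsup[OF \<beta>[OF i], of c d] gaugeD(1)[OF \<beta>[OF i] v(1)] cd by (auto simp: C_def)
    moreover have "\<alpha> i (dual_diff E f ?v) = 0"
      using gaugeD(2)[OF \<alpha>[OF i] diffP[OF v(1,2)] diffP dual_diff_antimono[OF v(3)]]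
        gaugeD(1)[OF \<alpha>[OF i] diffP[OF v(1,2)]] cd by (auto simp: C_def)
    ultimately have "?v \<in> C i" using v by (simp add: C_def)
    then show "\<exists>d''\<in>C i. c \<unlhd> d'' \<and> d \<unlhd> d''" using v by blast
  qed (auto simp: C_def)
  \<comment> \<open>All functionals below f that every \<alpha> i annihilates. The supremum of K
    inherits this by continuity, and for each i it lies above a member of K whose complement is
    annihilated by \<beta> i.\<close>
  define K where "K = {g \<in> ?P. g \<unlhd> f \<and> (\<forall>i\<in>I. \<alpha> i g = 0)}"
  have CK: "\<exists>k\<in>K. \<beta> i (dual_diff E f k) = 0" if i: "i \<in> I" for i
  proof -
    obtain c where c: "directed_sup E (C i) c" "c \<unlhd> f" using Csup[OF i] by blast
    have cP: "c \<in> ?P" using c by (simp add: directed_sup_def)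
    have "\<beta> i c \<le> 0" by (rule gauge_directed_sup_le[OF \<beta>[OF i] c(1)]) (auto simp: C_def)
    then have "\<beta> i (dual_diff E f (dual_diff E f c)) = 0"
      using gaugeD(1)[OF \<beta>[OF i] cP] dual_diff_diff[OF PC[OF cP]] by simp
    \<comment> \<open>An exact separator g for a common majorant k of i and j is exact for i and
      satisfies \<alpha> j g = 0. Its complement is one of the elements with supremum c, hence f - c
      \<le> g.\<close>
    moreover have "\<alpha> j (dual_diff E f c) = 0" if j: "j \<in> I" for j
    proof -
      obtain k where k: "k \<in> I" "\<forall>g\<in>?P. \<alpha> i g \<le> \<alpha> k g \<and> \<alpha> j g \<le> \<alpha> k g \<and> \<beta> i g \<le> \<beta> k g \<and> \<beta> j g \<le> \<beta> k g"
        using dir[OF i j] by blast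
      obtain g where g: "dual_diff E f g \<in> C k" "g \<in> ?P" "g \<unlhd> f" "\<alpha> k g = 0"
        using ne[OF k(1)] by blast
      have "\<alpha> i g = 0" "\<beta> i (dual_diff E f g) = 0" "\<alpha> j g = 0"
        using k(2) g gaugeD(1)[OF \<alpha>[OF i], of g] gaugeD(1)[OF \<alpha>[OF j], of g]
          gaugeD(1)[OF \<beta>[OF i], of "dual_diff E f g"] unfolding C_def by force+
      then have "dual_diff E f g \<in> C i"
        using g diffP dual_diff_le dual_diff_diff[OF PC[OF g(2)]] by (auto simp: C_def)
      then have "dual_diff E f g \<unlhd> c" using c(1) by (simp add: directed_sup_def)
      then have "dual_diff E f c \<unlhd> g"
        using dual_diff_antimono[of _ c f] dual_diff_diff[OF PC[OF g(2)], of f] by metis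
      then show ?thesis
        using gaugeD(2)[OF \<alpha>[OF j] diffP[OF cP c(2)] g(2)] gaugeD(1)[OF \<alpha>[OF j] diffP[OF cP c(2)]] \<open>\<alpha> j g = 0\<close>
        by simp
    qed
    ultimately show ?thesis
      using diffP[OF cP c(2)] dual_diff_le[OF cP] by (intro bexI[of _ "dual_diff E f c"]) (auto simp: K_def)
  qed
  obtain s where s: "directed_sup E K s" "s \<unlhd> f"
  proof (rule directed_sup_exists[of K f])
    \<comment> \<open>The definition of a gauge does not say that it vanishes at 0; here this
      follows by comparison with a separator at which \<alpha> i is 0.\<close>
    have "\<alpha> i \<zero>\<^bsub>dual E\<^esub> = 0" if "i \<in> I" for i
    proof -
      obtain g where g: "g \<in> ?P" "\<alpha> i g = 0" using ne[OF \<open>i \<in> I\<close>] by blast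
      then have "\<zero>\<^bsub>dual E\<^esub> \<unlhd> g" by (simp add: pcone_def)
      then show ?thesis using gaugeD(2)[OF \<alpha>[OF that] zP g(1)] gaugeD(1)[OF \<alpha>[OF that] zP] g by simp
    qed
    then show "K \<noteq> {}" using zP f by (auto simp: K_def pcone_def)
    fix c d assume cd: "c \<in> K" "d \<in> K"
    let ?v = "vsup (dual E) c d"
    have v: "?v \<in> ?P" "?v \<unlhd> f" "c \<unlhd> ?v" "d \<unlhd> ?v"
      using supP[of c d] cd by (auto simp: K_def)
    have "\<alpha> i ?v = 0" if "i \<in> I" for i
      using gauge_vsup[OF \<alpha>[OF that], of c d] gaugeD(1)[OF \<alpha>[OF that] v(1)] cd that by (auto simp: K_def)
    then have "?v \<in> K" using v by (simp add: K_def)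
    then show "\<exists>d''\<in>K. c \<unlhd> d'' \<and> d \<unlhd> d''" using v by blast
  qed (auto simp: K_def)
  have sP: "s \<in> ?P" using s by (simp add: directed_sup_def)
  show ?thesis
  proof (intro bexI[of _ s] conjI ballI sP s(2))
    fix i assume i: "i \<in> I"
    have "\<alpha> i s \<le> 0" by (rule gauge_directed_sup_le[OF \<alpha>[OF i] s(1)]) (use i in \<open>auto simp: K_def\<close>)
    then show "\<alpha> i s = 0" using gaugeD(1)[OF \<alpha>[OF i] sP] by simp
    obtain k where k: "k \<in> K" "\<beta> i (dual_diff E f k) = 0" using CK[OF i] by blast
    then have "k \<unlhd> s" using s by (simp add: directed_sup_def)
    then show "\<beta> i (dual_diff E f s) = 0"
      using gaugeD(2)[OF \<beta>[OF i] diffP[OF sP s(2)] diffP dual_diff_antimono] k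
        gaugeD(1)[OF \<beta>[OF i] diffP[OF sP s(2)]] by (fastforce simp: K_def)
  qed
qed

end

section \<open>Order continuous functionals\<close>

text \<open>The dominating set of \<open>order_null\<close>, with the infimum condition unfolded: D
  lies in the cone, and every lower bound of D is at most 0.\<close>

definition down_null :: "('a, 'b) ordered_module_scheme \<Rightarrow> 'a set \<Rightarrow> bool" where
  "down_null E D \<longleftrightarrow> D \<noteq> {} \<and> D \<subseteq> pcone E \<and>
     (\<forall>a\<in>D. \<forall>b\<in>D. \<exists>d\<in>D. d \<preceq>\<^bsub>E\<^esub> a \<and> d \<preceq>\<^bsub>E\<^esub> b) \<and>
     (\<forall>t\<in>carrier E. (\<forall>d\<in>D. t \<preceq>\<^bsub>E\<^esub> d) \<longrightarrow> t \<preceq>\<^bsub>E\<^esub> \<zero>\<^bsub>E\<^esub>)"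

lemma oc_order_dual_simps [simp]:
  "\<zero>\<^bsub>oc_order_dual G\<^esub> = (\<lambda>x\<in>carrier G. 0)"
  "f \<oplus>\<^bsub>oc_order_dual G\<^esub> g = (\<lambda>x\<in>carrier G. f x + g x)"
  "c \<odot>\<^bsub>oc_order_dual G\<^esub> f = (\<lambda>x\<in>carrier G. c * f x)"
  "vle (oc_order_dual G) = vle (dual G)"
  by (simp_all add: oc_order_dual_def order_dual_def)

lemma oc_order_dual_carrier:
  "f \<in> carrier (oc_order_dual G) \<longleftrightarrow> f \<in> carrier (dual G) \<and> order_continuous G f"
  by (simp add: oc_order_dual_def)

section \<open>Order convergence and order continuity\<close>

context riesz_space
begin

lemma order_null_iff:
  "order_null E F \<longleftrightarrow>
     (\<exists>D. down_null E D \<and> (\<forall>d\<in>D. \<forall>\<^sub>F x in F. x \<in> carrier E \<and> vabs E x \<preceq> d))"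
proof -
  have "is_glb (order_of E) \<zero> D \<longleftrightarrow>
      (\<forall>d\<in>D. \<zero> \<preceq> d) \<and> (\<forall>t\<in>carrier E. (\<forall>d\<in>D. t \<preceq> d) \<longrightarrow> t \<preceq> \<zero>)"
    if "D \<subseteq> carrier E" for D
    using that by (simp add: greatest_def Lower_def Int_absorb2) blast
  then have glb: "D \<subseteq> carrier E \<and> is_glb (order_of E) \<zero> D \<longleftrightarrow>
      D \<subseteq> pcone E \<and> (\<forall>t\<in>carrier E. (\<forall>d\<in>D. t \<preceq> d) \<longrightarrow> t \<preceq> \<zero>)" for D
    by (cases "D \<subseteq> carrier E") (auto simp: pcone_def)
  have "order_null E F \<longleftrightarrow> (\<exists>D. D \<noteq> {} \<and> (D \<subseteq> carrier E \<and> is_glb (order_of E) \<zero> D) \<and>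
      (\<forall>a\<in>D. \<forall>b\<in>D. \<exists>d\<in>D. d \<preceq> a \<and> d \<preceq> b) \<and>
      (\<forall>d\<in>D. \<forall>\<^sub>F x in F. x \<in> carrier E \<and> vabs E x \<preceq> d))"
    unfolding order_null_def by (simp only: conj_ac)
  then show ?thesis
    unfolding glb down_null_def by (simp only: conj_ac)
qed

text \<open>The filter generated by the tails of D is itself order null, so convergence along it
  gives a bound on a whole tail. This brings the definition by filters back to directed
  sets.\<close>

lemma order_continuous_tail:
  assumes "order_continuous E \<phi>" and D: "down_null E D" and e: "0 < e"
  obtains d where "d \<in> D" "\<And>d'. \<lbrakk>d' \<in> D; d' \<preceq> d\<rbrakk> \<Longrightarrow> \<bar>\<phi> d'\<bar> < e"
proof -
  define T where "T d = {d' \<in> D. d' \<preceq> d}" for d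
  define F where "F = (INF d\<in>D. principal (T d))"
  have base: "eventually P F \<longleftrightarrow> (\<exists>d\<in>D. eventually P (principal (T d)))" for P
    unfolding F_def
  proof (rule eventually_INF_base)
    show "D \<noteq> {}" using D by (simp add: down_null_def)
    fix a b assume ab: "a \<in> D" "b \<in> D"
    then obtain d where d: "d \<in> D" "d \<preceq> a" "d \<preceq> b" using D unfolding down_null_def by blast
    have C: "D \<subseteq> carrier E" using D pcone_closed by (auto simp: down_null_def)
    have "T d \<subseteq> T a \<inter> T b" using d ab C vle_trans[of _ d a] vle_trans[of _ d b] by (auto simp: T_def)
    then show "\<exists>x\<in>D. principal (T x) \<le> inf (principal (T a)) (principal (T b))" using d by auto
  qed
  have "order_null E F"
    unfolding order_null_iff
  proof (intro exI[of _ D] conjI D ballI)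
    fix d assume "d \<in> D"
    moreover have "eventually (\<lambda>x. x \<in> carrier E \<and> vabs E x \<preceq> d) (principal (T d))"
      using D pcone_closed vabs_pos by (auto simp: eventually_principal T_def down_null_def)
    ultimately show "eventually (\<lambda>x. x \<in> carrier E \<and> vabs E x \<preceq> d) F" using base by blast
  qed
  then have "(\<phi> \<longlongrightarrow> 0) F" using assms(1) by (simp add: order_continuous_def)
  then have "eventually (\<lambda>x. dist (\<phi> x) 0 < e) F" using e by (rule tendstoD)
  then obtain d where "d \<in> D" "\<forall>x\<in>T d. \<bar>\<phi> x\<bar> < e"
    using base by (auto simp: eventually_principal)
  then show ?thesis using that[of d] by (auto simp: T_def)
qed

text \<open>For positive \<phi>, small values on D suffice, because |\<phi> x| \<le> \<phi> |x|
  \<le> \<phi> d as soon as |x| \<le> d.\<close>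

lemma order_continuousI:
  assumes \<phi>: "\<phi> \<in> pcone (dual E)"
    and inf: "\<And>D e. \<lbrakk>down_null E D; 0 < e\<rbrakk> \<Longrightarrow> \<exists>d\<in>D. \<phi> d < e"
  shows "order_continuous E \<phi>"
  unfolding order_continuous_def
proof (intro allI impI)
  fix F assume "order_null E F"
  then obtain D where D: "down_null E D" "\<forall>d\<in>D. \<forall>\<^sub>F x in F. x \<in> carrier E \<and> vabs E x \<preceq> d"
    unfolding order_null_iff by blast
  interpret D: riesz_space "dual E" by (rule riesz_space_dual)
  have \<phi>C: "\<phi> \<in> carrier (dual E)" using \<phi> by (rule pcone_dual_closed)
  show "(\<phi> \<longlongrightarrow> 0) F"
  proof (rule tendstoI)
    fix e :: real assume "0 < e"
    then obtain d where d: "d \<in> D" "\<phi> d < e" using inf D(1) by blast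
    have dC: "d \<in> carrier E" using d D pcone_closed by (auto simp: down_null_def)
    have "\<forall>\<^sub>F x in F. x \<in> carrier E \<and> vabs E x \<preceq> d" using D d by blast
    then show "\<forall>\<^sub>F x in F. dist (\<phi> x) 0 < e"
    proof eventually_elim
      case (elim x)
      then have "\<bar>\<phi> x\<bar> \<le> \<phi> (vabs E x)" using functional_abs_le[OF \<phi>C, of x] D.vabs_pos[OF \<phi>] by simp
      also have "\<dots> \<le> \<phi> d" using elim dC vabs_closed by (intro functional_mono[OF \<phi>]) auto
      finally show ?case using d by simp
    qed
  qed
qed

lemma order_null_carrier: "order_null E F \<Longrightarrow> \<forall>\<^sub>F x in F. x \<in> carrier E"
proof -
  assume "order_null E F"
  then obtain D where "down_null E D" "\<forall>d\<in>D. \<forall>\<^sub>F x in F. x \<in> carrier E \<and> vabs E x \<preceq> d"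
    unfolding order_null_iff by blast
  then obtain d where "\<forall>\<^sub>F x in F. x \<in> carrier E \<and> vabs E x \<preceq> d" by (auto simp: down_null_def)
  then show ?thesis by eventually_elim simp
qed

text \<open>An order null filter eventually lives in the carrier, so restricting the functional does
  not affect its limit. Sums and multiples in the dual are restricted in this way.\<close>

lemma order_continuous_restrict:
  assumes "\<And>F. order_null E F \<Longrightarrow> (\<phi> \<longlongrightarrow> 0) F"
  shows "order_continuous E (\<lambda>x\<in>carrier E. \<phi> x)"
  unfolding order_continuous_def
proof (intro allI impI)
  fix F assume F: "order_null E F"
  have "\<forall>\<^sub>F x in F. (\<lambda>x\<in>carrier E. \<phi> x) x = \<phi> x"
    using order_null_carrier[OF F] by eventually_elim simp
  then show "((\<lambda>x\<in>carrier E. \<phi> x) \<longlongrightarrow> 0) F"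
    using assms[OF F] by (simp add: filterlim_cong)
qed

section \<open>The Riesz space of order continuous functionals\<close>

lemma order_continuous_zero: "order_continuous E (\<lambda>x\<in>carrier E. 0)"
  by (rule order_continuous_restrict) simp

lemma order_continuous_add:
  "\<lbrakk>order_continuous E f; order_continuous E g\<rbrakk> \<Longrightarrow> order_continuous E (\<lambda>x\<in>carrier E. f x + g x)"
  using tendsto_add[of f 0 _ g 0]
  by (intro order_continuous_restrict) (simp add: order_continuous_def)

lemma order_continuous_smult:
  "order_continuous E f \<Longrightarrow> order_continuous E (\<lambda>x\<in>carrier E. c * f x)"
  using tendsto_mult_left[of f 0 _ c]
  by (intro order_continuous_restrict) (simp add: order_continuous_def)

text \<open>Let s be the positive part and choose t \<le> \<open>d\<^sub>0\<close> with f t close to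
  s \<open>d\<^sub>0\<close>. For d \<le> \<open>d\<^sub>0\<close>, what remains of t beyond t
  \<sqinter> d is at most \<open>d\<^sub>0\<close> - d, so f t - f (t \<sqinter> d) \<le> s
  \<open>d\<^sub>0\<close> - s d. Hence s d exceeds f (t \<sqinter> d) by a small error only, and t
  \<sqinter> d decreases to 0 along D.\<close>

lemma order_continuous_pos_part:
  assumes f: "f \<in> carrier (dual E)" and oc: "order_continuous E f"
  shows "order_continuous E (vsup (dual E) f (\<lambda>x\<in>carrier E. 0))" (is "order_continuous E ?s")
proof (rule order_continuousI)
  note sup = dual_vsup[OF f dual_zero_closed]
  show sP: "?s \<in> pcone (dual E)"
    using sup(1,3) by (auto simp: pcone_dual dual_vle pcone_closed)
  fix D and e :: real assume D: "down_null E D" and "0 < e"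
  then have e: "0 < e/2" by simp
  have DP: "d \<in> pcone E" "d \<in> carrier E" if "d \<in> D" for d
    using D that pcone_closed by (auto simp: down_null_def)
  obtain d\<^sub>0 where d\<^sub>0: "d\<^sub>0 \<in> D" using D by (auto simp: down_null_def)
  obtain t b where t: "t \<in> pcone E" "b \<in> pcone E" "d\<^sub>0 = t \<oplus> b" "?s d\<^sub>0 < f t + e/2"
    using dual_vsup_approx[OF f dual_zero_closed DP(1)[OF d\<^sub>0] e] pcone_closed by auto
  have tC: "t \<in> carrier E" using t pcone_closed by auto
  have mP: "vinf E t d \<in> pcone E" "vinf E t d \<preceq> t" "vinf E t d \<preceq> d" if "d \<in> D" for d
    using DP[OF that] t(1) tC by (auto simp: pcone_def intro: vinf_closed vinf_lower vinf_greatest)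
  have mC: "vinf E t d \<in> carrier E" if "d \<in> D" for d using mP[OF that] pcone_closed by auto
  have mono: "vinf E t d \<preceq> vinf E t d'" if "d \<in> D" "d' \<in> D" "d \<preceq> d'" for d d'
    using mP[OF that(1)] mC[OF that(1)] DP(2) tC that vle_trans[of "vinf E t d" d d']
    by (intro vinf_greatest) auto
  \<comment> \<open>The meets with t again decrease to 0, since each of their lower bounds is a
    lower bound of D.\<close>
  define M where "M = vinf E t ` D"
  have "down_null E M"
    unfolding down_null_def
  proof (intro conjI ballI impI)
    show "M \<noteq> {}" "M \<subseteq> pcone E" using d\<^sub>0 mP by (auto simp: M_def)
    fix a b assume "a \<in> M" "b \<in> M"
    then obtain d d' where d: "d \<in> D" "a = vinf E t d" "d' \<in> D" "b = vinf E t d'" by (auto simp: M_def)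
    then obtain d'' where "d'' \<in> D" "d'' \<preceq> d" "d'' \<preceq> d'" using D unfolding down_null_def by blast
    then show "\<exists>d\<in>M. d \<preceq> a \<and> d \<preceq> b" using d mono by (auto simp: M_def)
  next
    fix u assume u: "u \<in> carrier E" "\<forall>d\<in>M. u \<preceq> d"
    have "u \<preceq> d" if "d \<in> D" for d
      using u mP[OF that] mC[OF that] DP(2)[OF that] that vle_trans[of u "vinf E t d" d] by (auto simp: M_def)
    then show "u \<preceq> \<zero>" using D u(1) by (auto simp: down_null_def)
  qed
  then obtain m where m: "m \<in> M" "\<And>d'. \<lbrakk>d' \<in> M; d' \<preceq> m\<rbrakk> \<Longrightarrow> \<bar>f d'\<bar> < e/2"
    using order_continuous_tail[OF oc _ e] by metis
  then obtain d\<^sub>1 where d\<^sub>1: "d\<^sub>1 \<in> D" "m = vinf E t d\<^sub>1" by (auto simp: M_def)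
  obtain d where d: "d \<in> D" "d \<preceq> d\<^sub>0" "d \<preceq> d\<^sub>1" using D d\<^sub>0 d\<^sub>1 unfolding down_null_def by blast
  define n where "n = vinf E t d"
  have n: "n \<in> carrier E" "n \<in> pcone E" "n \<preceq> t" using mP[OF d(1)] mC[OF d(1)] by (auto simp: n_def)
  have fn: "\<bar>f n\<bar> < e/2" using m(2)[of n] mono[OF d(1) d\<^sub>1(1) d(3)] d d\<^sub>1 by (auto simp: n_def M_def)
  obtain r where r: "r \<in> pcone E" "d\<^sub>0 = d \<oplus> r" using d d\<^sub>0 DP vle_iff[of d d\<^sub>0] by blast
  obtain q where q: "q \<in> pcone E" "t = n \<oplus> q" using n tC vle_iff[of n t] by blast
  have C: "r \<in> carrier E" "q \<in> carrier E" "b \<in> carrier E" "d \<in> carrier E"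
    using r(1) q(1) t(2) d(1) DP pcone_closed by auto
  \<comment> \<open>In t \<le> d + r the part of t under d lies below n = t \<sqinter> d, so the
    rest q of t beyond n lies below r.\<close>
  have "q \<preceq> r"
  proof -
    have "t \<preceq> d \<oplus> r" using vle_add[OF tC t(2)] t(3) r(2) by simp
    then obtain a c where ac: "a \<in> pcone E" "c \<in> pcone E" "t = a \<oplus> c" "a \<preceq> d" "c \<preceq> r" "a \<preceq> t"
      using riesz_decomposition[OF t(1) DP(1)[OF d(1)] r(1)] by metis
    have acC: "a \<in> carrier E" "c \<in> carrier E" using ac pcone_closed by auto
    have "a \<preceq> n" unfolding n_def using ac acC tC C by (intro vinf_greatest) auto
    then obtain z where z: "z \<in> pcone E" "n = a \<oplus> z" using acC n vle_iff[of a n] by blast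
    have zC: "z \<in> carrier E" using z pcone_closed by auto
    have "a \<oplus> c = a \<oplus> (z \<oplus> q)" using ac(3) q(2) z acC C zC by (simp add: M.a_assoc)
    then have "c = q \<oplus> z" using acC C zC by (simp add: M.a_comm)
    then have "q \<preceq> c" using vle_add C z by simp
    then show ?thesis using ac vle_trans[of q c r] C acC by simp
  qed
  then have "?s q \<le> ?s r" using C by (intro functional_mono[OF sP]) auto
  moreover have "f q \<le> ?s q" using sup(2) q by (simp add: dual_vle)
  moreover have "?s d\<^sub>0 = ?s d + ?s r" using functional_add[OF sup(1)] r C by simp
  moreover have "f t = f n + f q" using functional_add[OF f] q n C by simp
  ultimately have "?s d < e" using t(4) fn by linarith
  then show "\<exists>d\<in>D. ?s d < e" using d by blast
qed

text \<open>The supremum is g plus the positive part of f - g, which reduces the claim to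
  \<open>order_continuous_pos_part\<close> and linearity.\<close>

lemma order_continuous_vsup:
  assumes f: "f \<in> carrier (dual E)" and g: "g \<in> carrier (dual E)"
    and oc: "order_continuous E f" "order_continuous E g"
  shows "order_continuous E (vsup (dual E) f g)"
proof -
  interpret D: riesz_space "dual E" by (rule riesz_space_dual)
  define h where "h = (\<lambda>x\<in>carrier E. f x + (\<lambda>x\<in>carrier E. -1 * g x) x)"
  have h: "h \<in> carrier (dual E)"
    unfolding h_def using f g by (intro dual_add_closed dual_smult_closed)
  have "order_continuous E h"
    unfolding h_def using oc by (intro order_continuous_add order_continuous_smult)
  note hs = order_continuous_pos_part[OF h this]
  note sup = dual_vsup[OF h dual_zero_closed]
  let ?r = "vsup (dual E) h (\<lambda>x\<in>carrier E. 0)"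
  have "vsup (dual E) f g = (\<lambda>x\<in>carrier E. g x + ?r x)"
  proof (rule D.vsup_eqI[OF f g])
    show "(\<lambda>x\<in>carrier E. g x + ?r x) \<in> carrier (dual E)" using g sup(1) by (rule dual_add_closed)
    show "f \<unlhd> (\<lambda>x\<in>carrier E. g x + ?r x)" "g \<unlhd> (\<lambda>x\<in>carrier E. g x + ?r x)"
      using sup(2,3) by (force simp: dual_vle pcone_closed h_def)+
    fix t assume t: "t \<in> carrier (dual E)" "f \<unlhd> t" "g \<unlhd> t"
    have "?r \<unlhd> (\<lambda>x\<in>carrier E. t x - g x)"
      using t dual_minus_closed[OF t(1) g]
      by (intro sup(4)) (auto simp: dual_vle pcone_closed h_def)
    then show "(\<lambda>x\<in>carrier E. g x + ?r x) \<unlhd> t"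
      by (force simp: dual_vle pcone_closed)
  qed
  then show ?thesis using order_continuous_add[OF oc(2) hs] by simp
qed

lemma oc_order_dual_closed:
  "(\<lambda>x\<in>carrier E. 0) \<in> carrier (oc_order_dual E)"
  "\<lbrakk>f \<in> carrier (oc_order_dual E); g \<in> carrier (oc_order_dual E)\<rbrakk>
    \<Longrightarrow> (\<lambda>x\<in>carrier E. f x + g x) \<in> carrier (oc_order_dual E)"
  "f \<in> carrier (oc_order_dual E) \<Longrightarrow> (\<lambda>x\<in>carrier E. c * f x) \<in> carrier (oc_order_dual E)"
  unfolding oc_order_dual_carrier
  by (blast intro: dual_zero_closed dual_add_closed dual_smult_closed
      order_continuous_zero order_continuous_add order_continuous_smult)+

lemma module_oc_order_dual: "module real_ring (oc_order_dual E)"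
proof -
  interpret D: module real_ring "dual E" by (rule module_dual)
  let ?H = "carrier (oc_order_dual E)"
  have "submodule ?H real_ring (dual E)"
  proof (rule D.submoduleI)
    show "\<ominus>\<^bsub>dual E\<^esub> f \<in> ?H" if "f \<in> ?H" for f
      using oc_order_dual_closed(3)[OF that, of "-1"] that
      by (simp add: dual_uminus oc_order_dual_carrier)
  qed (use oc_order_dual_closed in \<open>auto simp: oc_order_dual_carrier\<close>)
  from submodule.submodule_is_module[OF this module_dual]
  show ?thesis by (simp add: oc_order_dual_def)
qed

text \<open>Suprema are those of the whole order dual, which are again order continuous.\<close>

lemma riesz_space_oc_order_dual: "riesz_space (oc_order_dual E)"
proof (rule riesz_spaceI[OF module_oc_order_dual])
  interpret D: riesz_space "dual E" by (rule riesz_space_dual)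
  show "\<And>f g. \<lbrakk>f \<preceq>\<^bsub>oc_order_dual E\<^esub> g; g \<preceq>\<^bsub>oc_order_dual E\<^esub> f; f \<in> carrier (oc_order_dual E);
     g \<in> carrier (oc_order_dual E)\<rbrakk> \<Longrightarrow> f = g"
    using D.vle_antisym by (simp add: oc_order_dual_carrier)
  fix f g assume "f \<in> carrier (oc_order_dual E)" "g \<in> carrier (oc_order_dual E)"
  then have C: "f \<in> carrier (dual E)" "g \<in> carrier (dual E)" and
    oc: "order_continuous E f" "order_continuous E g" by (simp_all add: oc_order_dual_carrier)
  show "\<exists>s\<in>carrier (oc_order_dual E). f \<preceq>\<^bsub>oc_order_dual E\<^esub> s \<and> g \<preceq>\<^bsub>oc_order_dual E\<^esub> s \<and>
      (\<forall>t\<in>carrier (oc_order_dual E). f \<preceq>\<^bsub>oc_order_dual E\<^esub> t \<longrightarrow> g \<preceq>\<^bsub>oc_order_dual E\<^esub> t \<longrightarrow> s \<preceq>\<^bsub>oc_order_dual E\<^esub> t)"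
    using dual_vsup[OF C] order_continuous_vsup[OF C oc]
    by (intro bexI[of _ "vsup (dual E) f g"]) (simp_all add: oc_order_dual_carrier)
next
  show "\<And>f g h. \<lbrakk>f \<preceq>\<^bsub>oc_order_dual E\<^esub> g; g \<preceq>\<^bsub>oc_order_dual E\<^esub> h\<rbrakk> \<Longrightarrow> f \<preceq>\<^bsub>oc_order_dual E\<^esub> h"
    using dual_vle_trans by simp
qed (simp_all add: dual_vle pcone_closed mult_left_mono)

end

lemma pcone_oc_order_dual:
  "f \<in> pcone (oc_order_dual G) \<longleftrightarrow> f \<in> pcone (dual G) \<and> order_continuous G f"
  by (auto simp: pcone_def oc_order_dual_def order_dual_def)

text \<open>If D increases to s pointwise on the cone, then the differences s - d decrease to 0 in
  the order dual, and \<phi> is small on a tail of them.\<close>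

lemma (in riesz_space) gauge_order_continuous:
  assumes \<phi>: "\<phi> \<in> pcone (dual (dual E))" and oc: "order_continuous (dual E) \<phi>"
  shows "gauge E \<phi>"
proof -
  interpret D: riesz_space "dual E" by (rule riesz_space_dual)
  have \<phi>C: "\<phi> \<in> carrier (dual (dual E))" using \<phi> by (rule pcone_dual_closed)
  show ?thesis
    unfolding gauge_def
  proof (intro conjI ballI allI impI)
    fix g h assume gh: "g \<in> pcone (dual E)" "h \<in> pcone (dual E)"
    show "\<phi> (g \<oplus>\<^bsub>dual E\<^esub> h) \<le> \<phi> g + \<phi> h"
      using functional_add[OF \<phi>C] gh pcone_dual_closed by (metis order_refl)
    show "\<phi> g \<le> \<phi> h" if "g \<unlhd> h"
      using D.functional_mono[OF \<phi> that] gh pcone_dual_closed by blast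
  next
    fix D s and e :: real assume D: "directed_sup E D s" and e: "0 < e"
    have sC: "s \<in> carrier (dual E)" and DC: "\<And>d. d \<in> D \<Longrightarrow> d \<in> carrier (dual E)"
      using D pcone_dual_closed by (auto simp: directed_sup_def)
    define M where "M = dual_diff E s ` D"
    have "down_null (dual E) M"
      unfolding down_null_def
    proof (intro conjI ballI impI)
      show "M \<noteq> {}" "M \<subseteq> pcone (dual E)"
        using D sC DC dual_diff_pcone by (auto simp: M_def directed_sup_def)
      fix a b assume "a \<in> M" "b \<in> M"
      then obtain d d' where d: "d \<in> D" "a = dual_diff E s d" "d' \<in> D" "b = dual_diff E s d'" by (auto simp: M_def)
      then obtain d'' where "d'' \<in> D" "d \<unlhd> d''" "d' \<unlhd> d''"
        using D unfolding directed_sup_def by blast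
      then show "\<exists>d\<in>M. d \<unlhd> a \<and> d \<unlhd> b"
        using d dual_diff_antimono by (auto simp: M_def)
    next
      fix u assume u: "u \<in> carrier (dual E)" "\<forall>d\<in>M. u \<unlhd> d"
      show "u \<unlhd> \<zero>\<^bsub>dual E\<^esub>"
        unfolding dual_vle
      proof (intro ballI real_le_if_le_add_eps)
        fix x and e :: real assume x: "x \<in> pcone E" and "0 < e"
        then obtain d where d: "d \<in> D" "s x < d x + e" using D unfolding directed_sup_def by blast
        then have "u x \<le> dual_diff E s d x" using u x by (auto simp: M_def dual_vle)
        then show "u x < \<zero>\<^bsub>dual E\<^esub> x + e" using d x by (simp add: dual_diff_def pcone_closed)
      qed
    qed
    then obtain m where m: "m \<in> M" "\<And>d'. \<lbrakk>d' \<in> M; d' \<unlhd> m\<rbrakk> \<Longrightarrow> \<bar>\<phi> d'\<bar> < e"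
      using D.order_continuous_tail[OF oc _ e] by metis
    then obtain d where d: "d \<in> D" "m = dual_diff E s d" by (auto simp: M_def)
    have "\<phi> m < e" using m(2)[OF m(1) dual_vle_refl] by simp
    moreover have "s = d \<oplus>\<^bsub>dual E\<^esub> m"
      using dual_ext[OF sC] d by (simp add: dual_diff_def cong: restrict_cong)
    moreover have "m \<in> carrier (dual E)"
      using d dual_minus_closed[OF sC DC] by (simp add: dual_diff_def)
    ultimately have "\<phi> s < \<phi> d + e" using functional_add[OF \<phi>C DC[OF d(1)], of m] by simp
    then show "\<exists>d\<in>D. \<phi> s < \<phi> d + e" using d by blast
  qed (use \<phi> in \<open>auto simp: pcone_dual\<close>)
qed

section \<open>The stages of the Arens extension\<close>

lemma tuples_upd:
  "\<lbrakk>x \<in> tuples I E; i \<in> I; u \<in> carrier (E i)\<rbrakk> \<Longrightarrow> x(i := u) \<in> tuples I E"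
  by (auto simp: tuples_def PiE_iff extensional_def)

lemma tuples_insert:
  "\<lbrakk>x \<in> tuples (I - {i}) E; i \<in> I; u \<in> carrier (E i)\<rbrakk> \<Longrightarrow> x(i := u) \<in> tuples I E"
  by (auto simp: tuples_def PiE_iff extensional_def)

lemma tuples_nth: "\<lbrakk>x \<in> tuples I E; i \<in> I\<rbrakk> \<Longrightarrow> x i \<in> carrier (E i)"
  by (auto simp: tuples_def)

definition pos_tuples :: "nat set \<Rightarrow> (nat \<Rightarrow> ('a, 'b) ordered_module_scheme) \<Rightarrow> (nat \<Rightarrow> 'a) set" where
  "pos_tuples I E = {x \<in> tuples I E. \<forall>i\<in>I. x i \<in> pcone (E i)}"

lemma pos_tuples_tuples: "x \<in> pos_tuples I E \<Longrightarrow> x \<in> tuples I E"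
  by (simp add: pos_tuples_def)

lemma pos_tuples_upd:
  "\<lbrakk>x \<in> pos_tuples I E; i \<in> I; u \<in> pcone (E i)\<rbrakk> \<Longrightarrow> x(i := u) \<in> pos_tuples I E"
  by (auto simp: pos_tuples_def pcone_def intro: tuples_upd)

lemma pos_tuples_insert:
  "\<lbrakk>x \<in> pos_tuples (I - {i}) E; i \<in> I; u \<in> pcone (E i)\<rbrakk> \<Longrightarrow> x(i := u) \<in> pos_tuples I E"
  by (auto simp: pos_tuples_def pcone_def intro: tuples_insert)

definition abs_tuple :: "nat set \<Rightarrow> (nat \<Rightarrow> ('a, 'b) ordered_module_scheme) \<Rightarrow> (nat \<Rightarrow> 'a) \<Rightarrow> nat \<Rightarrow> 'a" where
  "abs_tuple I E x = (\<lambda>i\<in>I. vabs (E i) (x i))"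

section \<open>Forms and slices at the stages\<close>

locale arens =
  fixes m :: nat and E :: "nat \<Rightarrow> 'a ordered_module" and F :: "'b ordered_module"
    and A :: "(nat \<Rightarrow> 'a) \<Rightarrow> 'b" and \<rho> :: "nat \<Rightarrow> nat"
  assumes E: "\<And>i. i \<in> {1..m} \<Longrightarrow> riesz_space (E i)"
    and multi: "riesz_multimorphism m E F A"
    and perm: "\<rho> permutes {1..m}"
begin

abbreviation "idx \<equiv> arens_index m \<rho>"

abbreviation "bidual i \<equiv> dual (dual (E i))"

definition bidual_tuple :: "(nat \<Rightarrow> ('a \<Rightarrow> real) \<Rightarrow> real) \<Rightarrow> bool" where
  "bidual_tuple xs \<longleftrightarrow> (\<forall>i\<in>{1..m}. xs i \<in> carrier (bidual i))"

definition pos_bidual_tuple :: "(nat \<Rightarrow> ('a \<Rightarrow> real) \<Rightarrow> real) \<Rightarrow> bool" where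
  "pos_bidual_tuple xs \<longleftrightarrow> (\<forall>i\<in>{1..m}. xs i \<in> pcone (bidual i))"

text \<open>Entries outside {1..m} are left alone, so that positive families satisfy
  \<open>abs_bidual xs = xs\<close> as an equation between functions.\<close>

definition abs_bidual :: "(nat \<Rightarrow> ('a \<Rightarrow> real) \<Rightarrow> real) \<Rightarrow> nat \<Rightarrow> ('a \<Rightarrow> real) \<Rightarrow> real" where
  "abs_bidual xs = (\<lambda>i. if i \<in> {1..m} then vabs (bidual i) (xs i) else xs i)"

definition pform :: "(nat \<Rightarrow> ('a \<Rightarrow> real) \<Rightarrow> real) \<Rightarrow> nat \<Rightarrow> ('b \<Rightarrow> real) \<Rightarrow> (nat \<Rightarrow> 'a) \<Rightarrow> real" where
  "pform xs k f = arens_comp m E \<rho> xs k (\<lambda>x\<in>tuples {1..m} E. f (A x))"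

text \<open>The functional on \<open>E (\<rho> (Suc k))\<close> to which the next bidual entry is
  applied.\<close>

definition slice :: "(nat \<Rightarrow> ('a \<Rightarrow> real) \<Rightarrow> real) \<Rightarrow> nat \<Rightarrow> ('b \<Rightarrow> real) \<Rightarrow> (nat \<Rightarrow> 'a) \<Rightarrow> 'a \<Rightarrow> real" where
  "slice xs k f x = (\<lambda>t\<in>carrier (E (\<rho> (Suc k))). pform xs k f (x(\<rho> (Suc k) := t)))"

lemma F: "riesz_space F"
  using multi by (simp add: riesz_multimorphism_def)

lemma idx_0: "idx 0 = {1..m}"
  by (simp add: arens_index_def)

lemma idx_m: "idx m = {}"
  using permutes_image[OF perm] by (simp add: arens_index_def)

lemma idx_subset: "idx k \<subseteq> {1..m}"
  by (auto simp: arens_index_def)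

lemma idx_Suc: "idx (Suc k) = idx k - {\<rho> (Suc k)}"
  by (auto simp: arens_index_def atLeastAtMostSuc_conv)

lemma rho_mem: "k < m \<Longrightarrow> \<rho> (Suc k) \<in> idx k"
  using permutes_in_image[OF perm, of "Suc k"] inj_image_mem_iff[OF permutes_inj[OF perm], of "Suc k" "{1..k}"]
  by (auto simp: arens_index_def)

lemma rho_range: "k < m \<Longrightarrow> \<rho> (Suc k) \<in> {1..m}"
  using rho_mem idx_subset by blast

lemma idx_neq: "i \<in> idx (Suc k) \<Longrightarrow> i \<noteq> \<rho> (Suc k) \<and> i \<in> idx k"
  by (simp add: idx_Suc)

lemma E_idx: "i \<in> idx k \<Longrightarrow> riesz_space (E i)"
  using E idx_subset by blast

lemma E_bidual: "i \<in> {1..m} \<Longrightarrow> riesz_space (bidual i)"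
  by (intro riesz_space.riesz_space_dual E)

text \<open>Regularity provides A = P - Q on tuples. Updated tuples are tuples again, so linearity
  in each coordinate is inherited from P and Q.\<close>

lemma A_multilinear: "multilinear m E F A"
proof -
  interpret F: riesz_space F by (rule F)
  obtain P Q where P: "multilinear m E F P" and Q: "multilinear m E F Q"
    and A: "\<And>x. x \<in> tuples {1..m} E \<Longrightarrow> A x = P x \<ominus>\<^bsub>F\<^esub> Q x"
    using multi by (auto simp: riesz_multimorphism_def regular_multilinear_def positive_multilinear_def)
  have C: "P x \<in> carrier F" "Q x \<in> carrier F" if "x \<in> tuples {1..m} E" for x
    using P Q that by (auto simp: multilinear_def)
  show ?thesis
    unfolding multilinear_def
  proof (intro conjI ballI allI)
    show "A \<in> tuples {1..m} E \<rightarrow> carrier F" using A C by simp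
    fix x i u assume x: "x \<in> tuples {1..m} E" and i: "i \<in> {1..m}" and u: "u \<in> carrier (E i)"
    interpret Ei: riesz_space "E i" using i by (rule E)
    have T: "x(i := w) \<in> tuples {1..m} E" if "w \<in> carrier (E i)" for w
      using x i that by (rule tuples_upd)
    {
      fix v assume v: "v \<in> carrier (E i)"
      have "P (x(i := u \<oplus>\<^bsub>E i\<^esub> v)) = P (x(i := u)) \<oplus>\<^bsub>F\<^esub> P (x(i := v))"
        "Q (x(i := u \<oplus>\<^bsub>E i\<^esub> v)) = Q (x(i := u)) \<oplus>\<^bsub>F\<^esub> Q (x(i := v))"
        using P Q x i u v by (auto simp: multilinear_def)
      then show "A (x(i := u \<oplus>\<^bsub>E i\<^esub> v)) = A (x(i := u)) \<oplus>\<^bsub>F\<^esub> A (x(i := v))"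
        unfolding A[OF T[OF u]] A[OF T[OF v]] A[OF T[OF Ei.M.a_closed[OF u v]]]
        using C[OF T[OF u]] C[OF T[OF v]] by (simp add: F.minus_eq F.minus_add F.a_ac)
    next
      fix c
      have cu: "c \<odot>\<^bsub>E i\<^esub> u \<in> carrier (E i)" using u by simp
      have "P (x(i := c \<odot>\<^bsub>E i\<^esub> u)) = c \<odot>\<^bsub>F\<^esub> P (x(i := u))"
        "Q (x(i := c \<odot>\<^bsub>E i\<^esub> u)) = c \<odot>\<^bsub>F\<^esub> Q (x(i := u))"
        using P Q x i u by (auto simp: multilinear_def)
      then show "A (x(i := c \<odot>\<^bsub>E i\<^esub> u)) = c \<odot>\<^bsub>F\<^esub> A (x(i := u))"
        unfolding A[OF T[OF u]] A[OF T[OF cu]]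
        using C[OF T[OF u]] F.smult_r_minus[of c "Q (x(i := u))"]
        by (simp add: F.minus_eq F.smult_r_distr)
    }
  qed
qed

lemma A_closed: "x \<in> tuples {1..m} E \<Longrightarrow> A x \<in> carrier F"
  and A_add: "\<lbrakk>x \<in> tuples {1..m} E; i \<in> {1..m}; u \<in> carrier (E i); v \<in> carrier (E i)\<rbrakk>
    \<Longrightarrow> A (x(i := u \<oplus>\<^bsub>E i\<^esub> v)) = A (x(i := u)) \<oplus>\<^bsub>F\<^esub> A (x(i := v))"
  and A_smult: "\<lbrakk>x \<in> tuples {1..m} E; i \<in> {1..m}; u \<in> carrier (E i)\<rbrakk>
    \<Longrightarrow> A (x(i := c \<odot>\<^bsub>E i\<^esub> u)) = c \<odot>\<^bsub>F\<^esub> A (x(i := u))"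
  using A_multilinear unfolding multilinear_def by blast+

lemma A_abs: "x \<in> tuples {1..m} E \<Longrightarrow> vabs F (A x) = A (abs_tuple {1..m} E x)"
  using multi by (simp add: riesz_multimorphism_def abs_tuple_def)

lemma pform_0: "x \<in> tuples {1..m} E \<Longrightarrow> pform xs 0 f x = f (A x)"
  by (simp add: pform_def)

lemma pform_Suc: "x \<in> tuples (idx (Suc k)) E \<Longrightarrow> pform xs (Suc k) f x = xs (\<rho> (Suc k)) (slice xs k f x)"
  by (simp add: pform_def arens_bar_def slice_def)

lemma tuples_slice:
  "\<lbrakk>k < m; x \<in> tuples (idx (Suc k)) E; t \<in> carrier (E (\<rho> (Suc k)))\<rbrakk> \<Longrightarrow> x(\<rho> (Suc k) := t) \<in> tuples (idx k) E"
  unfolding idx_Suc by (rule tuples_insert) (auto intro: rho_mem)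

lemma pos_tuples_slice:
  "\<lbrakk>k < m; x \<in> pos_tuples (idx (Suc k)) E; t \<in> pcone (E (\<rho> (Suc k)))\<rbrakk> \<Longrightarrow> x(\<rho> (Suc k) := t) \<in> pos_tuples (idx k) E"
  unfolding idx_Suc by (rule pos_tuples_insert) (auto intro: rho_mem)

lemma abs_tuple_closed: "x \<in> tuples (idx k) E \<Longrightarrow> abs_tuple (idx k) E x \<in> pos_tuples (idx k) E"
proof -
  assume x: "x \<in> tuples (idx k) E"
  have "vabs (E i) (x i) \<in> pcone (E i)" if "i \<in> idx k" for i
    by (rule riesz_space.vabs_pcone[OF E_idx[OF that] tuples_nth[OF x that]])
  then show ?thesis by (auto simp: abs_tuple_def pos_tuples_def tuples_def pcone_def)
qed

lemma abs_tuple_pos: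
  assumes "x \<in> pos_tuples (idx k) E" shows "abs_tuple (idx k) E x = x"
proof (rule extensionalityI[of _ "idx k"])
  show "abs_tuple (idx k) E x i = x i" if "i \<in> idx k" for i
    using assms that riesz_space.vabs_pos[OF E_idx[OF that]] by (simp add: abs_tuple_def pos_tuples_def)
qed (use assms in \<open>auto simp: abs_tuple_def pos_tuples_def tuples_def PiE_iff\<close>)

lemma abs_tuple_slice:
  assumes "k < m"
  shows "abs_tuple (idx k) E (x(\<rho> (Suc k) := t)) =
    (abs_tuple (idx (Suc k)) E x)(\<rho> (Suc k) := vabs (E (\<rho> (Suc k))) t)"
  using rho_mem[OF assms] by (auto simp: abs_tuple_def idx_Suc)

lemma abs_bidual_pos: "pos_bidual_tuple xs \<Longrightarrow> abs_bidual xs = xs"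
proof
  fix i assume xs: "pos_bidual_tuple xs"
  show "abs_bidual xs i = xs i"
  proof (cases "i \<in> {1..m}")
    case True
    then show ?thesis using riesz_space.vabs_pos[OF E_bidual[OF True]] xs
      by (auto simp: abs_bidual_def pos_bidual_tuple_def)
  qed (auto simp: abs_bidual_def)
qed

lemma pos_bidual_abs:
  assumes "bidual_tuple xs" shows "pos_bidual_tuple (abs_bidual xs)"
proof -
  have "vabs (bidual i) (xs i) \<in> pcone (bidual i)" if "i \<in> {1..m}" for i
    using riesz_space.vabs_pcone[OF E_bidual[OF that]] assms that by (auto simp: bidual_tuple_def)
  then show ?thesis by (simp add: pos_bidual_tuple_def abs_bidual_def)
qed

lemma pos_bidual_bidual: "pos_bidual_tuple xs \<Longrightarrow> bidual_tuple xs"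
  by (simp add: pos_bidual_tuple_def bidual_tuple_def pcone_def)

text \<open>Domination by the form with all data replaced by absolute values is what makes the slices
  order bounded, so that the next functional can be applied to them.\<close>

definition dominated :: "nat \<Rightarrow> bool" where
  "dominated k \<longleftrightarrow> (\<forall>xs f x. bidual_tuple xs \<longrightarrow> f \<in> carrier (dual F) \<longrightarrow> x \<in> tuples (idx k) E \<longrightarrow>
     (\<forall>i\<in>idx k. \<forall>u\<in>carrier (E i). (\<forall>v\<in>carrier (E i).
        pform xs k f (x(i := u \<oplus>\<^bsub>E i\<^esub> v)) = pform xs k f (x(i := u)) + pform xs k f (x(i := v))) \<and>
        (\<forall>c. pform xs k f (x(i := c \<odot>\<^bsub>E i\<^esub> u)) = c * pform xs k f (x(i := u)))) \<and>
     \<bar>pform xs k f x\<bar> \<le> pform (abs_bidual xs) k (vabs (dual F) f) (abs_tuple (idx k) E x))"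

lemma dominated_add:
  "\<lbrakk>dominated k; bidual_tuple xs; f \<in> carrier (dual F); x \<in> tuples (idx k) E; i \<in> idx k;
    u \<in> carrier (E i); v \<in> carrier (E i)\<rbrakk> \<Longrightarrow>
    pform xs k f (x(i := u \<oplus>\<^bsub>E i\<^esub> v)) = pform xs k f (x(i := u)) + pform xs k f (x(i := v))"
  unfolding dominated_def by blast

lemma dominated_smult:
  "\<lbrakk>dominated k; bidual_tuple xs; f \<in> carrier (dual F); x \<in> tuples (idx k) E; i \<in> idx k;
    u \<in> carrier (E i)\<rbrakk> \<Longrightarrow> pform xs k f (x(i := c \<odot>\<^bsub>E i\<^esub> u)) = c * pform xs k f (x(i := u))"
  unfolding dominated_def by blast

lemma dominated_abs:
  "\<lbrakk>dominated k; bidual_tuple xs; f \<in> carrier (dual F); x \<in> tuples (idx k) E\<rbrakk> \<Longrightarrow>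
    \<bar>pform xs k f x\<bar> \<le> pform (abs_bidual xs) k (vabs (dual F) f) (abs_tuple (idx k) E x)"
  unfolding dominated_def by blast

text \<open>Positive data are unchanged by passing to absolute values, so domination says that the
  absolute value of the form is at most the form itself.\<close>

lemma dominated_pos:
  assumes "dominated k" "pos_bidual_tuple xs" "f \<in> pcone (dual F)" "x \<in> pos_tuples (idx k) E"
  shows "0 \<le> pform xs k f x"
proof -
  interpret F': riesz_space "dual F" using F by (rule riesz_space.riesz_space_dual)
  have "\<bar>pform xs k f x\<bar> \<le> pform xs k f x"
    using dominated_abs[OF assms(1) pos_bidual_bidual[OF assms(2)] pcone_dual_closed[OF assms(3)]
        pos_tuples_tuples[OF assms(4)]]
    by (simp add: abs_bidual_pos[OF assms(2)] F'.vabs_pos[OF assms(3)] abs_tuple_pos[OF assms(4)])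
  then show ?thesis by linarith
qed

lemma slice_linear:
  assumes k: "k < m" and g: "dominated k" and xs: "bidual_tuple xs" and f: "f \<in> carrier (dual F)"
    and x: "x \<in> tuples (idx (Suc k)) E"
  shows "linear_functional (E (\<rho> (Suc k))) (slice xs k f x)"
proof -
  let ?j = "\<rho> (Suc k)"
  interpret Ej: riesz_space "E ?j" using rho_mem[OF k] by (rule E_idx)
  \<comment> \<open>A tuple over \<open>idx (Suc k)\<close> is not one over \<open>idx k\<close>;
    with 0 inserted it becomes a base point for the linearity statements of stage k.\<close>
  have x0: "x(?j := \<zero>\<^bsub>E ?j\<^esub>) \<in> tuples (idx k) E" using k x by (intro tuples_slice) auto
  show ?thesis
    unfolding linear_functional_def slice_def
    using dominated_add[OF g xs f x0 rho_mem[OF k]] dominated_smult[OF g xs f x0 rho_mem[OF k]] by simp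
qed

lemma slice_pos:
  assumes k: "k < m" and g: "dominated k" and xs: "pos_bidual_tuple xs" and f: "f \<in> pcone (dual F)"
    and x: "x \<in> pos_tuples (idx (Suc k)) E"
  shows "slice xs k f x \<in> pcone (dual (E (\<rho> (Suc k))))"
proof -
  let ?j = "\<rho> (Suc k)"
  interpret Ej: riesz_space "E ?j" using rho_mem[OF k] by (rule E_idx)
  show ?thesis
  proof (rule Ej.positive_linear_in_dual)
    show "linear_functional (E ?j) (slice xs k f x)"
      using k g xs f x by (intro slice_linear pos_bidual_bidual pcone_dual_closed pos_tuples_tuples)
    show "0 \<le> slice xs k f x t" if "t \<in> pcone (E ?j)" for t
      using dominated_pos[OF g xs f pos_tuples_slice[OF k x that]] Ej.pcone_closed[OF that] by (simp add: slice_def)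
  qed (simp add: slice_def)
qed

text \<open>The slice of the absolute data is positive and dominates the given slice. This puts the
  latter into the order dual, the domain of the next functional, and bounds its absolute
  value.\<close>

lemma slice_dual:
  assumes k: "k < m" and g: "dominated k" and xs: "bidual_tuple xs" and f: "f \<in> carrier (dual F)"
    and x: "x \<in> tuples (idx (Suc k)) E"
  shows "slice xs k f x \<in> carrier (dual (E (\<rho> (Suc k))))"
    and "vabs (dual (E (\<rho> (Suc k)))) (slice xs k f x) \<unlhd>\<^bsub>E (\<rho> (Suc k))\<^esub>
      slice (abs_bidual xs) k (vabs (dual F) f) (abs_tuple (idx (Suc k)) E x)"
    and "slice (abs_bidual xs) k (vabs (dual F) f) (abs_tuple (idx (Suc k)) E x)
      \<in> pcone (dual (E (\<rho> (Suc k))))"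
proof -
  let ?j = "\<rho> (Suc k)"
  interpret F': riesz_space "dual F" using F by (rule riesz_space.riesz_space_dual)
  interpret Ej: riesz_space "E ?j" using rho_mem[OF k] by (rule E_idx)
  let ?g = "slice (abs_bidual xs) k (vabs (dual F) f) (abs_tuple (idx (Suc k)) E x)"
  show P: "?g \<in> pcone (dual (E ?j))"
    using k g xs f x by (intro slice_pos pos_bidual_abs abs_tuple_closed F'.vabs_pcone)
  have dom: "\<bar>slice xs k f x t\<bar> \<le> ?g (vabs (E ?j) t)" if t: "t \<in> carrier (E ?j)" for t
    using dominated_abs[OF g xs f tuples_slice[OF k x t]] t abs_tuple_slice[OF k, of x t] Ej.vabs_closed[OF t]
    by (simp add: slice_def)
  have ext: "slice xs k f x \<in> extensional (carrier (E ?j))" by (simp add: slice_def)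
  show "slice xs k f x \<in> carrier (dual (E ?j))"
    by (rule Ej.dominated_functional(1)[OF ext slice_linear[OF k g xs f x] P dom])
  show "vabs (dual (E ?j)) (slice xs k f x) \<unlhd>\<^bsub>E ?j\<^esub> ?g"
    by (rule Ej.dominated_functional(2)[OF ext slice_linear[OF k g xs f x] P dom])
qed

text \<open>The identity |A x| = A |x| starts the induction, through |f (A x)| \<le> |f| (|A
  x|).\<close>

lemma dominated_0: "dominated 0"
  unfolding dominated_def idx_0
proof (intro allI impI conjI ballI)
  interpret F: riesz_space F by (rule F)
  fix xs f x assume f: "f \<in> carrier (dual F)" and x: "x \<in> tuples {1..m} E"
  have "abs_tuple {1..m} E x \<in> tuples {1..m} E"
    using pos_tuples_tuples[OF abs_tuple_closed[of x 0]] x unfolding idx_0 by blast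
  then show "\<bar>pform xs 0 f x\<bar> \<le> pform (abs_bidual xs) 0 (vabs (dual F) f) (abs_tuple {1..m} E x)"
    unfolding pform_0[OF x] using F.functional_abs_le[OF f A_closed[OF x]] A_abs[OF x] by (simp only: pform_0)
  fix i u assume i: "i \<in> {1..m}" and u: "u \<in> carrier (E i)"
  interpret Ei: riesz_space "E i" using i by (rule E)
  have T: "x(i := v) \<in> tuples {1..m} E" if "v \<in> carrier (E i)" for v
    using x i that by (rule tuples_upd)
  note C = A_closed[OF T]
  {
    fix v assume v: "v \<in> carrier (E i)"
    show "pform xs 0 f (x(i := u \<oplus>\<^bsub>E i\<^esub> v)) = pform xs 0 f (x(i := u)) + pform xs 0 f (x(i := v))"
      unfolding pform_0[OF T[OF u]] pform_0[OF T[OF v]] pform_0[OF T[OF Ei.M.a_closed[OF u v]]] A_add[OF x i u v]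
      by (rule functional_add[OF f C[OF u] C[OF v]])
  next
    fix c
    have "c \<odot>\<^bsub>E i\<^esub> u \<in> carrier (E i)" using u by simp
    then show "pform xs 0 f (x(i := c \<odot>\<^bsub>E i\<^esub> u)) = c * pform xs 0 f (x(i := u))"
      using pform_0[OF T] u A_smult[OF x i u] functional_smult[OF f C[OF u]] by simp
  }
qed

lemma dominated_Suc:
  assumes k: "k < m" and g: "dominated k" shows "dominated (Suc k)"
  unfolding dominated_def
proof (intro allI impI conjI ballI)
  let ?j = "\<rho> (Suc k)"
  interpret F': riesz_space "dual F" using F by (rule riesz_space.riesz_space_dual)
  interpret Ej: riesz_space "E ?j" using rho_mem[OF k] by (rule E_idx)
  interpret Ej': riesz_space "dual (E ?j)" by (rule Ej.riesz_space_dual)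
  interpret Ej'': riesz_space "bidual ?j" by (rule Ej'.riesz_space_dual)
  fix xs f x assume xs: "bidual_tuple xs" and f: "f \<in> carrier (dual F)" and x: "x \<in> tuples (idx (Suc k)) E"
  have xj: "xs ?j \<in> carrier (bidual ?j)" using xs rho_range[OF k] by (simp add: bidual_tuple_def)
  note S = slice_dual[OF k g xs f]
  show "\<bar>pform xs (Suc k) f x\<bar> \<le> pform (abs_bidual xs) (Suc k) (vabs (dual F) f) (abs_tuple (idx (Suc k)) E x)"
  proof -
    have "\<bar>pform xs (Suc k) f x\<bar> = \<bar>xs ?j (slice xs k f x)\<bar>" using x by (simp add: pform_Suc)
    \<comment> \<open>The absolute value of the bidual entry is monotone, which allows the absolute
      value of the slice to be replaced by the slice of the absolute data.\<close>
    also have "\<dots> \<le> vabs (bidual ?j) (xs ?j) (vabs (dual (E ?j)) (slice xs k f x))"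
      by (rule Ej'.functional_abs_le[OF xj S(1)[OF x]])
    also have "\<dots> \<le> vabs (bidual ?j) (xs ?j)
        (slice (abs_bidual xs) k (vabs (dual F) f) (abs_tuple (idx (Suc k)) E x))"
      by (rule Ej'.functional_mono[OF Ej''.vabs_pcone[OF xj] S(2)[OF x] Ej'.vabs_closed[OF S(1)[OF x]]
            pcone_dual_closed[OF S(3)[OF x]]])
    also have "\<dots> = pform (abs_bidual xs) (Suc k) (vabs (dual F) f) (abs_tuple (idx (Suc k)) E x)"
      using pform_Suc[OF pos_tuples_tuples[OF abs_tuple_closed[OF x]]] rho_range[OF k] by (simp add: abs_bidual_def)
    finally show ?thesis .
  qed
  fix i u assume i: "i \<in> idx (Suc k)" and u: "u \<in> carrier (E i)"
  interpret Ei: riesz_space "E i" using i by (rule E_idx)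
  have ij: "i \<noteq> ?j" "i \<in> idx k" using idx_neq[OF i] by auto
  have T: "x(i := v) \<in> tuples (idx (Suc k)) E" if "v \<in> carrier (E i)" for v
    using x i that by (rule tuples_upd)
  \<comment> \<open>Replacing coordinate i commutes with inserting t at the coordinate of this
    stage, so linearity at stage k makes the slice linear in coordinate i.\<close>
  have tw: "x(i := v, ?j := t) = (x(?j := t))(i := v)" for v t using ij by (simp add: fun_upd_twist)
  {
    fix v assume v: "v \<in> carrier (E i)"
    have "slice xs k f (x(i := u \<oplus>\<^bsub>E i\<^esub> v)) =
        slice xs k f (x(i := u)) \<oplus>\<^bsub>dual (E ?j)\<^esub> slice xs k f (x(i := v))"
      using dominated_add[OF g xs f tuples_slice[OF k x] ij(2) u v] by (auto simp: slice_def tw)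
    then show "pform xs (Suc k) f (x(i := u \<oplus>\<^bsub>E i\<^esub> v)) = pform xs (Suc k) f (x(i := u)) + pform xs (Suc k) f (x(i := v))"
      using functional_add[OF xj S(1)[OF T[OF u]] S(1)[OF T[OF v]]] T u v by (simp add: pform_Suc)
  next
    fix c
    have "slice xs k f (x(i := c \<odot>\<^bsub>E i\<^esub> u)) = c \<odot>\<^bsub>dual (E ?j)\<^esub> slice xs k f (x(i := u))"
      using dominated_smult[OF g xs f tuples_slice[OF k x] ij(2) u] by (auto simp: slice_def tw)
    then show "pform xs (Suc k) f (x(i := c \<odot>\<^bsub>E i\<^esub> u)) = c * pform xs (Suc k) f (x(i := u))"
      using functional_smult[OF xj S(1)[OF T[OF u]]] T u by (simp add: pform_Suc)
  }
qed

lemma dominated: "k \<le> m \<Longrightarrow> dominated k"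
  by (induction k) (auto intro: dominated_0 dominated_Suc)


section \<open>Linearity and monotonicity of the stages\<close>

lemma pform_cong: "(\<And>n. n \<in> {1..k} \<Longrightarrow> xs (\<rho> n) = ys (\<rho> n)) \<Longrightarrow> pform xs k = pform ys k"
proof (induction k)
  case 0
  then show ?case by (simp add: pform_def fun_eq_iff)
next
  case (Suc k)
  have "pform zs (Suc k) = arens_bar m E \<rho> (Suc k) (zs (\<rho> (Suc k))) \<circ> pform zs k" for zs
    by (simp add: pform_def fun_eq_iff)
  then show ?case using Suc by simp
qed

text \<open>An index in \<open>idx k\<close> is not extended in the first k stages, so its bidual
  entry has not been read.\<close>

lemma pform_upd: "j \<in> idx k \<Longrightarrow> pform (xs(j := \<xi>)) k = pform xs k"
  by (rule pform_cong) (auto simp: arens_index_def)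

lemma bidual_upd: "\<lbrakk>bidual_tuple xs; \<xi> \<in> carrier (bidual i)\<rbrakk> \<Longrightarrow> bidual_tuple (xs(i := \<xi>))"
  by (simp add: bidual_tuple_def)

lemma slice_closed:
  "\<lbrakk>k < m; bidual_tuple xs; f \<in> carrier (dual F); x \<in> tuples (idx (Suc k)) E\<rbrakk>
    \<Longrightarrow> slice xs k f x \<in> carrier (dual (E (\<rho> (Suc k))))"
  using slice_dual(1) dominated by simp

lemma slice_pcone:
  "\<lbrakk>k < m; pos_bidual_tuple xs; f \<in> pcone (dual F); x \<in> pos_tuples (idx (Suc k)) E\<rbrakk>
    \<Longrightarrow> slice xs k f x \<in> pcone (dual (E (\<rho> (Suc k))))"
  using slice_pos dominated by simp

lemma pform_nonneg:
  "\<lbrakk>k \<le> m; pos_bidual_tuple xs; f \<in> pcone (dual F); x \<in> pos_tuples (idx k) E\<rbrakk> \<Longrightarrow> 0 \<le> pform xs k f x"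
  using dominated_pos dominated by blast

text \<open>The two coefficients treat sums, differences and multiples in one induction. The
  combination is given by values, because slices are compared pointwise.\<close>

lemma pform_lincomb:
  assumes xs: "bidual_tuple xs" and f: "f \<in> carrier (dual F)" and g: "g \<in> carrier (dual F)"
    and h: "h \<in> carrier (dual F)" and eq: "\<And>y. y \<in> carrier F \<Longrightarrow> h y = c * f y + d * g y"
  shows "\<lbrakk>k \<le> m; x \<in> tuples (idx k) E\<rbrakk> \<Longrightarrow> pform xs k h x = c * pform xs k f x + d * pform xs k g x"
proof (induction k arbitrary: x)
  case 0
  then show ?case using eq[OF A_closed[of x]] by (simp add: idx_0 pform_0)
next
  case (Suc k)
  then have k: "k < m" by simp
  have xj: "xs (\<rho> (Suc k)) \<in> carrier (bidual (\<rho> (Suc k)))"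
    using xs rho_range[OF k] by (simp add: bidual_tuple_def)
  have "slice xs k h x t = c * slice xs k f x t + d * slice xs k g x t" if t: "t \<in> carrier (E (\<rho> (Suc k)))" for t
  proof -
    have "pform xs k h (x(\<rho> (Suc k) := t)) = c * pform xs k f (x(\<rho> (Suc k) := t)) + d * pform xs k g (x(\<rho> (Suc k) := t))"
      using k by (intro Suc.IH tuples_slice[OF k Suc.prems(2) t]) simp
    then show ?thesis using t by (simp add: slice_def)
  qed
  then show ?case
    using riesz_space.bidual_lincomb[OF E_idx[OF rho_mem[OF k]] xj slice_closed slice_closed slice_closed]
      k xs f g h Suc.prems(2) by (simp add: pform_Suc)
qed

lemma slice_lincomb:
  assumes "k < m" "bidual_tuple xs" "f \<in> carrier (dual F)" "g \<in> carrier (dual F)"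
    "h \<in> carrier (dual F)" "\<And>y. y \<in> carrier F \<Longrightarrow> h y = c * f y + d * g y"
    "x \<in> tuples (idx (Suc k)) E" "t \<in> carrier (E (\<rho> (Suc k)))"
  shows "slice xs k h x t = c * slice xs k f x t + d * slice xs k g x t"
  using pform_lincomb[OF assms(2-6) _ tuples_slice[OF assms(1,7,8)]] assms(1,8) by (simp add: slice_def)

text \<open>The form depends on entry i only after it has been read, hence the premise i \<notin>
  \<open>idx k\<close>. At the stage that reads it, all three entries act on the same slice; at
  later stages the combination has passed into the slices.\<close>

lemma pform_bidual_lincomb:
  assumes xs: "bidual_tuple xs" and f: "f \<in> carrier (dual F)" and i: "i \<in> {1..m}"
    and C: "\<xi> \<in> carrier (bidual i)" "\<eta> \<in> carrier (bidual i)" "\<zeta> \<in> carrier (bidual i)"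
    and eq: "\<And>h. h \<in> carrier (dual (E i)) \<Longrightarrow> \<zeta> h = c * \<xi> h + d * \<eta> h"
  shows "\<lbrakk>k \<le> m; x \<in> tuples (idx k) E; i \<notin> idx k\<rbrakk> \<Longrightarrow>
    pform (xs(i := \<zeta>)) k f x = c * pform (xs(i := \<xi>)) k f x + d * pform (xs(i := \<eta>)) k f x"
proof (induction k arbitrary: x)
  case 0
  then show ?case using i by (simp add: idx_0)
next
  case (Suc k)
  then have k: "k < m" by simp
  let ?j = "\<rho> (Suc k)"
  have U: "bidual_tuple (xs(i := \<xi>))" "bidual_tuple (xs(i := \<eta>))" "bidual_tuple (xs(i := \<zeta>))"
    using xs C by (auto intro: bidual_upd)
  note S = slice_closed[OF k _ f Suc.prems(2)]
  show ?case
  proof (cases "i = ?j")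
    case True
    have "slice (xs(?j := \<upsilon>)) k f x = slice xs k f x" for \<upsilon>
      unfolding slice_def pform_upd[OF rho_mem[OF k]] ..
    then have *: "pform (xs(i := \<upsilon>)) (Suc k) f x = \<upsilon> (slice xs k f x)" for \<upsilon>
      unfolding pform_Suc[OF Suc.prems(2)] True by (simp only: fun_upd_same)
    show ?thesis unfolding * using eq[of "slice xs k f x"] S[OF xs] True by blast
  next
    case False
    then have "i \<notin> idx k" using Suc.prems(3) by (simp add: idx_Suc)
    then have eq': "slice (xs(i := \<zeta>)) k f x t = c * slice (xs(i := \<xi>)) k f x t + d * slice (xs(i := \<eta>)) k f x t"
      if t: "t \<in> carrier (E ?j)" for t
    proof -
      have "pform (xs(i := \<zeta>)) k f (x(?j := t)) = c * pform (xs(i := \<xi>)) k f (x(?j := t)) + d * pform (xs(i := \<eta>)) k f (x(?j := t))"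
        using k \<open>i \<notin> idx k\<close> by (intro Suc.IH tuples_slice[OF k Suc.prems(2) t]) simp_all
      then show ?thesis using t by (simp add: slice_def)
    qed
    have xj: "xs ?j \<in> carrier (bidual ?j)" using xs rho_range[OF k] by (simp add: bidual_tuple_def)
    have *: "pform (xs(i := \<upsilon>)) (Suc k) f x = xs ?j (slice (xs(i := \<upsilon>)) k f x)" for \<upsilon>
      unfolding pform_Suc[OF Suc.prems(2)] using False by (simp only: fun_upd_other not_sym)
    show ?thesis
      unfolding * by (rule riesz_space.bidual_lincomb[OF E_idx[OF rho_mem[OF k]] xj S[OF U(1)] S[OF U(2)] S[OF U(3)] eq'])
  qed
qed

lemma dual_diff_closed:
  "\<lbrakk>f \<in> carrier (dual F); g \<in> carrier (dual F)\<rbrakk> \<Longrightarrow> dual_diff F f g \<in> carrier (dual F)"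
  unfolding dual_diff_def by (rule riesz_space.dual_minus_closed[OF F])

lemma pform_diff:
  assumes "k \<le> m" "bidual_tuple xs" "f \<in> carrier (dual F)" "g \<in> carrier (dual F)" "x \<in> tuples (idx k) E"
  shows "pform xs k (dual_diff F f g) x = pform xs k f x - pform xs k g x"
  using pform_lincomb[OF assms(2-4) dual_diff_closed[OF assms(3,4)], of 1 "-1" k x] assms
  by (simp add: dual_diff_def)

lemma pform_mono_functional:
  assumes "k \<le> m" "pos_bidual_tuple xs" "f \<in> carrier (dual F)" "g \<in> carrier (dual F)"
    "f \<unlhd>\<^bsub>F\<^esub> g" "x \<in> pos_tuples (idx k) E"
  shows "pform xs k f x \<le> pform xs k g x"
  using pform_diff[OF assms(1) pos_bidual_bidual[OF assms(2)] assms(4,3) pos_tuples_tuples[OF assms(6)]]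
    pform_nonneg[OF assms(1,2) riesz_space.dual_diff_pcone[OF F assms(4,3,5)] assms(6)] by simp

lemma slice_mono_functional:
  assumes "k < m" "pos_bidual_tuple xs" "f \<in> carrier (dual F)" "g \<in> carrier (dual F)"
    "f \<unlhd>\<^bsub>F\<^esub> g" "x \<in> pos_tuples (idx (Suc k)) E"
  shows "slice xs k f x \<unlhd>\<^bsub>E (\<rho> (Suc k))\<^esub> slice xs k g x"
  unfolding dual_vle slice_def
  using pform_mono_functional[OF _ assms(2-5) pos_tuples_slice[OF assms(1,6)]] assms(1)
  by (simp add: pcone_def)

text \<open>Coordinates of x are exchanged for those of y one at a time; each exchange adds the
  value of the form at a positive tuple.\<close>

lemma pform_mono_tuple:
  assumes k: "k \<le> m" and xs: "pos_bidual_tuple xs" and f: "f \<in> pcone (dual F)"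
    and x: "x \<in> pos_tuples (idx k) E" and y: "y \<in> pos_tuples (idx k) E"
    and le: "\<And>i. i \<in> idx k \<Longrightarrow> x i \<preceq>\<^bsub>E i\<^esub> y i"
  shows "pform xs k f x \<le> pform xs k f y"
proof -
  define h where "h S = (\<lambda>i. if i \<in> S then y i else x i)" for S
  have hP: "h S \<in> pos_tuples (idx k) E" for S
    using x y by (auto simp: pos_tuples_def tuples_def PiE_iff extensional_def h_def)
  have "finite S \<Longrightarrow> S \<subseteq> idx k \<Longrightarrow> pform xs k f x \<le> pform xs k f (h S)" for S
  proof (induction S rule: finite_induct)
    case empty
    then show ?case by (simp add: h_def)
  next
    case (insert i S)
    interpret Ei: riesz_space "E i" using insert by (intro E_idx[of _ k]) auto
    have i: "i \<in> idx k" and C: "x i \<in> carrier (E i)" "y i \<in> carrier (E i)"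
      using insert x y by (auto simp: pos_tuples_def intro: tuples_nth)
    obtain p where p: "p \<in> pcone (E i)" "y i = x i \<oplus>\<^bsub>E i\<^esub> p" using le[OF i] C Ei.vle_iff by auto
    have "h (insert i S) = (h S)(i := x i \<oplus>\<^bsub>E i\<^esub> p)" "h S = (h S)(i := x i)"
      using p insert by (auto simp: h_def)
    then have "pform xs k f (h (insert i S)) = pform xs k f (h S) + pform xs k f ((h S)(i := p))"
      using dominated_add[OF dominated[OF k] pos_bidual_bidual[OF xs] pcone_dual_closed[OF f]
          pos_tuples_tuples[OF hP[of S]] i C(1) Ei.pcone_closed[OF p(1)]] by simp
    moreover have "0 \<le> pform xs k f ((h S)(i := p))"
      using k xs f i p by (intro pform_nonneg pos_tuples_upd hP)
    ultimately show ?case using insert by simp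
  qed
  moreover have "finite (idx k)" by (simp add: arens_index_def)
  ultimately have "pform xs k f x \<le> pform xs k f (h (idx k))" by blast
  moreover have "h (idx k) = y"
    using x y by (auto simp: h_def pos_tuples_def tuples_def PiE_iff extensional_def)
  ultimately show ?thesis by simp
qed

text \<open>The coordinatewise sum is a common majorant. Positive tuples can thus index directed
  families of gauges.\<close>

lemma pos_tuples_directed:
  assumes x: "x \<in> pos_tuples (idx k) E" and y: "y \<in> pos_tuples (idx k) E"
  obtains z where "z \<in> pos_tuples (idx k) E" "\<And>i. i \<in> idx k \<Longrightarrow> x i \<preceq>\<^bsub>E i\<^esub> z i" "\<And>i. i \<in> idx k \<Longrightarrow> y i \<preceq>\<^bsub>E i\<^esub> z i"
proof -
  let ?z = "\<lambda>i\<in>idx k. x i \<oplus>\<^bsub>E i\<^esub> y i"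
  have *: "x i \<oplus>\<^bsub>E i\<^esub> y i \<in> pcone (E i) \<and> x i \<preceq>\<^bsub>E i\<^esub> x i \<oplus>\<^bsub>E i\<^esub> y i \<and> y i \<preceq>\<^bsub>E i\<^esub> x i \<oplus>\<^bsub>E i\<^esub> y i"
    if i: "i \<in> idx k" for i
  proof -
    interpret Ei: riesz_space "E i" using i by (rule E_idx)
    have P: "x i \<in> pcone (E i)" "y i \<in> pcone (E i)" using x y i by (auto simp: pos_tuples_def)
    then show ?thesis
      using Ei.pcone_add[OF P] Ei.vle_add[of "x i" "y i"] Ei.vle_add[of "y i" "x i"] Ei.pcone_closed
      by (simp add: Ei.M.a_comm)
  qed
  then have "?z \<in> pos_tuples (idx k) E" by (auto simp: pos_tuples_def tuples_def pcone_def)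
  then show ?thesis by (rule that) (use * in auto)
qed

section \<open>Order continuity of the stages\<close>

definition pos_oc_tuple :: "(nat \<Rightarrow> ('a \<Rightarrow> real) \<Rightarrow> real) \<Rightarrow> bool" where
  "pos_oc_tuple xs \<longleftrightarrow> (\<forall>i\<in>{1..m}. xs i \<in> pcone (bidual i) \<and> order_continuous (dual (E i)) (xs i))"

lemma pos_oc_pos: "pos_oc_tuple xs \<Longrightarrow> pos_bidual_tuple xs"
  by (simp add: pos_oc_tuple_def pos_bidual_tuple_def)

lemma pos_oc_gauge: "\<lbrakk>pos_oc_tuple xs; i \<in> {1..m}\<rbrakk> \<Longrightarrow> gauge (E i) (xs i)"
  by (rule riesz_space.gauge_order_continuous[OF E]) (auto simp: pos_oc_tuple_def)

text \<open>Continuity of stage k, tested at tuples, is the pointwise approximation that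
  \<open>directed_sup\<close> asks of the slices; directedness follows from monotonicity in the
  functional.\<close>

lemma directed_sup_slice:
  assumes k: "k < m" and xs: "pos_bidual_tuple xs" and D: "directed_sup F D s"
    and ap: "\<And>x e. \<lbrakk>x \<in> pos_tuples (idx k) E; 0 < e\<rbrakk> \<Longrightarrow> \<exists>d\<in>D. pform xs k s x < pform xs k d x + e"
    and x: "x \<in> pos_tuples (idx (Suc k)) E"
  shows "directed_sup (E (\<rho> (Suc k))) ((\<lambda>d. slice xs k d x) ` D) (slice xs k s x)"
proof -
  let ?j = "\<rho> (Suc k)"
  let ?T = "\<lambda>d. slice xs k d x"
  have DP: "D \<noteq> {}" "\<And>d. d \<in> D \<Longrightarrow> d \<in> pcone (dual F)" "s \<in> pcone (dual F)"
    "\<And>d. d \<in> D \<Longrightarrow> d \<unlhd>\<^bsub>F\<^esub> s"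
    using D by (auto simp: directed_sup_def)
  have mono: "?T f \<unlhd>\<^bsub>E ?j\<^esub> ?T g"
    if "f \<in> pcone (dual F)" "g \<in> pcone (dual F)" "f \<unlhd>\<^bsub>F\<^esub> g" for f g
    using slice_mono_functional[OF k xs _ _ that(3) x] that pcone_dual_closed by blast
  have dir: "\<exists>d''\<in>D. ?T d \<unlhd>\<^bsub>E ?j\<^esub> ?T d'' \<and> ?T d' \<unlhd>\<^bsub>E ?j\<^esub> ?T d''"
    if dd: "d \<in> D" "d' \<in> D" for d d'
  proof -
    obtain d'' where "d'' \<in> D" "d \<unlhd>\<^bsub>F\<^esub> d''" "d' \<unlhd>\<^bsub>F\<^esub> d''"
      using D dd unfolding directed_sup_def by blast
    then show ?thesis using mono DP dd by blast
  qed
  have approx: "\<exists>d\<in>D. ?T s t < ?T d t + e" if "t \<in> pcone (E ?j)" "0 < e" for t and e :: real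
    using ap[OF pos_tuples_slice[OF k x that(1)] that(2)] that(1) by (simp add: slice_def pcone_def)
  show ?thesis
    unfolding directed_sup_def
    using DP(1) dir approx slice_pcone[OF k xs _ x] DP mono by (auto simp: image_subset_iff)
qed

text \<open>Each stage turns an increasing set of functionals into an increasing set of slices, to
  which the gauge property of the next bidual entry applies.\<close>

lemma pform_directed_sup:
  assumes xs: "pos_oc_tuple xs" and D: "directed_sup F D s"
  shows "\<lbrakk>k \<le> m; x \<in> pos_tuples (idx k) E; 0 < e\<rbrakk> \<Longrightarrow> \<exists>d\<in>D. pform xs k s x < pform xs k d x + e"
proof (induction k arbitrary: x e)
  case 0
  then have x: "x \<in> tuples {1..m} E" using pos_tuples_tuples[of x "idx 0"] by (simp add: idx_0)
  interpret F: riesz_space F by (rule F)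
  \<comment> \<open>At positive tuples A has values in the cone, where directed suprema are
    pointwise.\<close>
  have "A x = vabs F (A x)" using A_abs[OF x] abs_tuple_pos[OF 0(2)] by (simp add: idx_0)
  then have "A x \<in> pcone F" using F.vabs_pcone[OF A_closed[OF x]] by simp
  then show ?case using D 0(3) x by (simp add: directed_sup_def pform_0)
next
  case (Suc k)
  then have k: "k < m" by simp
  have "directed_sup (E (\<rho> (Suc k))) ((\<lambda>d. slice xs k d x) ` D) (slice xs k s x)"
    using Suc by (intro directed_sup_slice[OF k pos_oc_pos[OF xs] D]) auto
  from gaugeD(4)[OF pos_oc_gauge[OF xs rho_range[OF k]] this Suc.prems(3)]
  show ?case using pos_tuples_tuples[OF Suc.prems(2)] by (simp add: pform_Suc)
qed

lemma pform_gauge: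
  assumes k: "k \<le> m" and xs: "pos_oc_tuple xs" and x: "x \<in> pos_tuples (idx k) E"
  shows "gauge F (\<lambda>f. pform xs k f x)"
proof -
  interpret F: riesz_space F by (rule F)
  interpret F': riesz_space "dual F" by (rule F.riesz_space_dual)
  note P = pos_oc_pos[OF xs]
  have "pform xs k (f \<oplus>\<^bsub>dual F\<^esub> g) x = pform xs k f x + pform xs k g x"
    if "f \<in> pcone (dual F)" "g \<in> pcone (dual F)" for f g
  proof -
    have "f \<in> carrier (dual F)" "g \<in> carrier (dual F)"
      "f \<oplus>\<^bsub>dual F\<^esub> g \<in> carrier (dual F)"
      using that F'.pcone_add[OF that] pcone_dual_closed by blast+
    from pform_lincomb[OF pos_bidual_bidual[OF P] this, of 1 1 k x] show ?thesis
      using k x pos_tuples_tuples by auto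
  qed
  moreover have "pform xs k f x \<le> pform xs k g x"
    if "f \<in> pcone (dual F)" "g \<in> pcone (dual F)" "f \<unlhd>\<^bsub>F\<^esub> g" for f g
    using pform_mono_functional[OF k P _ _ that(3) x] that pcone_dual_closed by blast
  ultimately show ?thesis
    unfolding gauge_def using pform_nonneg[OF k P _ x] pform_directed_sup[OF xs _ k x] by auto
qed

section \<open>Separation through the stages\<close>

lemma pform_Suc_zero:
  assumes k: "k < m" and xs: "bidual_tuple xs" and f: "f \<in> carrier (dual F)"
    and z: "z \<in> tuples (idx (Suc k)) E"
    and zero: "\<And>t. t \<in> pcone (E (\<rho> (Suc k))) \<Longrightarrow> pform xs k f (z(\<rho> (Suc k) := t)) = 0"
  shows "pform xs (Suc k) f z = 0"
proof -
  let ?j = "\<rho> (Suc k)"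
  interpret Ej: riesz_space "E ?j" using rho_mem[OF k] by (rule E_idx)
  interpret Ej': riesz_space "dual (E ?j)" by (rule Ej.riesz_space_dual)
  have xj: "xs ?j \<in> carrier (bidual ?j)" using xs rho_range[OF k] by (simp add: bidual_tuple_def)
  have "slice xs k f z = \<zero>\<^bsub>dual (E ?j)\<^esub>"
  proof (rule functional_pos_eqI[OF Ej.riesz_space_axioms slice_closed[OF k xs f z] Ej'.M.zero_closed])
    fix t assume t: "t \<in> pcone (E ?j)"
    then show "slice xs k f z t = \<zero>\<^bsub>dual (E ?j)\<^esub> t"
      using zero[OF t] Ej.pcone_closed[OF t] by (simp add: slice_def)
  qed
  then show ?thesis unfolding pform_Suc[OF z] using Ej'.functional_zero[OF xj] by simp
qed

text \<open>Supplies the directedness premise of \<open>simultaneous_separation\<close>. The maps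
  \<phi> and \<psi> will either replace one coordinate by a fixed element or be the identity;
  \<open>xs\<close> and \<open>ys\<close> admit families that differ in one bidual entry.\<close>

lemma pform_gauge_directed:
  assumes "k \<le> m" "pos_bidual_tuple xs" "pos_bidual_tuple ys"
    and \<phi>: "\<And>x. x \<in> pos_tuples (idx k') E \<Longrightarrow> \<phi> x \<in> pos_tuples (idx k) E"
    and \<psi>: "\<And>x. x \<in> pos_tuples (idx k') E \<Longrightarrow> \<psi> x \<in> pos_tuples (idx k) E"
    and mono: "\<And>x y i. \<lbrakk>x \<in> pos_tuples (idx k') E; y \<in> pos_tuples (idx k') E;
        \<And>i. i \<in> idx k' \<Longrightarrow> x i \<preceq>\<^bsub>E i\<^esub> y i; i \<in> idx k\<rbrakk> \<Longrightarrow> \<phi> x i \<preceq>\<^bsub>E i\<^esub> \<phi> y i \<and> \<psi> x i \<preceq>\<^bsub>E i\<^esub> \<psi> y i"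
    and x: "x \<in> pos_tuples (idx k') E" and y: "y \<in> pos_tuples (idx k') E"
  shows "\<exists>z\<in>pos_tuples (idx k') E. \<forall>g\<in>pcone (dual F).
    pform xs k g (\<phi> x) \<le> pform xs k g (\<phi> z) \<and> pform xs k g (\<phi> y) \<le> pform xs k g (\<phi> z) \<and>
    pform ys k g (\<psi> x) \<le> pform ys k g (\<psi> z) \<and> pform ys k g (\<psi> y) \<le> pform ys k g (\<psi> z)"
proof -
  obtain z where z: "z \<in> pos_tuples (idx k') E" "\<And>i. i \<in> idx k' \<Longrightarrow> x i \<preceq>\<^bsub>E i\<^esub> z i"
    "\<And>i. i \<in> idx k' \<Longrightarrow> y i \<preceq>\<^bsub>E i\<^esub> z i"
    using pos_tuples_directed[OF x y] by blast
  have "\<phi> x i \<preceq>\<^bsub>E i\<^esub> \<phi> z i \<and> \<psi> x i \<preceq>\<^bsub>E i\<^esub> \<psi> z i" "\<phi> y i \<preceq>\<^bsub>E i\<^esub> \<phi> z i \<and> \<psi> y i \<preceq>\<^bsub>E i\<^esub> \<psi> z i"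
    if "i \<in> idx k" for i
    using mono[OF x z(1) z(2) that] mono[OF y z(1) z(3) that] by blast+
  then show ?thesis
    using \<phi>[OF x] \<phi>[OF y] \<phi>[OF z(1)] \<psi>[OF x] \<psi>[OF y] \<psi>[OF z(1)] z(1) assms(1-3)
    by (intro bexI[of _ z] ballI conjI pform_mono_tuple) blast+
qed

text \<open>The difference z of disjoint elements has their sum as absolute value. Since A preserves
  absolute values, the difference of the two values of A also has their sum as absolute value, which
  forces them to be disjoint.\<close>

lemma A_disjoint:
  assumes x: "x \<in> pos_tuples {1..m} E" and j: "j \<in> {1..m}" and d: "vdisjoint (E j) y\<^sub>1 y\<^sub>2"
  shows "vdisjoint F (A (x(j := y\<^sub>1))) (A (x(j := y\<^sub>2)))"
proof -
  interpret F: riesz_space F by (rule F)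
  interpret Ej: riesz_space "E j" using j by (rule E)
  have P: "y\<^sub>1 \<in> pcone (E j)" "y\<^sub>2 \<in> pcone (E j)" using d by (auto simp: vdisjoint_def)
  then have C: "y\<^sub>1 \<in> carrier (E j)" "y\<^sub>2 \<in> carrier (E j)" using Ej.pcone_closed by auto
  have A_pos: "A z \<in> pcone F" if "z \<in> pos_tuples {1..m} E" for z
    using F.vabs_pcone[OF A_closed[OF pos_tuples_tuples[OF that]]] A_abs[OF pos_tuples_tuples[OF that]]
      abs_tuple_pos[of z 0] that by (simp add: idx_0)
  define z where "z = y\<^sub>1 \<oplus>\<^bsub>E j\<^esub> \<ominus>\<^bsub>E j\<^esub> y\<^sub>2"
  have z: "z \<in> carrier (E j)" "y\<^sub>1 = z \<oplus>\<^bsub>E j\<^esub> y\<^sub>2"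
    using C by (auto simp: z_def Ej.M.a_assoc Ej.M.l_neg)
  have vz: "vabs (E j) z = y\<^sub>1 \<oplus>\<^bsub>E j\<^esub> y\<^sub>2"
    using Ej.vabs_diff_disjoint[OF C z] d P by (simp add: Ej.vabs_pos)
  have "abs_tuple {1..m} E (x(j := z)) = x(j := y\<^sub>1 \<oplus>\<^bsub>E j\<^esub> y\<^sub>2)"
  proof -
    have xe: "abs_tuple {1..m} E x = x" using abs_tuple_pos[of x 0] x by (simp add: idx_0)
    have "abs_tuple {1..m} E (x(j := u)) = (abs_tuple {1..m} E x)(j := vabs (E j) u)" for u
      using j by (auto simp: abs_tuple_def)
    then show ?thesis unfolding xe by (simp only: vz)
  qed
  moreover have T: "x(j := u) \<in> tuples {1..m} E" if "u \<in> carrier (E j)" for u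
    using pos_tuples_tuples[OF x] j that by (rule tuples_upd)
  ultimately have "vabs F (A (x(j := z))) = A (x(j := y\<^sub>1)) \<oplus>\<^bsub>F\<^esub> A (x(j := y\<^sub>2))"
    using A_abs[OF T[OF z(1)]] A_add[OF pos_tuples_tuples[OF x] j C] by simp
  moreover have "A (x(j := y\<^sub>1)) = A (x(j := z)) \<oplus>\<^bsub>F\<^esub> A (x(j := y\<^sub>2))"
    using A_add[OF pos_tuples_tuples[OF x] j z(1) C(2)] z(2) by simp
  ultimately show ?thesis
    by (intro F.vdisjoint_abs_diff[of _ _ "A (x(j := z))"] A_pos pos_tuples_upd x j P A_closed T z)
qed

text \<open>The separating functional obtained for \<open>k = 0\<close> serves for all later stages.\<close>

lemma separation_argument:
  assumes xs: "pos_oc_tuple xs" and f: "f \<in> pcone (dual F)" and d: "vdisjoint (E j) y\<^sub>1 y\<^sub>2"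
  shows "\<lbrakk>k \<le> m; j \<in> idx k\<rbrakk> \<Longrightarrow> \<exists>g\<in>pcone (dual F). g \<unlhd>\<^bsub>F\<^esub> f \<and>
    (\<forall>x\<in>pos_tuples (idx k) E. pform xs k g (x(j := y\<^sub>1)) = 0 \<and> pform xs k (dual_diff F f g) (x(j := y\<^sub>2)) = 0)"
proof (induction k)
  case 0
  interpret F: riesz_space F by (rule F)
  have j: "j \<in> idx 0" "j \<in> {1..m}" using 0 by (auto simp: idx_0)
  interpret Ej: riesz_space "E j" using j(2) by (rule E)
  have P: "y\<^sub>1 \<in> pcone (E j)" "y\<^sub>2 \<in> pcone (E j)" using d by (auto simp: vdisjoint_def)
  have U: "x(j := y\<^sub>1) \<in> pos_tuples (idx 0) E" "x(j := y\<^sub>2) \<in> pos_tuples (idx 0) E"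
    if "x \<in> pos_tuples (idx 0) E" for x
    using that j(1) P by (auto intro: pos_tuples_upd)
  show ?case
  proof (rule F.simultaneous_separation[of "pos_tuples (idx 0) E" "\<lambda>x g. pform xs 0 g (x(j := y\<^sub>1))"
        "\<lambda>x g. pform xs 0 g (x(j := y\<^sub>2))" f])
    fix x assume x: "x \<in> pos_tuples (idx 0) E"
    show "gauge F (\<lambda>g. pform xs 0 g (x(j := y\<^sub>1)))" "gauge F (\<lambda>g. pform xs 0 g (x(j := y\<^sub>2)))"
      using U[OF x] by (auto intro: pform_gauge xs)
    fix e :: real assume e: "0 < e"
    have x': "x \<in> pos_tuples {1..m} E" using x by (simp add: idx_0)
    have T: "x(j := y\<^sub>1) \<in> tuples {1..m} E" "x(j := y\<^sub>2) \<in> tuples {1..m} E"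
      using U[OF x] pos_tuples_tuples[of _ "idx 0"] by (auto simp: idx_0)
    \<comment> \<open>The component is an exact splitting but depends on x; one g for all positive
      tuples comes from the surrounding \<open>simultaneous_separation\<close>.\<close>
    obtain g where g: "g \<in> pcone (dual F)" "g \<unlhd>\<^bsub>F\<^esub> f" "g (A (x(j := y\<^sub>1))) = 0"
      "g (A (x(j := y\<^sub>2))) = f (A (x(j := y\<^sub>2)))"
      using F.functional_disjoint_component[OF A_disjoint[OF x' j(2) d] f] by blast
    then show "\<exists>g\<in>pcone (dual F). g \<unlhd>\<^bsub>F\<^esub> f \<and> pform xs 0 g (x(j := y\<^sub>1)) < e \<and>
        pform xs 0 (dual_diff F f g) (x(j := y\<^sub>2)) < e"
      using e A_closed[OF T(2)] unfolding pform_0[OF T(1)] pform_0[OF T(2)]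
      by (intro bexI[of _ g]) (auto simp: dual_diff_def)
  next
    fix x y assume "x \<in> pos_tuples (idx 0) E" "y \<in> pos_tuples (idx 0) E"
    then show "\<exists>z\<in>pos_tuples (idx 0) E. \<forall>g\<in>pcone (dual F).
      pform xs 0 g (x(j := y\<^sub>1)) \<le> pform xs 0 g (z(j := y\<^sub>1)) \<and> pform xs 0 g (y(j := y\<^sub>1)) \<le> pform xs 0 g (z(j := y\<^sub>1)) \<and>
      pform xs 0 g (x(j := y\<^sub>2)) \<le> pform xs 0 g (z(j := y\<^sub>2)) \<and> pform xs 0 g (y(j := y\<^sub>2)) \<le> pform xs 0 g (z(j := y\<^sub>2))"
      using U P Ej.vle_refl Ej.pcone_closed pos_oc_pos[OF xs]
      by (intro pform_gauge_directed[of 0 xs xs 0 "\<lambda>x. x(j := y\<^sub>1)" "\<lambda>x. x(j := y\<^sub>2)"]) auto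
  qed (rule f)
next
  case (Suc k)
  then have k: "k < m" by simp
  have jk: "j \<in> idx k" "j \<noteq> \<rho> (Suc k)" using idx_neq[OF Suc.prems(2)] by auto
  obtain g where g: "g \<in> pcone (dual F)" "g \<unlhd>\<^bsub>F\<^esub> f"
    "\<And>x. x\<in>pos_tuples (idx k) E \<Longrightarrow> pform xs k g (x(j := y\<^sub>1)) = 0"
    "\<And>x. x\<in>pos_tuples (idx k) E \<Longrightarrow> pform xs k (dual_diff F f g) (x(j := y\<^sub>2)) = 0"
    using Suc.IH[OF less_imp_le[OF k] jk(1)] by blast
  have C: "g \<in> carrier (dual F)" "dual_diff F f g \<in> carrier (dual F)"
    using g f by (auto intro: dual_diff_closed pcone_dual_closed)
  have P: "y\<^sub>1 \<in> pcone (E j)" "y\<^sub>2 \<in> pcone (E j)" using d by (auto simp: vdisjoint_def)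
  have xb: "bidual_tuple xs" using xs by (intro pos_bidual_bidual pos_oc_pos)
  have "pform xs (Suc k) g (x(j := y\<^sub>1)) = 0 \<and> pform xs (Suc k) (dual_diff F f g) (x(j := y\<^sub>2)) = 0"
    if x: "x \<in> pos_tuples (idx (Suc k)) E" for x
  proof -
    have T: "x(j := y\<^sub>1) \<in> tuples (idx (Suc k)) E" "x(j := y\<^sub>2) \<in> tuples (idx (Suc k)) E"
      using pos_tuples_upd[OF x Suc.prems(2)] P pos_tuples_tuples by blast+
    have tw: "x(j := y, \<rho> (Suc k) := t) = x(\<rho> (Suc k) := t, j := y)" for y t
      using jk(2) by (rule fun_upd_twist)
    show ?thesis
    proof
      show "pform xs (Suc k) g (x(j := y\<^sub>1)) = 0"
        by (rule pform_Suc_zero[OF k xb C(1) T(1)]) (unfold tw, rule g(3)[OF pos_tuples_slice[OF k x]])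
      show "pform xs (Suc k) (dual_diff F f g) (x(j := y\<^sub>2)) = 0"
        by (rule pform_Suc_zero[OF k xb C(2) T(2)]) (unfold tw, rule g(4)[OF pos_tuples_slice[OF k x]])
    qed
  qed
  then show ?case using g by blast
qed

text \<open>Monotonicity and subadditivity are those of the meet with w. For continuity, the slice
  of s is written as the slice of d plus some r, and the truncation passes on at most r y of this
  increase.\<close>

lemma gauge_truncated_slice:
  assumes k: "k < m" and xs: "pos_oc_tuple xs" and x: "x \<in> pos_tuples (idx (Suc k)) E"
    and w: "w \<in> pcone (dual (E (\<rho> (Suc k))))" and y: "y \<in> pcone (E (\<rho> (Suc k)))"
  shows "gauge F (\<lambda>g. vinf (dual (E (\<rho> (Suc k)))) (slice xs k g x) w y)"
proof -
  let ?j = "\<rho> (Suc k)" and ?G = "dual (E (\<rho> (Suc k)))"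
  interpret F: riesz_space F by (rule F)
  interpret F': riesz_space "dual F" by (rule F.riesz_space_dual)
  interpret Ej: riesz_space "E ?j" using rho_mem[OF k] by (rule E_idx)
  interpret G: riesz_space ?G by (rule Ej.riesz_space_dual)
  note P = pos_oc_pos[OF xs]
  let ?T = "\<lambda>g. slice xs k g x"
  have TP: "?T g \<in> pcone ?G" if "g \<in> pcone (dual F)" for g by (rule slice_pcone[OF k P that x])
  have TC: "?T g \<in> carrier ?G" if "g \<in> pcone (dual F)" for g by (rule G.pcone_closed[OF TP[OF that]])
  have wC: "w \<in> carrier ?G" using w by (rule G.pcone_closed)
  have ev: "f y \<le> g y" if "f \<preceq>\<^bsub>?G\<^esub> g" for f g using that y by (simp add: dual_vle)
  have yC: "y \<in> carrier (E ?j)" using y by (rule Ej.pcone_closed)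
  have nonneg: "0 \<le> vinf ?G (?T g) w y" if "g \<in> pcone (dual F)" for g
    by (rule pcone_dual_nonneg[OF G.vinf_pcone[OF TP[OF that] w] y])
  have mono: "vinf ?G (?T g) w y \<le> vinf ?G (?T h) w y"
    if g: "g \<in> pcone (dual F)" and h: "h \<in> pcone (dual F)" and le: "g \<unlhd>\<^bsub>F\<^esub> h" for g h
    by (rule ev[OF G.vinf_mono[OF slice_mono_functional[OF k P _ _ le x] TC[OF g] TC[OF h] wC]])
      (use g h pcone_dual_closed in auto)
  have add: "vinf ?G (u \<oplus>\<^bsub>?G\<^esub> v) w y \<le> vinf ?G u w y + vinf ?G v w y" if u: "u \<in> pcone ?G" and v: "v \<in> pcone ?G" for u v
    using ev[OF G.vinf_add_le[OF u v w]] yC by simp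
  have Tadd: "?T (g \<oplus>\<^bsub>dual F\<^esub> h) = ?T g \<oplus>\<^bsub>?G\<^esub> ?T h"
    if g: "g \<in> pcone (dual F)" and h: "h \<in> pcone (dual F)" for g h
  proof (rule extensionalityI[of _ "carrier (E ?j)"])
    fix t assume t: "t \<in> carrier (E ?j)"
    have C: "g \<in> carrier (dual F)" "h \<in> carrier (dual F)"
      "g \<oplus>\<^bsub>dual F\<^esub> h \<in> carrier (dual F)"
      using F'.pcone_add[OF g h] g h pcone_dual_closed by blast+
    have "?T (g \<oplus>\<^bsub>dual F\<^esub> h) t = 1 * ?T g t + 1 * ?T h t"
      by (rule slice_lincomb[OF k pos_bidual_bidual[OF P] C _ pos_tuples_tuples[OF x] t]) simp
    then show "?T (g \<oplus>\<^bsub>dual F\<^esub> h) t = (?T g \<oplus>\<^bsub>?G\<^esub> ?T h) t" using t by simp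
  qed (auto simp: slice_def)
  have sup: "\<exists>d\<in>D. vinf ?G (?T s) w y < vinf ?G (?T d) w y + e" if D: "directed_sup F D s" and e: "0 < e" for D s e
  proof -
    have "directed_sup (E ?j) (?T ` D) (?T s)"
      using pform_directed_sup[OF xs D] k by (intro directed_sup_slice[OF k P D _ x]) auto
    then obtain d where d: "d \<in> D" "?T s y < ?T d y + e"
      using y e unfolding directed_sup_def by blast
    have dP: "d \<in> pcone (dual F)" "s \<in> pcone (dual F)" "d \<unlhd>\<^bsub>F\<^esub> s"
      using d D by (auto simp: directed_sup_def)
    have "?T d \<preceq>\<^bsub>?G\<^esub> ?T s"
      using dP pcone_dual_closed by (intro slice_mono_functional[OF k P _ _ _ x])
    then obtain r where r: "r \<in> pcone ?G" "?T s = ?T d \<oplus>\<^bsub>?G\<^esub> r"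
      using G.vle_iff TC dP by blast
    have "vinf ?G (?T s) w y \<le> vinf ?G (?T d) w y + vinf ?G r w y"
      unfolding r(2) by (rule add[OF TP[OF dP(1)] r(1)])
    also have "\<dots> \<le> vinf ?G (?T d) w y + r y"
      using ev[OF G.vinf_lower(1)[OF G.pcone_closed[OF r(1)] wC]] by simp
    also have "r y = ?T s y - ?T d y" using fun_cong[OF r(2), of y] yC by simp
    finally show ?thesis using d by (intro bexI[of _ d]) auto
  qed
  show ?thesis
    unfolding gauge_def using nonneg mono sup by (auto simp: Tadd[simplified] add[OF TP TP, simplified])
qed

text \<open>The tests cross over: the slice of g is truncated by w, the part of h on which \<eta>
  vanishes, and the slice of f - g by u. A slice below h that is disjoint from w lies below u + 2 r,
  and \<xi> vanishes there.\<close>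

lemma separation_slice:
  assumes k: "k < m" and xs: "pos_oc_tuple xs" and f: "f \<in> pcone (dual F)"
    and x: "x \<in> pos_tuples (idx (Suc k)) E"
    and \<xi>: "gauge (E (\<rho> (Suc k))) \<xi>" and \<eta>: "gauge (E (\<rho> (Suc k))) \<eta>"
    and d: "vdisjoint (bidual (\<rho> (Suc k))) \<xi> \<eta>"
  shows "\<exists>g\<in>pcone (dual F). g \<unlhd>\<^bsub>F\<^esub> f \<and>
    \<xi> (slice xs k g x) = 0 \<and> \<eta> (slice xs k (dual_diff F f g) x) = 0"
proof -
  let ?j = "\<rho> (Suc k)" and ?G = "dual (E (\<rho> (Suc k)))"
  interpret F: riesz_space F by (rule F)
  interpret F': riesz_space "dual F" by (rule F.riesz_space_dual)
  interpret Ej: riesz_space "E ?j" using rho_mem[OF k] by (rule E_idx)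
  interpret G: riesz_space ?G by (rule Ej.riesz_space_dual)
  note P = pos_oc_pos[OF xs]
  note PC = pcone_dual_closed
  let ?T = "\<lambda>g. slice xs k g x"
  have TP: "?T g \<in> pcone ?G" if "g \<in> pcone (dual F)" for g by (rule slice_pcone[OF k P that x])
  define h where "h = ?T f"
  have h: "h \<in> pcone ?G" unfolding h_def using f by (rule TP)
  have fC: "f \<in> carrier (dual F)" using f by (rule PC)
  have \<xi>P: "\<xi> \<in> pcone (bidual ?j)" and \<eta>P: "\<eta> \<in> pcone (bidual ?j)" using d by (auto simp: vdisjoint_def)
  have \<xi>C: "\<xi> \<in> carrier (bidual ?j)" and \<eta>C: "\<eta> \<in> carrier (bidual ?j)" using \<xi>P \<eta>P PC by auto
  have diffG: "dual_diff (E ?j) h g \<in> pcone ?G" "h = g \<oplus>\<^bsub>?G\<^esub> dual_diff (E ?j) h g"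
    if g: "g \<in> pcone ?G" and le: "g \<preceq>\<^bsub>?G\<^esub> h" for g
  proof -
    show "dual_diff (E ?j) h g \<in> pcone ?G" by (rule Ej.dual_diff_pcone[OF PC[OF h] PC[OF g] le])
    show "h = g \<oplus>\<^bsub>?G\<^esub> dual_diff (E ?j) h g"
      using Ej.dual_ext[OF PC[OF h]] by (simp add: dual_diff_def cong: restrict_cong)
  qed
  \<comment> \<open>Disjointness of \<xi> and \<eta>, evaluated at h, yields approximate separators
    among the functionals below h; \<open>Ej.exact_separation\<close> makes them exact.\<close>
  have apG: "\<exists>g\<in>pcone ?G. g \<preceq>\<^bsub>?G\<^esub> h \<and> \<xi> g < e \<and> \<eta> (dual_diff (E ?j) h g) < e" if e: "0 < e" for e
  proof -
    obtain a b where ab: "a \<in> pcone ?G" "b \<in> pcone ?G" "h = a \<oplus>\<^bsub>?G\<^esub> b" "\<xi> a + \<eta> b < e"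
      using G.dual_disjoint_approx[OF d h e] by metis
    have "0 \<le> \<xi> a" "0 \<le> \<eta> b"
      using pcone_dual_nonneg[OF \<xi>P ab(1)] pcone_dual_nonneg[OF \<eta>P ab(2)] by auto
    moreover have "a \<preceq>\<^bsub>?G\<^esub> h" using G.vle_add[OF PC[OF ab(1)] ab(2)] ab(3) by simp
    moreover have "dual_diff (E ?j) h a = b"
      using Ej.dual_ext[OF PC[OF ab(2)]] ab(3) by (simp add: dual_diff_def cong: restrict_cong)
    ultimately show ?thesis using ab by (intro bexI[of _ a]) auto
  qed
  \<comment> \<open>Split \<open>h\<close> into disjoint parts and a rest that is null for both functionals.\<close>
  obtain u\<^sub>0 where u0: "u\<^sub>0 \<in> pcone ?G" "u\<^sub>0 \<preceq>\<^bsub>?G\<^esub> h" "\<xi> u\<^sub>0 = 0" "\<eta> (dual_diff (E ?j) h u\<^sub>0) = 0"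
    using Ej.exact_separation[OF \<xi> \<eta> h apG] by blast
  obtain r u w where r: "r \<in> pcone ?G" and u: "u \<in> pcone ?G" and w: "w \<in> pcone ?G"
    and sp: "u\<^sub>0 = u \<oplus>\<^bsub>?G\<^esub> r" "dual_diff (E ?j) h u\<^sub>0 = w \<oplus>\<^bsub>?G\<^esub> r" and uw: "vdisjoint ?G u w"
    using G.vdisjoint_remainder[OF u0(1) diffG(1)[OF u0(1,2)]] by metis
  note C = PC[OF r] PC[OF u] PC[OF w]
  have hs: "h = (u \<oplus>\<^bsub>?G\<^esub> r) \<oplus>\<^bsub>?G\<^esub> (w \<oplus>\<^bsub>?G\<^esub> r)" using diffG(2)[OF u0(1,2)] sp by simp
  have null: "\<xi> (u \<oplus>\<^bsub>?G\<^esub> r) = 0" "\<xi> r = 0" "\<eta> (w \<oplus>\<^bsub>?G\<^esub> r) = 0" "\<eta> r = 0"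
  proof -
    show *: "\<xi> (u \<oplus>\<^bsub>?G\<^esub> r) = 0" "\<eta> (w \<oplus>\<^bsub>?G\<^esub> r) = 0" using u0 sp by auto
    have "0 \<le> \<xi> u" "0 \<le> \<xi> r" "0 \<le> \<eta> w" "0 \<le> \<eta> r"
      using pcone_dual_nonneg[OF \<xi>P] pcone_dual_nonneg[OF \<eta>P] u w r by auto
    then show "\<xi> r = 0" "\<eta> r = 0"
      using * functional_add[OF \<xi>C C(2,1)] functional_add[OF \<eta>C C(3,1)] by linarith+
  qed
  have "\<exists>g\<in>pcone (dual F). g \<unlhd>\<^bsub>F\<^esub> f \<and>
    (\<forall>y\<in>pcone (E ?j). vinf ?G (?T g) w y = 0 \<and> vinf ?G (?T (dual_diff F f g)) u y = 0)"
  proof (rule F.simultaneous_separation[of "pcone (E ?j)" "\<lambda>y g. vinf ?G (?T g) w y"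
        "\<lambda>y g. vinf ?G (?T g) u y" f])
    fix y assume y: "y \<in> pcone (E ?j)"
    show "gauge F (\<lambda>g. vinf ?G (?T g) w y)" "gauge F (\<lambda>g. vinf ?G (?T g) u y)"
      using k xs x u w y by (auto intro: gauge_truncated_slice)
    fix e :: real assume "0 < e"
    then have e: "0 < e/2" by simp
    \<comment> \<open>u is small on \<open>y\<^sub>1\<close> and w on \<open>y\<^sub>2\<close>, but
      these two need not be disjoint, as the known splittings require. Their common part n is
      removed and estimated separately.\<close>
    obtain y\<^sub>1 y\<^sub>2 where y12: "y\<^sub>1 \<in> pcone (E ?j)" "y\<^sub>2 \<in> pcone (E ?j)" "y = y\<^sub>1 \<oplus>\<^bsub>E ?j\<^esub> y\<^sub>2" "u y\<^sub>1 + w y\<^sub>2 < e/2"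
      using Ej.dual_disjoint_approx[OF uw y e] by metis
    obtain n z\<^sub>1 z\<^sub>2 where z: "n \<in> pcone (E ?j)" "z\<^sub>1 \<in> pcone (E ?j)" "z\<^sub>2 \<in> pcone (E ?j)"
      "y\<^sub>1 = z\<^sub>1 \<oplus>\<^bsub>E ?j\<^esub> n" "y\<^sub>2 = z\<^sub>2 \<oplus>\<^bsub>E ?j\<^esub> n" "vdisjoint (E ?j) z\<^sub>1 z\<^sub>2"
      using Ej.vdisjoint_remainder[OF y12(1,2)] by metis
    have zC: "n \<in> carrier (E ?j)" "z\<^sub>1 \<in> carrier (E ?j)" "z\<^sub>2 \<in> carrier (E ?j)"
      using z Ej.pcone_closed by auto
    obtain g where g: "g \<in> pcone (dual F)" "g \<unlhd>\<^bsub>F\<^esub> f"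
      "\<And>x. x \<in> pos_tuples (idx k) E \<Longrightarrow> pform xs k g (x(?j := z\<^sub>1)) = 0"
      "\<And>x. x \<in> pos_tuples (idx k) E \<Longrightarrow> pform xs k (dual_diff F f g) (x(?j := z\<^sub>2)) = 0"
      using separation_argument[OF xs f z(6) less_imp_le[OF k] rho_mem[OF k]] by blast
    have fg: "dual_diff F f g \<in> pcone (dual F)" by (rule F.dual_diff_pcone[OF fC PC[OF g(1)] g(2)])
    have Tz: "?T g z\<^sub>1 = 0" "?T (dual_diff F f g) z\<^sub>2 = 0"
      using g(3)[OF pos_tuples_slice[OF k x z(2)]] g(4)[OF pos_tuples_slice[OF k x z(3)]] zC
      by (simp_all add: slice_def)
    have split: "v y = v z\<^sub>1 + v z\<^sub>2 + 2 * v n" if "v \<in> pcone ?G" for v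
      using functional_add[OF PC[OF that]] y12(3) z(4,5) zC by simp
    have bound: "0 \<le> u z\<^sub>1" "0 \<le> u n" "0 \<le> w z\<^sub>2" "0 \<le> w n" "u y\<^sub>1 = u z\<^sub>1 + u n" "w y\<^sub>2 = w z\<^sub>2 + w n"
      using pcone_dual_nonneg[OF u] pcone_dual_nonneg[OF w] functional_add[OF C(2)]
        functional_add[OF C(3)] z zC by auto
    have vl: "vinf ?G a b \<in> pcone ?G" "\<And>t. t \<in> pcone (E ?j) \<Longrightarrow> vinf ?G a b t \<le> a t"
      "\<And>t. t \<in> pcone (E ?j) \<Longrightarrow> vinf ?G a b t \<le> b t" if "a \<in> pcone ?G" "b \<in> pcone ?G" for a b
      using G.vinf_pcone[OF that] G.vinf_lower[OF PC[OF that(1)] PC[OF that(2)]]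
      by (auto simp: dual_vle)
    \<comment> \<open>On \<open>z\<^sub>1\<close> the slice of g vanishes, and on
      \<open>z\<^sub>2\<close> and n the truncation is at most w. Since n occurs twice in y, the
      total is at most twice the value of w at \<open>y\<^sub>2\<close>; hence the choice of
      e/2.\<close>
    have "vinf ?G (?T g) w y < e"
      using split[OF vl(1)[OF TP[OF g(1)] w]] vl(2)[OF TP[OF g(1)] w z(2)] vl(3)[OF TP[OF g(1)] w z(3)]
        vl(3)[OF TP[OF g(1)] w z(1)] Tz(1) bound y12(4) by linarith
    moreover have "vinf ?G (?T (dual_diff F f g)) u y < e"
      using split[OF vl(1)[OF TP[OF fg] u]] vl(2)[OF TP[OF fg] u z(3)] vl(3)[OF TP[OF fg] u z(2)]
        vl(3)[OF TP[OF fg] u z(1)] Tz(2) bound y12(4) by linarith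
    ultimately show "\<exists>g\<in>pcone (dual F). g \<unlhd>\<^bsub>F\<^esub> f \<and> vinf ?G (?T g) w y < e \<and>
        vinf ?G (?T (dual_diff F f g)) u y < e" using g by blast
  next
    fix y z assume yz: "y \<in> pcone (E ?j)" "z \<in> pcone (E ?j)"
    have mono: "v y \<le> v (y \<oplus>\<^bsub>E ?j\<^esub> z) \<and> v z \<le> v (y \<oplus>\<^bsub>E ?j\<^esub> z)" if "v \<in> pcone ?G" for v
      using functional_add[OF PC[OF that]] pcone_dual_nonneg[OF that] yz Ej.pcone_closed by auto
    show "\<exists>k\<in>pcone (E ?j). \<forall>g\<in>pcone (dual F).
        vinf ?G (?T g) w y \<le> vinf ?G (?T g) w k \<and> vinf ?G (?T g) w z \<le> vinf ?G (?T g) w k \<and>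
        vinf ?G (?T g) u y \<le> vinf ?G (?T g) u k \<and> vinf ?G (?T g) u z \<le> vinf ?G (?T g) u k"
      using mono[OF G.vinf_pcone[OF TP w]] mono[OF G.vinf_pcone[OF TP u]] Ej.pcone_add[OF yz]
      by (intro bexI[of _ "y \<oplus>\<^bsub>E ?j\<^esub> z"]) auto
  qed (rule f)
  then obtain g where g: "g \<in> pcone (dual F)" "g \<unlhd>\<^bsub>F\<^esub> f"
    "\<And>y. y \<in> pcone (E ?j) \<Longrightarrow> vinf ?G (?T g) w y = 0"
    "\<And>y. y \<in> pcone (E ?j) \<Longrightarrow> vinf ?G (?T (dual_diff F f g)) u y = 0"
    by blast
  have fg: "dual_diff F f g \<in> pcone (dual F)" by (rule F.dual_diff_pcone[OF fC PC[OF g(1)] g(2)])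
  have gf: "dual_diff F f g \<unlhd>\<^bsub>F\<^esub> f" using g(1) by (rule F.dual_diff_le)
  have Tle: "?T q \<preceq>\<^bsub>?G\<^esub> h" if "q \<in> pcone (dual F)" "q \<unlhd>\<^bsub>F\<^esub> f" for q
    unfolding h_def by (rule slice_mono_functional[OF k P PC[OF that(1)] fC that(2) x])
  \<comment> \<open>In the decomposition of q along a + b, the part e under b lies below q and b,
    hence below their meet, which is 0. This leaves q \<le> a.\<close>
  have vanish: "\<phi> q = 0" if q: "q \<in> pcone ?G" "q \<preceq>\<^bsub>?G\<^esub> a \<oplus>\<^bsub>?G\<^esub> b" and ab: "a \<in> pcone ?G" "b \<in> pcone ?G"
    and m: "\<And>y. y \<in> pcone (E ?j) \<Longrightarrow> vinf ?G q b y = 0" and \<phi>: "\<phi> \<in> pcone (bidual ?j)" "\<phi> a = 0" for \<phi> q a b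
  proof -
    obtain c e where ce: "c \<in> pcone ?G" "e \<in> pcone ?G" "q = c \<oplus>\<^bsub>?G\<^esub> e" "c \<preceq>\<^bsub>?G\<^esub> a" "e \<preceq>\<^bsub>?G\<^esub> b" "e \<preceq>\<^bsub>?G\<^esub> q"
      using G.riesz_decomposition[OF q(1) ab q(2)] by metis
    have "e \<preceq>\<^bsub>?G\<^esub> vinf ?G q b" using ce q ab PC by (intro G.vinf_greatest) auto
    then have "e \<preceq>\<^bsub>?G\<^esub> \<zero>\<^bsub>?G\<^esub>" using m by (auto simp: dual_vle Ej.pcone_closed)
    then have "e = \<zero>\<^bsub>?G\<^esub>" by (rule G.pcone_add_zero[OF ce(2)])
    then have "q = c" using G.M.r_zero[OF PC[OF ce(1)]] ce(3) by simp
    then have "\<phi> q \<le> \<phi> a" using G.functional_mono[OF \<phi>(1) ce(4)] ce(1) ab(1) PC by blast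
    then show ?thesis using \<phi> pcone_dual_nonneg[OF \<phi>(1) q(1)] by simp
  qed
  have "\<xi> (?T g) = 0"
  proof (rule vanish[OF TP[OF g(1)] _ _ w g(3) \<xi>P])
    show "?T g \<preceq>\<^bsub>?G\<^esub> (u \<oplus>\<^bsub>?G\<^esub> r \<oplus>\<^bsub>?G\<^esub> r) \<oplus>\<^bsub>?G\<^esub> w"
      using Tle[OF g(1,2)] unfolding hs G.M.a_assoc[OF G.M.a_closed[OF C(2,1)] C(1) C(3)]
        G.M.a_comm[OF C(1,3)] .
    show "u \<oplus>\<^bsub>?G\<^esub> r \<oplus>\<^bsub>?G\<^esub> r \<in> pcone ?G" using u r by (intro G.pcone_add)
    show "\<xi> (u \<oplus>\<^bsub>?G\<^esub> r \<oplus>\<^bsub>?G\<^esub> r) = 0"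
      using functional_add[OF \<xi>C G.M.a_closed[OF C(2,1)] C(1)] null by simp
  qed
  moreover have "\<eta> (?T (dual_diff F f g)) = 0"
  proof (rule vanish[OF TP[OF fg] _ _ u g(4) \<eta>P])
    have "h = (w \<oplus>\<^bsub>?G\<^esub> r \<oplus>\<^bsub>?G\<^esub> r) \<oplus>\<^bsub>?G\<^esub> u"
    proof (rule extensionalityI[of _ "carrier (E ?j)"])
      show "h t = ((w \<oplus>\<^bsub>?G\<^esub> r \<oplus>\<^bsub>?G\<^esub> r) \<oplus>\<^bsub>?G\<^esub> u) t" if "t \<in> carrier (E ?j)" for t
        using that hs by simp
    qed (use h in \<open>auto simp: pcone_def dual_carrier\<close>)
    then show "?T (dual_diff F f g) \<preceq>\<^bsub>?G\<^esub> (w \<oplus>\<^bsub>?G\<^esub> r \<oplus>\<^bsub>?G\<^esub> r) \<oplus>\<^bsub>?G\<^esub> u"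
      using Tle[OF fg gf] by simp
    show "w \<oplus>\<^bsub>?G\<^esub> r \<oplus>\<^bsub>?G\<^esub> r \<in> pcone ?G" using w r by (intro G.pcone_add)
    show "\<eta> (w \<oplus>\<^bsub>?G\<^esub> r \<oplus>\<^bsub>?G\<^esub> r) = 0"
      using functional_add[OF \<eta>C G.M.a_closed[OF C(3,1)] C(1)] null by simp
  qed
  ultimately show ?thesis using g by blast
qed

text \<open>The claim begins at the stage that reads entry j, since j \<in> \<open>idx k\<close>
  before it. At that stage the splittings for single tuples are made uniform; later stages only
  transport them.\<close>

lemma separation_functional:
  assumes zs: "pos_oc_tuple zs" and f: "f \<in> pcone (dual F)"
    and xs: "pos_oc_tuple (zs(j := \<xi>))" and ys: "pos_oc_tuple (zs(j := \<eta>))"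
    and j: "j \<in> {1..m}" and d: "vdisjoint (bidual j) \<xi> \<eta>"
  shows "\<lbrakk>k \<le> m; j \<notin> idx k\<rbrakk> \<Longrightarrow> \<exists>g\<in>pcone (dual F). g \<unlhd>\<^bsub>F\<^esub> f \<and>
    (\<forall>x\<in>pos_tuples (idx k) E. pform (zs(j := \<xi>)) k g x = 0 \<and> pform (zs(j := \<eta>)) k (dual_diff F f g) x = 0)"
proof (induction k)
  case 0
  then show ?case using j by (simp add: idx_0)
next
  case (Suc k)
  then have k: "k < m" by simp
  interpret F: riesz_space F by (rule F)
  note PC = pcone_dual_closed
  show ?case
  proof (cases "j = \<rho> (Suc k)")
    case False
    then have "j \<notin> idx k" using Suc.prems(2) by (simp add: idx_Suc)
    then obtain g where g: "g \<in> pcone (dual F)" "g \<unlhd>\<^bsub>F\<^esub> f"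
      "\<And>x. x \<in> pos_tuples (idx k) E \<Longrightarrow> pform (zs(j := \<xi>)) k g x = 0"
      "\<And>x. x \<in> pos_tuples (idx k) E \<Longrightarrow> pform (zs(j := \<eta>)) k (dual_diff F f g) x = 0"
      using Suc.IH[OF less_imp_le[OF k] \<open>j \<notin> idx k\<close>] by blast
    have C: "g \<in> carrier (dual F)" "dual_diff F f g \<in> carrier (dual F)"
      using PC[OF g(1)] dual_diff_closed[OF PC[OF f]] by auto
    have "pform (zs(j := \<xi>)) (Suc k) g x = 0 \<and> pform (zs(j := \<eta>)) (Suc k) (dual_diff F f g) x = 0"
      if x: "x \<in> pos_tuples (idx (Suc k)) E" for x
      by (intro conjI pform_Suc_zero[OF k pos_bidual_bidual[OF pos_oc_pos] _ pos_tuples_tuples[OF x]]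
          xs ys C g(3,4) pos_tuples_slice[OF k x])
    then show ?thesis using g by blast
  next
    case True
    \<comment> \<open>Entry j has not been read in the first k stages, so \<xi> and \<eta> act on
      slices of one and the same form.\<close>
    have sl: "slice (zs(j := \<upsilon>)) k g x = slice zs k g x" for \<upsilon> g x
      unfolding slice_def True pform_upd[OF rho_mem[OF k]] ..
    have ev: "pform (zs(j := \<upsilon>)) (Suc k) g x = \<upsilon> (slice zs k g x)" if x: "x \<in> pos_tuples (idx (Suc k)) E" for \<upsilon> g x
      unfolding pform_Suc[OF pos_tuples_tuples[OF x]] sl unfolding True by (simp only: fun_upd_same)
    have ga: "gauge (E (\<rho> (Suc k))) \<xi>" "gauge (E (\<rho> (Suc k))) \<eta>"
      using pos_oc_gauge[OF xs j] pos_oc_gauge[OF ys j] True by auto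
    show ?thesis
    proof (rule F.simultaneous_separation[of "pos_tuples (idx (Suc k)) E"
          "\<lambda>x g. pform (zs(j := \<xi>)) (Suc k) g x" "\<lambda>x g. pform (zs(j := \<eta>)) (Suc k) g x" f])
      fix x assume x: "x \<in> pos_tuples (idx (Suc k)) E"
      show "gauge F (\<lambda>g. pform (zs(j := \<xi>)) (Suc k) g x)" "gauge F (\<lambda>g. pform (zs(j := \<eta>)) (Suc k) g x)"
        by (rule pform_gauge[OF Suc.prems(1) xs x] pform_gauge[OF Suc.prems(1) ys x])+
      fix e :: real assume e: "0 < e"
      obtain g where "g \<in> pcone (dual F)" "g \<unlhd>\<^bsub>F\<^esub> f"
        "\<xi> (slice zs k g x) = 0" "\<eta> (slice zs k (dual_diff F f g) x) = 0"
        using separation_slice[OF k zs f x ga] d True by blast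
      then show "\<exists>g\<in>pcone (dual F). g \<unlhd>\<^bsub>F\<^esub> f \<and> pform (zs(j := \<xi>)) (Suc k) g x < e \<and>
          pform (zs(j := \<eta>)) (Suc k) (dual_diff F f g) x < e"
        unfolding ev[OF x] using e by (intro bexI[of _ g]) auto
    next
      fix x y assume "x \<in> pos_tuples (idx (Suc k)) E" "y \<in> pos_tuples (idx (Suc k)) E"
      then show "\<exists>z\<in>pos_tuples (idx (Suc k)) E. \<forall>g\<in>pcone (dual F).
        pform (zs(j := \<xi>)) (Suc k) g x \<le> pform (zs(j := \<xi>)) (Suc k) g z \<and>
        pform (zs(j := \<xi>)) (Suc k) g y \<le> pform (zs(j := \<xi>)) (Suc k) g z \<and>
        pform (zs(j := \<eta>)) (Suc k) g x \<le> pform (zs(j := \<eta>)) (Suc k) g z \<and>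
        pform (zs(j := \<eta>)) (Suc k) g y \<le> pform (zs(j := \<eta>)) (Suc k) g z"
        by (intro pform_gauge_directed[OF Suc.prems(1) pos_oc_pos[OF xs] pos_oc_pos[OF ys], of "Suc k" "\<lambda>x. x" "\<lambda>x. x"]) auto
    qed (rule f)
  qed
qed

end

section \<open>Multimorphisms and disjointness\<close>

lemma positive_imp_regular:
  assumes "riesz_space G" "positive_multilinear n K G P" shows "regular_multilinear n K G P"
proof -
  interpret G: riesz_space G by fact
  have "positive_multilinear n K G (\<lambda>_. \<zero>\<^bsub>G\<^esub>)"
    by (auto simp: positive_multilinear_def multilinear_def G.vle_refl)
  moreover have "P x = P x \<ominus>\<^bsub>G\<^esub> \<zero>\<^bsub>G\<^esub>" if "x \<in> tuples {1..n} K" for x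
  proof -
    have "\<ominus>\<^bsub>G\<^esub> \<zero>\<^bsub>G\<^esub> = \<zero>\<^bsub>G\<^esub>" by (rule G.M.minus_equality) simp_all
    moreover have "P x \<in> carrier G"
      using assms(2) that by (auto simp: positive_multilinear_def multilinear_def)
    ultimately show ?thesis by (simp add: G.minus_eq)
  qed
  ultimately show ?thesis using assms(2) unfolding regular_multilinear_def by blast
qed

text \<open>Induction on a set S outside of which the coordinates are positive. For a new coordinate
  j, A x is the difference of the values at the positive and the negative part of x j. By the
  induction hypothesis their absolute values are values of A at positive tuples, hence disjoint, so
  they add up to the absolute value of A x.\<close>

lemma disjointness_preserving_vabs:
  fixes E :: "nat \<Rightarrow> ('a, 'b) ordered_module_scheme" and F :: "('c, 'd) ordered_module_scheme"
  assumes E: "\<And>i. i \<in> {1..m} \<Longrightarrow> riesz_space (E i)" and F: "riesz_space F"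
    and A: "positive_multilinear m E F A"
    and disj: "\<And>x j u v. \<lbrakk>x \<in> pos_tuples {1..m} E; j \<in> {1..m}; vdisjoint (E j) u v\<rbrakk>
      \<Longrightarrow> vdisjoint F (A (x(j := u))) (A (x(j := v)))"
    and x: "x \<in> tuples {1..m} E"
  shows "vabs F (A x) = A (abs_tuple {1..m} E x)"
proof -
  interpret F: riesz_space F by (rule F)
  have closed: "A y \<in> carrier F" if "y \<in> tuples {1..m} E" for y
    using A that by (auto simp: positive_multilinear_def multilinear_def)
  have pos: "A y \<in> pcone F" if "y \<in> pos_tuples {1..m} E" for y
    using A that by (auto simp: positive_multilinear_def multilinear_def pos_tuples_def pcone_def)
  have add: "A (y(i := u \<oplus>\<^bsub>E i\<^esub> v)) = A (y(i := u)) \<oplus>\<^bsub>F\<^esub> A (y(i := v))"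
    if "y \<in> tuples {1..m} E" "i \<in> {1..m}" "u \<in> carrier (E i)" "v \<in> carrier (E i)" for y i u v
    using A that by (auto simp: positive_multilinear_def multilinear_def)
  have abs_pos: "abs_tuple {1..m} E y \<in> pos_tuples {1..m} E" if y: "y \<in> tuples {1..m} E" for y
  proof -
    have "vabs (E i) (y i) \<in> pcone (E i)" if "i \<in> {1..m}" for i
      using riesz_space.vabs_pcone[OF E[OF that] tuples_nth[OF y that]] .
    then show ?thesis by (auto simp: abs_tuple_def pos_tuples_def tuples_def pcone_def)
  qed
  have "finite S \<Longrightarrow> \<forall>x\<in>tuples {1..m} E. (\<forall>i\<in>{1..m} - S. x i \<in> pcone (E i)) \<longrightarrow>
      vabs F (A x) = A (abs_tuple {1..m} E x)" for S
  proof (induction S rule: finite_induct)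
    case empty
    show ?case
    proof (intro ballI impI)
      fix x assume x: "x \<in> tuples {1..m} E" and P: "\<forall>i\<in>{1..m} - {}. x i \<in> pcone (E i)"
      then have "x \<in> pos_tuples {1..m} E" by (simp add: pos_tuples_def)
      moreover have "abs_tuple {1..m} E x = x"
      proof (rule extensionalityI[of _ "{1..m}"])
        show "abs_tuple {1..m} E x i = x i" if "i \<in> {1..m}" for i
          using riesz_space.vabs_pos[OF E[OF that]] P that by (simp add: abs_tuple_def)
      qed (use x in \<open>auto simp: abs_tuple_def tuples_def PiE_iff\<close>)
      ultimately show "vabs F (A x) = A (abs_tuple {1..m} E x)" using F.vabs_pos[OF pos] by simp
    qed
  next
    case (insert j S)
    show ?case
    proof (intro ballI impI)
      fix x assume x: "x \<in> tuples {1..m} E" and P: "\<forall>i\<in>{1..m} - insert j S. x i \<in> pcone (E i)"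
      show "vabs F (A x) = A (abs_tuple {1..m} E x)"
      proof (cases "j \<in> {1..m}")
        case False
        then show ?thesis using insert.IH x P by auto
      next
        case j: True
        interpret Ej: riesz_space "E j" using j by (rule E)
        have xj: "x j \<in> carrier (E j)" using x j by (rule tuples_nth)
        obtain p n where pn: "p \<in> pcone (E j)" "n \<in> pcone (E j)" "p = x j \<oplus>\<^bsub>E j\<^esub> n"
          "vabs (E j) (x j) = p \<oplus>\<^bsub>E j\<^esub> n" "vdisjoint (E j) p n"
          using Ej.jordan_decomposition[OF xj] by metis
        have C: "p \<in> carrier (E j)" "n \<in> carrier (E j)" using pn Ej.pcone_closed by auto
        define a where "a = abs_tuple {1..m} E x"
        have aP: "a \<in> pos_tuples {1..m} E" unfolding a_def using x by (rule abs_pos)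
        have IH: "vabs F (A (x(j := q))) = A (a(j := q))" if q: "q \<in> pcone (E j)" for q
        proof -
          have "abs_tuple {1..m} E (x(j := q)) = a(j := q)"
            using Ej.vabs_pos[OF q] j by (auto simp: a_def abs_tuple_def)
          moreover have "x(j := q) \<in> tuples {1..m} E"
            using x j Ej.pcone_closed[OF q] by (rule tuples_upd)
          moreover have "\<forall>i\<in>{1..m} - S. (x(j := q)) i \<in> pcone (E i)" using P q by simp
          ultimately show ?thesis using insert.IH by metis
        qed
        have xn: "x(j := x j) = x" by simp
        have T: "x(j := q) \<in> tuples {1..m} E" if "q \<in> carrier (E j)" for q
          using x j that by (rule tuples_upd)
        have "vabs F (A x) = vabs F (A (x(j := p))) \<oplus>\<^bsub>F\<^esub> vabs F (A (x(j := n)))"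
        proof (rule F.vabs_diff_disjoint[OF closed[OF T[OF C(1)]] closed[OF T[OF C(2)]] closed[OF x]])
          show "A (x(j := p)) = A x \<oplus>\<^bsub>F\<^esub> A (x(j := n))"
            using add[OF x j xj C(2)] unfolding pn(3)[symmetric] xn .
          show "vdisjoint F (vabs F (A (x(j := p)))) (vabs F (A (x(j := n))))"
            unfolding IH[OF pn(1)] IH[OF pn(2)] by (rule disj[OF aP j pn(5)])
        qed
        also have "\<dots> = A (a(j := p \<oplus>\<^bsub>E j\<^esub> n))"
          unfolding IH[OF pn(1)] IH[OF pn(2)] by (rule add[OF pos_tuples_tuples[OF aP] j C, symmetric])
        also have "a(j := p \<oplus>\<^bsub>E j\<^esub> n) = a" using pn(4) j by (auto simp: a_def abs_tuple_def)
        finally show ?thesis by (simp add: a_def)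
      qed
    qed
  qed
  from this[of "{1..m}"] x show ?thesis by simp
qed

section \<open>Order continuous functionals as an ideal\<close>

lemma (in riesz_space) order_continuous_below:
  assumes f: "f \<in> pcone (dual E)" and g: "order_continuous E g" and le: "f \<unlhd> g"
  shows "order_continuous E f"
proof (rule order_continuousI[OF f])
  fix D and e :: real assume D: "down_null E D" and "0 < e"
  then obtain d where d: "d \<in> D" "\<And>d'. \<lbrakk>d' \<in> D; d' \<preceq> d\<rbrakk> \<Longrightarrow> \<bar>g d'\<bar> < e"
    using order_continuous_tail[OF g D] by metis
  then have "d \<in> pcone E" using D by (auto simp: down_null_def)
  then have "f d \<le> g d" "\<bar>g d\<bar> < e" using le d vle_refl pcone_closed by (auto simp: dual_vle)
  then show "\<exists>d\<in>D. f d < e" using d by force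
qed

text \<open>A positive functional below an order continuous one is order continuous, so the larger
  space contributes no further positive lower bounds.\<close>

lemma (in riesz_space) vdisjoint_oc_order_dual:
  assumes "vdisjoint (oc_order_dual E) f g" shows "vdisjoint (dual E) f g"
proof -
  interpret D: riesz_space "dual E" by (rule riesz_space_dual)
  interpret O: riesz_space "oc_order_dual E" by (rule riesz_space_oc_order_dual)
  have f: "f \<in> pcone (dual E)" "order_continuous E f" and g: "g \<in> pcone (dual E)"
    using assms by (auto simp: vdisjoint_def pcone_oc_order_dual)
  show ?thesis
  proof (rule D.vdisjointI[OF f(1) g])
    fix t assume t: "t \<in> pcone (dual E)" "t \<unlhd> f" "t \<unlhd> g"
    then have "t \<in> pcone (oc_order_dual E)"
      using order_continuous_below[OF t(1) f(2) t(2)] by (simp add: pcone_oc_order_dual)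
    then have "t = \<zero>\<^bsub>oc_order_dual E\<^esub>" using O.vdisjoint_zeroD[OF assms] t by simp
    then show "t = \<zero>\<^bsub>dual E\<^esub>" by simp
  qed
qed

section \<open>The Arens extension as an operator into the bidual\<close>

context arens
begin

text \<open>Stage m at the only tuple over the empty index set. In contrast to
  \<open>arens_extension\<close> it is not restricted to tuples of biduals, so entries can be
  updated without side conditions.\<close>

definition arens_op :: "(nat \<Rightarrow> ('a \<Rightarrow> real) \<Rightarrow> real) \<Rightarrow> ('b \<Rightarrow> real) \<Rightarrow> real" where
  "arens_op xs = (\<lambda>y\<in>carrier (dual F). pform xs m y (\<lambda>_. undefined))"

lemma empty_tuple: "(\<lambda>_. undefined) \<in> pos_tuples (idx m) E"
  by (simp add: idx_m pos_tuples_def tuples_def)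

lemma arens_extension_eq:
  "xs \<in> tuples {1..m} (\<lambda>i. bidual i) \<Longrightarrow> arens_extension m E F \<rho> A xs = arens_op xs"
  by (simp add: arens_extension_def arens_op_def pform_def)

lemma arens_op_linear: assumes xs: "bidual_tuple xs" shows "linear_functional (dual F) (arens_op xs)"
proof -
  interpret F: riesz_space F by (rule F)
  note T = pos_tuples_tuples[OF empty_tuple]
  have 1: "(\<lambda>x\<in>carrier F. f x + g x) \<in> carrier (dual F)"
    "pform xs m (\<lambda>x\<in>carrier F. f x + g x) (\<lambda>_. undefined) = pform xs m f (\<lambda>_. undefined) + pform xs m g (\<lambda>_. undefined)"
    if "f \<in> carrier (dual F)" "g \<in> carrier (dual F)" for f g
    using pform_lincomb[OF xs that F.dual_add_closed[OF that], of 1 1 m "\<lambda>_. undefined"] T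
      F.dual_add_closed[OF that] by simp_all
  have 2: "(\<lambda>x\<in>carrier F. c * f x) \<in> carrier (dual F)"
    "pform xs m (\<lambda>x\<in>carrier F. c * f x) (\<lambda>_. undefined) = c * pform xs m f (\<lambda>_. undefined)"
    if "f \<in> carrier (dual F)" for f c
    using pform_lincomb[OF xs that that F.dual_smult_closed[OF that], of c c 0 m "\<lambda>_. undefined"] T
      F.dual_smult_closed[OF that] by simp_all
  show ?thesis
    unfolding linear_functional_def using 1 2 by (auto simp: arens_op_def)
qed

lemma arens_op_pos:
  assumes xs: "pos_bidual_tuple xs" shows "arens_op xs \<in> pcone (dual (dual F))"
proof -
  interpret F': riesz_space "dual F" using F by (rule riesz_space.riesz_space_dual)
  show ?thesis
    using arens_op_linear[OF pos_bidual_bidual[OF xs]] pform_nonneg[OF order_refl xs _ empty_tuple]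
    by (intro F'.positive_linear_in_dual) (auto simp: arens_op_def pcone_dual)
qed

text \<open>For arguments that need not be positive, the operator at the absolute data dominates, by
  the estimate of the last stage.\<close>

lemma arens_op_closed:
  assumes xs: "bidual_tuple xs" shows "arens_op xs \<in> carrier (dual (dual F))"
proof -
  interpret F': riesz_space "dual F" using F by (rule riesz_space.riesz_space_dual)
  have e: "abs_tuple (idx m) E (\<lambda>_. undefined) = (\<lambda>_. undefined)" by (rule abs_tuple_pos[OF empty_tuple])
  show ?thesis
  proof (rule F'.dominated_functional(1)[OF _ arens_op_linear[OF xs] arens_op_pos[OF pos_bidual_abs[OF xs]]])
    fix t assume t: "t \<in> carrier (dual F)"
    show "\<bar>arens_op xs t\<bar> \<le> arens_op (abs_bidual xs) (vabs (dual F) t)"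
      using dominated_abs[OF dominated[OF order_refl] xs t pos_tuples_tuples[OF empty_tuple]] t F'.vabs_closed[OF t]
      unfolding e arens_op_def by simp
  qed (simp add: arens_op_def)
qed

text \<open>A positive t below both values satisfies t f = t g + t (f - g) for the splitting of f,
  and each summand is bounded by 0.\<close>

lemma arens_op_disjoint:
  assumes zs: "pos_oc_tuple zs" and j: "j \<in> {1..m}" and d: "vdisjoint (bidual j) \<xi> \<eta>"
    and oc: "order_continuous (dual (E j)) \<xi>" "order_continuous (dual (E j)) \<eta>"
  shows "vdisjoint (dual (dual F)) (arens_op (zs(j := \<xi>))) (arens_op (zs(j := \<eta>)))"
proof -
  interpret F: riesz_space F by (rule F)
  interpret F': riesz_space "dual F" by (rule F.riesz_space_dual)
  interpret F'': riesz_space "dual (dual F)" by (rule F'.riesz_space_dual)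
  have P: "\<xi> \<in> pcone (bidual j)" "\<eta> \<in> pcone (bidual j)" using d by (auto simp: vdisjoint_def)
  have xs: "pos_oc_tuple (zs(j := \<xi>))" "pos_oc_tuple (zs(j := \<eta>))"
    using zs P oc by (auto simp: pos_oc_tuple_def)
  show ?thesis
  proof (rule F''.vdisjointI)
    show "arens_op (zs(j := \<xi>)) \<in> pcone (dual (dual F))" "arens_op (zs(j := \<eta>)) \<in> pcone (dual (dual F))"
      using xs by (auto intro: arens_op_pos pos_oc_pos)
    fix t assume t: "t \<in> pcone (dual (dual F))"
      "t \<unlhd>\<^bsub>dual F\<^esub> arens_op (zs(j := \<xi>))" "t \<unlhd>\<^bsub>dual F\<^esub> arens_op (zs(j := \<eta>))"
    have tC: "t \<in> carrier (dual (dual F))" using t by (simp add: pcone_def)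
    show "t = \<zero>\<^bsub>dual (dual F)\<^esub>"
    proof (rule functional_pos_eqI[OF F'.riesz_space_axioms tC F''.M.zero_closed])
      fix f assume f: "f \<in> pcone (dual F)"
      have fC: "f \<in> carrier (dual F)" using f by (rule pcone_dual_closed)
      have "j \<notin> idx m" by (simp add: idx_m)
      from separation_functional[OF zs f xs j d order_refl this]
      obtain g where g: "g \<in> pcone (dual F)" "g \<unlhd>\<^bsub>F\<^esub> f"
        "pform (zs(j := \<xi>)) m g (\<lambda>_. undefined) = 0" "pform (zs(j := \<eta>)) m (dual_diff F f g) (\<lambda>_. undefined) = 0"
        using empty_tuple by blast
      have gC: "g \<in> carrier (dual F)" using g by (simp add: pcone_def)
      let ?h = "dual_diff F f g"
      have h: "?h \<in> pcone (dual F)" by (rule F.dual_diff_pcone[OF fC gC g(2)])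
      have hC: "?h \<in> carrier (dual F)" using h by (rule pcone_dual_closed)
      have "f = g \<oplus>\<^bsub>dual F\<^esub> ?h"
        using F.dual_ext[OF fC] by (simp add: dual_diff_def cong: restrict_cong)
      then have "t f = t g + t ?h" using functional_add[OF tC gC hC] by simp
      also have "t g \<le> arens_op (zs(j := \<xi>)) g" using t(2) g(1) unfolding dual_vle by blast
      also have "arens_op (zs(j := \<xi>)) g = 0" using g(3) gC by (simp only: arens_op_def restrict_apply' refl)
      also have "t ?h \<le> arens_op (zs(j := \<eta>)) ?h" using t(3) h unfolding dual_vle by blast
      also have "arens_op (zs(j := \<eta>)) ?h = 0" using g(4) hC by (simp only: arens_op_def restrict_apply' refl)
      finally have "t f \<le> 0" by simp
      moreover have "0 \<le> t f" using t(1) f by (rule pcone_dual_nonneg)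
      ultimately show "t f = \<zero>\<^bsub>dual (dual F)\<^esub> f" using fC by simp
    qed
  qed
qed

lemma arens_op_lincomb:
  assumes xs: "bidual_tuple xs" and i: "i \<in> {1..m}"
    and C: "\<xi> \<in> carrier (bidual i)" "\<eta> \<in> carrier (bidual i)" "\<zeta> \<in> carrier (bidual i)"
    and eq: "\<And>h. h \<in> carrier (dual (E i)) \<Longrightarrow> \<zeta> h = c * \<xi> h + d * \<eta> h"
    and f: "f \<in> carrier (dual F)"
  shows "arens_op (xs(i := \<zeta>)) f = c * arens_op (xs(i := \<xi>)) f + d * arens_op (xs(i := \<eta>)) f"
proof -
  have "i \<notin> idx m" by (simp add: idx_m)
  from pform_bidual_lincomb[OF xs f i C eq order_refl pos_tuples_tuples[OF empty_tuple] this]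
  show ?thesis using f unfolding arens_op_def by (simp only: restrict_apply')
qed

definition oc_spaces :: "nat \<Rightarrow> (('a \<Rightarrow> real) \<Rightarrow> real) ordered_module" where
  "oc_spaces i = oc_order_dual (dual (E i))"

lemma oc_tuples:
  assumes "xs \<in> tuples {1..m} oc_spaces"
  shows "bidual_tuple xs" "xs \<in> tuples {1..m} (\<lambda>i. bidual i)"
  using assms by (auto simp: tuples_def oc_spaces_def bidual_tuple_def PiE_iff oc_order_dual_carrier)

lemma pos_oc_tuples: "xs \<in> pos_tuples {1..m} oc_spaces \<Longrightarrow> pos_oc_tuple xs"
  by (auto simp: pos_tuples_def oc_spaces_def pos_oc_tuple_def pcone_oc_order_dual)

lemma positive_multilinear_arens_op:
  "positive_multilinear m oc_spaces (dual (dual F)) (restrict arens_op (tuples {1..m} oc_spaces))"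
  (is "positive_multilinear m _ ?G ?pform")
proof -
  have upd: "xs(i := \<xi>) \<in> tuples {1..m} oc_spaces"
    if "xs \<in> tuples {1..m} oc_spaces" "i \<in> {1..m}" "\<xi> \<in> carrier (oc_spaces i)" for xs i \<xi>
    using that by (rule tuples_upd)
  have ext: "arens_op xs \<in> extensional (carrier (dual F))" for xs by (simp add: arens_op_def)
  have oc_riesz: "riesz_space (oc_spaces i)" if "i \<in> {1..m}" for i
    unfolding oc_spaces_def by (intro riesz_space.riesz_space_oc_order_dual riesz_space.riesz_space_dual E that)
  have add: "arens_op (xs(i := \<xi> \<oplus>\<^bsub>oc_spaces i\<^esub> \<eta>)) = arens_op (xs(i := \<xi>)) \<oplus>\<^bsub>?G\<^esub> arens_op (xs(i := \<eta>))"
    and addC: "\<xi> \<oplus>\<^bsub>oc_spaces i\<^esub> \<eta> \<in> carrier (oc_spaces i)"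
    if xs: "xs \<in> tuples {1..m} oc_spaces" and i: "i \<in> {1..m}" and C: "\<xi> \<in> carrier (oc_spaces i)"
      "\<eta> \<in> carrier (oc_spaces i)" for xs i \<xi> \<eta>
  proof -
    interpret O: riesz_space "oc_spaces i" using i by (rule oc_riesz)
    show addC: "\<xi> \<oplus>\<^bsub>oc_spaces i\<^esub> \<eta> \<in> carrier (oc_spaces i)" using C by (rule O.M.a_closed)
    have C': "\<xi> \<in> carrier (bidual i)" "\<eta> \<in> carrier (bidual i)" "\<xi> \<oplus>\<^bsub>oc_spaces i\<^esub> \<eta> \<in> carrier (bidual i)"
      using C addC by (auto simp: oc_spaces_def oc_order_dual_carrier)
    show "arens_op (xs(i := \<xi> \<oplus>\<^bsub>oc_spaces i\<^esub> \<eta>)) = arens_op (xs(i := \<xi>)) \<oplus>\<^bsub>?G\<^esub> arens_op (xs(i := \<eta>))"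
    proof (rule extensionalityI[OF ext])
      fix f assume f: "f \<in> carrier (dual F)"
      have "arens_op (xs(i := \<xi> \<oplus>\<^bsub>oc_spaces i\<^esub> \<eta>)) f = 1 * arens_op (xs(i := \<xi>)) f + 1 * arens_op (xs(i := \<eta>)) f"
        by (rule arens_op_lincomb[OF oc_tuples(1)[OF xs] i C' _ f]) (simp add: oc_spaces_def)
      then show "arens_op (xs(i := \<xi> \<oplus>\<^bsub>oc_spaces i\<^esub> \<eta>)) f = (arens_op (xs(i := \<xi>)) \<oplus>\<^bsub>?G\<^esub> arens_op (xs(i := \<eta>))) f"
        using f by simp
    qed simp
  qed
  have smult: "arens_op (xs(i := c \<odot>\<^bsub>oc_spaces i\<^esub> \<xi>)) = c \<odot>\<^bsub>?G\<^esub> arens_op (xs(i := \<xi>))"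
    and smultC: "c \<odot>\<^bsub>oc_spaces i\<^esub> \<xi> \<in> carrier (oc_spaces i)"
    if xs: "xs \<in> tuples {1..m} oc_spaces" and i: "i \<in> {1..m}" and C: "\<xi> \<in> carrier (oc_spaces i)" for xs i \<xi> c
  proof -
    interpret O: riesz_space "oc_spaces i" using i by (rule oc_riesz)
    show smultC: "c \<odot>\<^bsub>oc_spaces i\<^esub> \<xi> \<in> carrier (oc_spaces i)" using C by simp
    have C': "\<xi> \<in> carrier (bidual i)" "c \<odot>\<^bsub>oc_spaces i\<^esub> \<xi> \<in> carrier (bidual i)"
      using C smultC by (auto simp: oc_spaces_def oc_order_dual_carrier)
    show "arens_op (xs(i := c \<odot>\<^bsub>oc_spaces i\<^esub> \<xi>)) = c \<odot>\<^bsub>?G\<^esub> arens_op (xs(i := \<xi>))"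
    proof (rule extensionalityI[OF ext])
      fix f assume f: "f \<in> carrier (dual F)"
      \<comment> \<open>The rule for linear combinations is applied with coefficients c and 0, and
        \<xi> itself fills the idle slot.\<close>
      have "arens_op (xs(i := c \<odot>\<^bsub>oc_spaces i\<^esub> \<xi>)) f = c * arens_op (xs(i := \<xi>)) f + 0 * arens_op (xs(i := \<xi>)) f"
        by (rule arens_op_lincomb[OF oc_tuples(1)[OF xs] i C'(1,1,2) _ f]) (simp add: oc_spaces_def)
      then show "arens_op (xs(i := c \<odot>\<^bsub>oc_spaces i\<^esub> \<xi>)) f = (c \<odot>\<^bsub>?G\<^esub> arens_op (xs(i := \<xi>))) f"
        using f by simp
    qed simp
  qed
  have restr: "?pform xs = arens_op xs" if "xs \<in> tuples {1..m} oc_spaces" for xs using that by simp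
  show ?thesis
    unfolding positive_multilinear_def multilinear_def
  proof (intro conjI ballI allI impI)
    show "?pform \<in> tuples {1..m} oc_spaces \<rightarrow> carrier ?G" using arens_op_closed oc_tuples(1) by simp
    fix xs assume xs: "xs \<in> tuples {1..m} oc_spaces"
    {
      assume "\<forall>i\<in>{1..m}. \<zero>\<^bsub>oc_spaces i\<^esub> \<preceq>\<^bsub>oc_spaces i\<^esub> xs i"
      then have "xs \<in> pos_tuples {1..m} oc_spaces" using xs by (auto simp: pos_tuples_def pcone_def tuples_def)
      then have "arens_op xs \<in> pcone ?G" by (intro arens_op_pos pos_oc_pos pos_oc_tuples)
      then show "\<zero>\<^bsub>?G\<^esub> \<preceq>\<^bsub>?G\<^esub> ?pform xs" unfolding restr[OF xs] by (simp add: pcone_def)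
    next
      fix i \<xi> c assume i: "i \<in> {1..m}" and \<xi>: "\<xi> \<in> carrier (oc_spaces i)"
      show "?pform (xs(i := c \<odot>\<^bsub>oc_spaces i\<^esub> \<xi>)) = c \<odot>\<^bsub>?G\<^esub> ?pform (xs(i := \<xi>))"
        unfolding restr[OF upd[OF xs i smultC[OF xs i \<xi>]]] restr[OF upd[OF xs i \<xi>]] by (rule smult[OF xs i \<xi>])
      fix \<eta> assume \<eta>: "\<eta> \<in> carrier (oc_spaces i)"
      show "?pform (xs(i := \<xi> \<oplus>\<^bsub>oc_spaces i\<^esub> \<eta>)) = ?pform (xs(i := \<xi>)) \<oplus>\<^bsub>?G\<^esub> ?pform (xs(i := \<eta>))"
        unfolding restr[OF upd[OF xs i addC[OF xs i \<xi> \<eta>]]] restr[OF upd[OF xs i \<xi>]] restr[OF upd[OF xs i \<eta>]]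
        by (rule add[OF xs i \<xi> \<eta>])
    }
  qed
qed

lemma riesz_multimorphism_arens_op:
  "riesz_multimorphism m oc_spaces (dual (dual F)) (restrict arens_op (tuples {1..m} oc_spaces))"
  (is "riesz_multimorphism m _ ?G ?pform")
proof -
  have G: "riesz_space ?G" by (intro riesz_space.riesz_space_dual F)
  have oc: "riesz_space (oc_spaces i)" if "i \<in> {1..m}" for i
    unfolding oc_spaces_def by (intro riesz_space.riesz_space_oc_order_dual riesz_space.riesz_space_dual E that)
  have disj: "vdisjoint ?G (?pform (xs(j := \<xi>))) (?pform (xs(j := \<eta>)))"
    if xs: "xs \<in> pos_tuples {1..m} oc_spaces" and j: "j \<in> {1..m}" and d: "vdisjoint (oc_spaces j) \<xi> \<eta>" for xs j \<xi> \<eta>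
  proof -
    have C: "\<xi> \<in> pcone (oc_spaces j)" "\<eta> \<in> pcone (oc_spaces j)" using d by (auto simp: vdisjoint_def)
    then have oc: "order_continuous (dual (E j)) \<xi>" "order_continuous (dual (E j)) \<eta>"
      by (auto simp: oc_spaces_def pcone_oc_order_dual)
    have T: "xs(j := \<xi>) \<in> tuples {1..m} oc_spaces" "xs(j := \<eta>) \<in> tuples {1..m} oc_spaces"
      using pos_tuples_upd[OF xs j C(1)] pos_tuples_upd[OF xs j C(2)] pos_tuples_tuples by blast+
    \<comment> \<open>Disjointness is given among order continuous functionals but is needed in the
      whole bidual.\<close>
    have "vdisjoint (bidual j) \<xi> \<eta>"
      using riesz_space.vdisjoint_oc_order_dual[OF riesz_space.riesz_space_dual[OF E[OF j]]] d
      by (simp add: oc_spaces_def)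
    from arens_op_disjoint[OF pos_oc_tuples[OF xs] j this oc] show ?thesis
      unfolding restrict_apply'[OF T(1)] restrict_apply'[OF T(2)] .
  qed
  have "vabs ?G (?pform xs) = ?pform (abs_tuple {1..m} oc_spaces xs)" if "xs \<in> tuples {1..m} oc_spaces" for xs
    by (rule disjointness_preserving_vabs[OF _ G positive_multilinear_arens_op _ that]) (rule oc disj; assumption)+
  then show ?thesis
    unfolding riesz_multimorphism_def
    using oc G positive_imp_regular[OF G positive_multilinear_arens_op] by (simp add: abs_tuple_def)
qed

end

theorem proposition3p1:
  fixes m :: nat
    and E :: "nat \<Rightarrow> 'a ordered_module"
    and F :: "'b ordered_module"
    and A :: "(nat \<Rightarrow> 'a) \<Rightarrow> 'b"
    and \<rho> :: "nat \<Rightarrow> nat"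
  assumes "1 \<le> m"
    and "\<And>i. i \<in> {1..m} \<Longrightarrow> archimedean_riesz_space (E i)"
    and "riesz_space F"
    and "riesz_multimorphism m E F A"
    and "\<rho> permutes {1..m}"
  shows "riesz_multimorphism m (\<lambda>i. oc_order_dual (order_dual (E i))) (order_dual (order_dual F))
     (restrict (arens_extension m E F \<rho> A)
        (tuples {1..m} (\<lambda>i. oc_order_dual (order_dual (E i)))))"
proof -
  interpret arens m E F A \<rho>
    by (rule arens.intro[OF archimedean_riesz_space.axioms(1)[OF assms(2)] assms(4,5)])
  have oc: "(\<lambda>i. oc_order_dual (order_dual (E i))) = oc_spaces" by (simp add: fun_eq_iff oc_spaces_def)
  have "restrict (arens_extension m E F \<rho> A) (tuples {1..m} oc_spaces) = restrict arens_op (tuples {1..m} oc_spaces)"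
    by (rule restrict_ext) (rule arens_extension_eq[OF oc_tuples(2)])
  then show ?thesis unfolding oc using riesz_multimorphism_arens_op by simp
qed

end
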